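(* Let the family $\{\mu_a\}_{a\in A}\subset\mathscr{P}(\Omega)$ satisfy the following four conditions: for every $B\in\mathcal{B}(\Omega)$, the function $a\mapsto\mu_a(B)$ is measurable; for every $\beta\in\mathbb{N}^p$ there is a polynomial $p_\beta\in\mathbb{R}[a]$ with $\int_\Omega\omega^\beta d\mu_a(\omega)=p_\beta(a)$ for all $a\in A$; for every $a\in A$ and every nonzero $g\in\mathbb{R}[\omega]$, $\mu_a(\{\omega\in\Omega: g(\omega)=0\})=0$; for every bounded measurable (resp. bounded continuous) function $q$ on $X\times\Omega$, the function $(x,a)\mapsto\int_\Omega q(x,\omega)d\mu_a(\omega)$ is bounded measurable (resp. bounded continuous) on $X\times A$. If $\Omega$ is unbounded, assume also that there exist $c,\gamma>0$ such that $\sup_{a\in A}\int_\Omega\exp(c|\omega_i|)\,d\mu_a(\omega)<\gamma$ for $i=1,\dots,p$. Assume that $K$, $A$, $X\times\Omega$ and $(X\times\Omega)\setminus K$ all have nonempty interior. Let $\rho_d$ be the optimal value of the semidefinite program $(\mathrm{SDP}_d)$ and $\rho^*_d$ that of its dual $(\mathrm{SDP}^*_d)$, $d\ge d_{\min}$, both given in the context. Then: (i) Slater's condition holds for $(\mathrm{SDP}_d)$ (i.e. there is a feasible solution at which all the matrices constrained to be positive semidefinite are positive definite), and so strong duality holds: for every $d\ge d_{\min}$, $\rho^*_d=\rho_d$ and $(\mathrm{SDP}^*_d)$ has an optimal solution, with polynomials $(h_d,w_d)$. (ii) For $\varepsilon>0$ define $X^d_\varepsilon:=\{x\in X: w_d(x)<\varepsilon\}$.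 Then $X^d_\varepsilon\subset X^*_\varepsilon$ for every $d\ge d_{\min}$. In addition, if $\lim_{d\to\infty}\rho_d=\rho$, where $$\rho=\sup_{\phi,\psi}\{\,\phi(K):\ \phi\le T^*\psi,\ \psi_x=\lambda,\ \phi\in\mathscr{M}_+(K),\ \psi\in\mathscr{P}(X\times A)\,\},$$ then $$\lim_{d\to\infty}\|w_d-\kappa\|_{L_1(X,\lambda)}=0\qquad\text{and}\qquad\lim_{d\to\infty}\lambda(X^*_\varepsilon\setminus X^d_\varepsilon)=0.$$
   Context: Sets. $X=\{x\in\mathbb{R}^n: g_j(x)\ge0,\ j=1,\dots,m\}$ and $A=\{a\in\mathbb{R}^t: q_\ell(a)\ge0,\ \ell=1,\dots,L\}$ are compact, $\Omega=\{\omega\in\mathbb{R}^p: s_\ell(\omega)\ge0,\ \ell=1,\dots,\bar s\}$ is not necessarily compact ($\bar s=0$ means $\Omega=\mathbb{R}^p$), with $g_j\in\mathbb{R}[x]$, $q_\ell\in\mathbb{R}[a]$, $s_\ell\in\mathbb{R}[\omega]$. For some $M>0$, $g_1(x)=M-\|x\|^2$, $q_1(a)=M-\|a\|^2$, and, if $\Omega$ is compact, $s_1(\omega)=M-\|\omega\|^2$. $\lambda$ is the Lebesgue measure on $X$ normalized to a probability measure, $\lambda_\alpha=\int_X x^\alpha d\lambda$. For a closed set $Z$: $\mathcal{B}(Z)$ is its Borel $\sigma$-field, $\mathscr{P}(Z)$, $\mathscr{M}(Z)$, $\mathscr{M}_+(Z)$ are respectively the probability, finite signed, and finite positive Borel measures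 on $Z$. Family of measures. $\mu_a\in\mathscr{P}(\Omega)$ for $a\in A$, with the following properties: for every $B\in\mathcal{B}(\Omega)$, $a\mapsto\mu_a(B)$ is measurable; for every $\beta\in\mathbb{N}^p$ there is a polynomial $p_\beta\in\mathbb{R}[a]$ with $\int_\Omega\omega^\beta d\mu_a(\omega)=p_\beta(a)$ for all $a\in A$ (these $p_\beta$ are fixed); for every $a\in A$ and every nonzero $g\in\mathbb{R}[\omega]$, $\mu_a(\{g=0\})=0$; for every bounded measurable (resp. bounded continuous) $q$ on $X\times\Omega$, $(x,a)\mapsto\int_\Omega q(x,\omega)d\mu_a(\omega)$ is bounded measurable (resp. bounded continuous) on $X\times A$; and, if $\Omega$ is unbounded, there exist $c,\gamma>0$ such that $\sup_{a\in A}\int_\Omega\exp(c|\omega_i|)\,d\mu_a(\omega)<\gamma$ for $i=1,\dots,p$. $\mathscr{M}_a$ is the set of mixtures $\mu(B)=\int_A\mu_a(B)\,d\varphi(a)$, $B\in\mathcal{B}(\Omega)$, $\varphi\in\mathscr{P}(A)$. $f\in\mathbb{R}[x,\omega]$ is given, $K=\{(x,\omega)\in X\times\Omega: f(x,\omega)\le0\}$, $K_x=\{\omega\in\Omega:(x,\omega)\in K\}$, $X^*_\varepsilon=\{x\in X:\mathrm{Prob}_\mu(f(x,\omega)>0)>1-\varepsilon\ \forall\mu\in\mathscr{M}_a\}$, and $\kappa(x)=\max\{\mu(K_x):\mu\in\mathscr{M}_a\}=\max\{\mu_a(K_x):a\in A\}$ for $x\in X$ (a measurable function; the maxima are attained).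 Operator $T$. $Tg(x,a)=\int_\Omega g(x,\omega)d\mu_a(\omega)$ for $g$ bounded measurable on $X\times\Omega$; $T^*:\mathscr{M}(X\times A)\to\mathscr{M}(X\times\Omega)$ is defined by $\int g\,d(T^*\psi)=\int Tg\,d\psi$ for all such $g$. $\psi_x$ is the marginal of $\psi$ on $X$; $\phi\in\mathscr{M}_+(K)$ is viewed as a measure on $X\times\Omega$ and $\le$ is the setwise order. Moment notation. For a real sequence $z$ indexed by monomials, $L_z$ is the linear functional on polynomials mapping each monomial to the corresponding entry of $z$. $M_d(z)$ is the matrix with rows and columns indexed by monomials of degree at most $d$ and entries $L_z(\text{product of the two monomials})$; for a polynomial $g$, the localizing matrix $M_d(g\,z)$ has entries $L_z(g\cdot\text{product of the two monomials})$. $\Sigma[\cdot]_k$ is the cone of sums of squares of polynomials of degree at most $k$. Semidefinite programs. Put $g_{m+1}=-f$, $g_0=1$, $d_0=0$, $d_j=\lceil\deg(g_j)/2\rceil$ ($1\le j\le m+1$), $d'_\ell=\lceil\deg(q_\ell)/2\rceil$, $d^1_\ell=\lceil\deg(s_\ell)/2\rceil$, and $d_{\min}$ the maximum of all these integers. For $d\ge d_{\min}$, with unknowns $y=(y_{\alpha\beta})$, $u=(u_{\alpha\beta})$ (indexed by monomials $x^\alpha\omega^\beta$ of degree $\le 2d$) and $v=(v_{\alpha\eta})$ (indexed by monomials $x^\alpha a^\eta$ of degree $\le2d$): $(\mathrm{SDP}_d)$: $\rho_d=\sup_{y,u,v}y_{00}$ subject to - $L_{y+u}(x^\alpha\omega^\beta)-L_v(x^\alpha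 p_\beta(a))=0$ for all $(\alpha,\beta)\in I_d:=\{(\alpha,\beta)\in\mathbb{N}^n\times\mathbb{N}^p:\ |\alpha|+|\beta|\le2d,\ |\alpha|+\deg(p_\beta)\le 2d\}$; - $L_v(x^\alpha)=\lambda_\alpha$ for all $|\alpha|\le2d$; - $M_d(y),M_d(u),M_d(v)\succeq0$; $M_{d-d_{m+1}}(g_{m+1}\,y)\succeq0$; - $M_{d-d_j}(g_j\,y),M_{d-d_j}(g_j\,u),M_{d-d_j}(g_j\,v)\succeq0$, $j=1,\dots,m$; - $M_{d-d^1_\ell}(s_\ell\,y),M_{d-d^1_\ell}(s_\ell\,u)\succeq0$, $\ell=1,\dots,\bar s$; - $M_{d-d'_\ell}(q_\ell\,v)\succeq0$, $\ell=1,\dots,L$. $(\mathrm{SDP}^*_d)$: $\rho^*_d=\inf\int_X w\,d\lambda$ over $w\in\mathbb{R}[x]$ with $\deg w\le 2d$, $h=\sum_{(\alpha,\beta)\in I_d}h_{\alpha\beta}x^\alpha\omega^\beta$ and sums of squares $\sigma^i_j,\tau^i_\ell$, subject to the polynomial identities - $h(x,\omega)-1=\sum_{j=0}^{m+1}\sigma^1_jg_j+\sum_{\ell=1}^{\bar s}\tau^1_\ell s_\ell$; - $h(x,\omega)=\sum_{j=0}^{m}\sigma^2_jg_j+\sum_{\ell=1}^{\bar s}\tau^2_\ell s_\ell$; - $w(x)-\sum_{\alpha,\beta}h_{\alpha\beta}x^\alpha p_\beta(a)=\sum_{j=0}^m\sigma^3_jg_j+\sum_{\ell=1}^L\tau^3_\ell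 q_\ell$; with $\sigma^1_j,\sigma^2_j\in\Sigma[x,\omega]_{d-d_j}$, $\sigma^3_j\in\Sigma[x,a]_{d-d_j}$, $\tau^1_\ell,\tau^2_\ell\in\Sigma[x,\omega]_{d-d^1_\ell}$, $\tau^3_\ell\in\Sigma[x,a]_{d-d'_\ell}$. *)

theory Defs
  imports "HOL-Probability.Probability" "HOL-Library.Poly_Mapping"
begin

text \<open>
  A polynomial in variables indexed by a finite type \<open>'v\<close> is a finitely supported map from
  exponents to coefficients; the ring structure is the convolution structure of Poly_Mapping.
  \<open>\<real>[x]\<close>, \<open>\<real>[\<omega>]\<close>, \<open>\<real>[a]\<close> use the index types \<open>'n\<close>, \<open>'p\<close>, \<open>'t\<close>; \<open>\<real>[x,\<omega>]\<close> and \<open>\<real>[x,a]\<close>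
  use \<open>'n + 'p\<close> and \<open>'n + 't\<close>.
\<close>

type_synonym 'v mon = "'v \<Rightarrow>\<^sub>0 nat"
type_synonym 'v mpol = "('v \<Rightarrow>\<^sub>0 nat) \<Rightarrow>\<^sub>0 real"

definition mon_deg :: "'v::finite mon \<Rightarrow> nat" where
  "mon_deg \<alpha> = (\<Sum>i\<in>UNIV. Poly_Mapping.lookup \<alpha> i)"

text \<open>The zero polynomial gets degree 0. This only matters for \<open>p\<^sub>\<beta> = 0\<close> in the index set \<open>idx\<close>
  below, where the convention \<open>-\<infinity>\<close> would give the same set.\<close>

definition pol_deg :: "'v::finite mpol \<Rightarrow> nat" where
  "pol_deg q = Max (insert 0 (mon_deg ` Poly_Mapping.keys q))"

definition half_deg :: "'v::finite mpol \<Rightarrow> nat" where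
  "half_deg q = nat \<lceil>real (pol_deg q) / 2\<rceil>"

definition mon_eval :: "('v::finite \<Rightarrow> real) \<Rightarrow> 'v mon \<Rightarrow> real" where
  "mon_eval v \<alpha> = (\<Prod>i\<in>UNIV. v i ^ Poly_Mapping.lookup \<alpha> i)"

definition pol_eval :: "('v::finite \<Rightarrow> real) \<Rightarrow> 'v mpol \<Rightarrow> real" where
  "pol_eval v q = (\<Sum>\<alpha>\<in>Poly_Mapping.keys q. Poly_Mapping.lookup q \<alpha> * mon_eval v \<alpha>)"

abbreviation ev1 :: "'v mpol \<Rightarrow> real ^ 'v::finite \<Rightarrow> real" where
  "ev1 q z \<equiv> pol_eval (($) z) q"

abbreviation ev2 :: "('v + 'w) mpol \<Rightarrow> (real ^ 'v::finite) \<times> (real ^ 'w::finite) \<Rightarrow> real" where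
  "ev2 q z \<equiv> pol_eval (case_sum (($) (fst z)) (($) (snd z))) q"

abbreviation mono_pol :: "'v mon \<Rightarrow> 'v mpol" where
  "mono_pol \<alpha> \<equiv> Poly_Mapping.single \<alpha> 1"

abbreviation const_pol :: "real \<Rightarrow> 'v mpol" where
  "const_pol c \<equiv> Poly_Mapping.single 0 c"

text \<open>Renaming of variables; with \<open>Inl\<close> and \<open>Inr\<close> this is the embedding of \<open>\<real>[x]\<close> and
  \<open>\<real>[\<omega>]\<close> into \<open>\<real>[x,\<omega>]\<close> (and of \<open>\<real>[x]\<close> and \<open>\<real>[a]\<close> into \<open>\<real>[x,a]\<close>).\<close>

definition mon_rename :: "('v \<Rightarrow> 'w) \<Rightarrow> 'v mon \<Rightarrow> 'w mon" where
  "mon_rename \<iota> \<alpha> = (\<Sum>i\<in>Poly_Mapping.keys \<alpha>. Poly_Mapping.single (\<iota> i) (Poly_Mapping.lookup \<alpha> i))"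

definition pol_rename :: "('v \<Rightarrow> 'w) \<Rightarrow> 'v mpol \<Rightarrow> 'w mpol" where
  "pol_rename \<iota> q = (\<Sum>\<alpha>\<in>Poly_Mapping.keys q. Poly_Mapping.single (mon_rename \<iota> \<alpha>) (Poly_Mapping.lookup q \<alpha>))"

definition mon_join :: "'v mon \<Rightarrow> 'w mon \<Rightarrow> ('v + 'w) mon" where
  "mon_join \<alpha> \<beta> = mon_rename Inl \<alpha> + mon_rename Inr \<beta>"

definition ball_pol :: "real \<Rightarrow> 'v::finite mpol" where
  "ball_pol M = const_pol M - (\<Sum>i\<in>UNIV. mono_pol (Poly_Mapping.single i 2))"

text \<open>The cone \<open>\<Sigma>[\<cdot>]\<^sub>k\<close>: \<open>k\<close> bounds the degree of the polynomials that are squared.\<close>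

definition sos :: "nat \<Rightarrow> 'v::finite mpol set" where
  "sos k = {\<Sum>q\<leftarrow>qs. q * q | qs. \<forall>q\<in>set qs. pol_deg q \<le> k}"

text \<open>A truncated moment sequence is represented by a total function on exponents. In the
  programs below only the entries of degree at most \<open>2d\<close> occur.\<close>

definition riesz :: "('v mon \<Rightarrow> real) \<Rightarrow> 'v mpol \<Rightarrow> real" where
  "riesz z q = (\<Sum>\<alpha>\<in>Poly_Mapping.keys q. Poly_Mapping.lookup q \<alpha> * z \<alpha>)"

definition mons :: "nat \<Rightarrow> 'v::finite mon set" where
  "mons d = {\<alpha>. mon_deg \<alpha> \<le> d}"

definition loc_mat :: "'v mpol \<Rightarrow> ('v mon \<Rightarrow> real) \<Rightarrow> 'v mon \<Rightarrow> 'v mon \<Rightarrow> real" where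
  "loc_mat g z \<alpha> \<beta> = riesz z (g * (mono_pol \<alpha> * mono_pol \<beta>))"

definition mom_mat :: "('v mon \<Rightarrow> real) \<Rightarrow> 'v mon \<Rightarrow> 'v mon \<Rightarrow> real" where
  "mom_mat z \<alpha> \<beta> = riesz z (mono_pol \<alpha> * mono_pol \<beta>)"

definition psd_on :: "'i set \<Rightarrow> ('i \<Rightarrow> 'i \<Rightarrow> real) \<Rightarrow> bool" where
  "psd_on I A \<longleftrightarrow> (\<forall>i\<in>I. \<forall>j\<in>I. A i j = A j i) \<and>
     (\<forall>c. 0 \<le> (\<Sum>i\<in>I. \<Sum>j\<in>I. c i * A i j * c j))"

definition pd_on :: "'i set \<Rightarrow> ('i \<Rightarrow> 'i \<Rightarrow> real) \<Rightarrow> bool" where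
  "pd_on I A \<longleftrightarrow> (\<forall>i\<in>I. \<forall>j\<in>I. A i j = A j i) \<and>
     (\<forall>c. (\<exists>i\<in>I. c i \<noteq> 0) \<longrightarrow> 0 < (\<Sum>i\<in>I. \<Sum>j\<in>I. c i * A i j * c j))"

definition borel_on :: "'a::topological_space set \<Rightarrow> 'a measure" where
  "borel_on Z = restrict_space borel Z"

definition prob_meas :: "'a::topological_space set \<Rightarrow> 'a measure set" where
  "prob_meas Z = {\<nu>. sets \<nu> = sets (borel_on Z) \<and> prob_space \<nu>}"

definition fin_meas :: "'a::topological_space set \<Rightarrow> 'a measure set" where
  "fin_meas Z = {\<nu>. sets \<nu> = sets (borel_on Z) \<and> finite_measure \<nu>}"

definition bdd_measurable_on :: "'a::topological_space set \<Rightarrow> ('a \<Rightarrow> real) \<Rightarrow> bool" where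
  "bdd_measurable_on Z q \<longleftrightarrow> q \<in> borel_measurable (borel_on Z) \<and> bounded (q ` Z)"

definition bdd_continuous_on :: "'a::topological_space set \<Rightarrow> ('a \<Rightarrow> real) \<Rightarrow> bool" where
  "bdd_continuous_on Z q \<longleftrightarrow> continuous_on Z q \<and> bounded (q ` Z)"

text \<open>The families \<open>g\<close>, \<open>q\<close>, \<open>s\<close> are indexed from 1; \<open>pp \<beta>\<close> is \<open>p\<^sub>\<beta>\<close>.\<close>

record ('n::finite, 'p::finite, 't::finite) data =
  ng :: nat
  gg :: "nat \<Rightarrow> 'n mpol"
  nq :: nat
  qq :: "nat \<Rightarrow> 't mpol"
  ns :: nat
  ss :: "nat \<Rightarrow> 'p mpol"
  ff :: "('n + 'p) mpol"
  mu :: "real ^ 't \<Rightarrow> (real ^ 'p) measure"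
  pp :: "'p mon \<Rightarrow> 't mpol"

definition XX :: "('n::finite, 'p::finite, 't::finite) data \<Rightarrow> (real ^ 'n) set" where
  "XX P = {x. \<forall>j\<in>{1..ng P}. 0 \<le> ev1 (gg P j) x}"

definition AA :: "('n::finite, 'p::finite, 't::finite) data \<Rightarrow> (real ^ 't) set" where
  "AA P = {a. \<forall>l\<in>{1..nq P}. 0 \<le> ev1 (qq P l) a}"

definition Om :: "('n::finite, 'p::finite, 't::finite) data \<Rightarrow> (real ^ 'p) set" where
  "Om P = {\<omega>. \<forall>l\<in>{1..ns P}. 0 \<le> ev1 (ss P l) \<omega>}"

definition lam :: "('n::finite, 'p::finite, 't::finite) data \<Rightarrow> (real ^ 'n) measure" where
  "lam P = uniform_measure (restrict_space lborel (XX P)) (XX P)"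

definition KK :: "('n::finite, 'p::finite, 't::finite) data \<Rightarrow> ((real ^ 'n) \<times> (real ^ 'p)) set" where
  "KK P = {z \<in> XX P \<times> Om P. ev2 (ff P) z \<le> 0}"

definition Kx :: "('n::finite, 'p::finite, 't::finite) data \<Rightarrow> real ^ 'n \<Rightarrow> (real ^ 'p) set" where
  "Kx P x = {\<omega> \<in> Om P. (x, \<omega>) \<in> KK P}"

definition mixtures :: "('n::finite, 'p::finite, 't::finite) data \<Rightarrow> (real ^ 'p) measure set" where
  "mixtures P = {\<nu>. sets \<nu> = sets (borel_on (Om P)) \<and>
     (\<exists>\<phi>\<in>prob_meas (AA P). \<forall>B\<in>sets (borel_on (Om P)).
        emeasure \<nu> B = (\<integral>\<^sup>+ a. emeasure (mu P a) B \<partial>\<phi>))}"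

definition Xstar :: "('n::finite, 'p::finite, 't::finite) data \<Rightarrow> real \<Rightarrow> (real ^ 'n) set" where
  "Xstar P \<epsilon> = {x \<in> XX P. \<forall>\<nu>\<in>mixtures P. measure \<nu> {\<omega> \<in> Om P. ev2 (ff P) (x, \<omega>) > 0} > 1 - \<epsilon>}"

text \<open>\<open>GREATEST\<close> is the maximum, which is attained under the hypotheses of the theorem.\<close>

definition kappa :: "('n::finite, 'p::finite, 't::finite) data \<Rightarrow> real ^ 'n \<Rightarrow> real" where
  "kappa P x = (GREATEST r. \<exists>\<nu>\<in>mixtures P. r = measure \<nu> (Kx P x))"

definition TT :: "('n::finite, 'p::finite, 't::finite) data \<Rightarrow> ((real ^ 'n) \<times> (real ^ 'p) \<Rightarrow> real)
    \<Rightarrow> (real ^ 'n) \<times> (real ^ 't) \<Rightarrow> real" where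
  "TT P g = (\<lambda>(x, a). \<integral>\<omega>. g (x, \<omega>) \<partial>(mu P a))"

text \<open>\<open>T\<^sup>*\<close> on positive measures, the only ones it is applied to (\<open>T\<^sup>*\<close> preserves positivity).\<close>

definition Tadj :: "('n::finite, 'p::finite, 't::finite) data \<Rightarrow> ((real ^ 'n) \<times> (real ^ 't)) measure
    \<Rightarrow> ((real ^ 'n) \<times> (real ^ 'p)) measure" where
  "Tadj P \<psi> = (THE \<nu>. \<nu> \<in> fin_meas (XX P \<times> Om P) \<and>
     (\<forall>g. bdd_measurable_on (XX P \<times> Om P) g \<longrightarrow> (\<integral>z. g z \<partial>\<nu>) = (\<integral>z. TT P g z \<partial>\<psi>)))"

definition rho_feasible :: "('n::finite, 'p::finite, 't::finite) data
    \<Rightarrow> ((real ^ 'n) \<times> (real ^ 'p)) measure \<Rightarrow> ((real ^ 'n) \<times> (real ^ 't)) measure \<Rightarrow> bool" where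
  "rho_feasible P \<phi> \<psi> \<longleftrightarrow> \<phi> \<in> fin_meas (KK P) \<and> \<psi> \<in> prob_meas (XX P \<times> AA P) \<and>
     (\<forall>B\<in>sets (borel_on (XX P \<times> Om P)). emeasure \<phi> (B \<inter> KK P) \<le> emeasure (Tadj P \<psi>) B) \<and>
     distr \<psi> (borel_on (XX P)) fst = lam P"

definition rho :: "('n::finite, 'p::finite, 't::finite) data \<Rightarrow> ereal" where
  "rho P = (SUP (\<phi>, \<psi>) \<in> {(\<phi>, \<psi>). rho_feasible P \<phi> \<psi>}. ereal (measure \<phi> (KK P)))"

text \<open>\<open>gw P j\<close> is \<open>g\<^sub>j\<close> for \<open>0 \<le> j \<le> m + 1\<close> in \<open>\<real>[x,\<omega>]\<close>, with \<open>g\<^sub>0 = 1\<close> and \<open>g\<^sub>m\<^sub>+\<^sub>1 = -f\<close>;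
  \<open>ga P j\<close> is \<open>g\<^sub>j\<close> for \<open>0 \<le> j \<le> m\<close> in \<open>\<real>[x,a]\<close>.\<close>

definition gw :: "('n::finite, 'p::finite, 't::finite) data \<Rightarrow> nat \<Rightarrow> ('n + 'p) mpol" where
  "gw P j = (if j = 0 then 1 else if j = ng P + 1 then - ff P else pol_rename Inl (gg P j))"

definition ga :: "('n::finite, 'p::finite, 't::finite) data \<Rightarrow> nat \<Rightarrow> ('n + 't) mpol" where
  "ga P j = (if j = 0 then 1 else pol_rename Inl (gg P j))"

definition sw :: "('n::finite, 'p::finite, 't::finite) data \<Rightarrow> nat \<Rightarrow> ('n + 'p) mpol" where
  "sw P l = pol_rename Inr (ss P l)"

definition qa :: "('n::finite, 'p::finite, 't::finite) data \<Rightarrow> nat \<Rightarrow> ('n + 't) mpol" where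
  "qa P l = pol_rename Inr (qq P l)"

definition dg :: "('n::finite, 'p::finite, 't::finite) data \<Rightarrow> nat \<Rightarrow> nat" where
  "dg P j = (if j = 0 then 0 else if j = ng P + 1 then half_deg (- ff P) else half_deg (gg P j))"

definition dmin :: "('n::finite, 'p::finite, 't::finite) data \<Rightarrow> nat" where
  "dmin P = Max (dg P ` {0..ng P + 1} \<union> (\<lambda>l. half_deg (qq P l)) ` {1..nq P}
                  \<union> (\<lambda>l. half_deg (ss P l)) ` {1..ns P})"

definition idx :: "('n::finite, 'p::finite, 't::finite) data \<Rightarrow> nat \<Rightarrow> ('n mon \<times> 'p mon) set" where
  "idx P d = {(\<alpha>, \<beta>). mon_deg \<alpha> + mon_deg \<beta> \<le> 2 * d \<and> mon_deg \<alpha> + pol_deg (pp P \<beta>) \<le> 2 * d}"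

definition xp :: "('n::finite, 'p::finite, 't::finite) data \<Rightarrow> 'n mon \<Rightarrow> 'p mon \<Rightarrow> ('n + 't) mpol" where
  "xp P \<alpha> \<beta> = mono_pol (mon_rename Inl \<alpha>) * pol_rename Inr (pp P \<beta>)"

text \<open>The constraints of \<open>(SDP\<^sub>d)\<close>, where \<open>S I A\<close> is the condition imposed on each matrix:
  \<open>psd_on\<close> gives feasibility, \<open>pd_on\<close> strict feasibility.\<close>

definition sdp_constraints :: "(('n + 'p) mon set \<Rightarrow> (('n + 'p) mon \<Rightarrow> ('n + 'p) mon \<Rightarrow> real) \<Rightarrow> bool)
    \<Rightarrow> (('n + 't) mon set \<Rightarrow> (('n + 't) mon \<Rightarrow> ('n + 't) mon \<Rightarrow> real) \<Rightarrow> bool)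
    \<Rightarrow> ('n::finite, 'p::finite, 't::finite) data \<Rightarrow> nat
    \<Rightarrow> (('n + 'p) mon \<Rightarrow> real) \<Rightarrow> (('n + 'p) mon \<Rightarrow> real) \<Rightarrow> (('n + 't) mon \<Rightarrow> real) \<Rightarrow> bool" where
  "sdp_constraints S S' P d y u v \<longleftrightarrow>
     (\<forall>(\<alpha>, \<beta>)\<in>idx P d.
        riesz (\<lambda>\<gamma>. y \<gamma> + u \<gamma>) (mono_pol (mon_join \<alpha> \<beta>)) - riesz v (xp P \<alpha> \<beta>) = 0) \<and>
     (\<forall>\<alpha>\<in>mons (2 * d).
        riesz v (mono_pol (mon_rename Inl \<alpha>)) = (\<integral>x. mon_eval (($) x) \<alpha> \<partial>(lam P))) \<and>
     S (mons d) (mom_mat y) \<and> S (mons d) (mom_mat u) \<and> S' (mons d) (mom_mat v) \<and>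
     S (mons (d - dg P (ng P + 1))) (loc_mat (gw P (ng P + 1)) y) \<and>
     (\<forall>j\<in>{1..ng P}. S (mons (d - dg P j)) (loc_mat (gw P j) y) \<and>
                    S (mons (d - dg P j)) (loc_mat (gw P j) u) \<and>
                    S' (mons (d - dg P j)) (loc_mat (ga P j) v)) \<and>
     (\<forall>l\<in>{1..ns P}. S (mons (d - half_deg (ss P l))) (loc_mat (sw P l) y) \<and>
                    S (mons (d - half_deg (ss P l))) (loc_mat (sw P l) u)) \<and>
     (\<forall>l\<in>{1..nq P}. S' (mons (d - half_deg (qq P l))) (loc_mat (qa P l) v))"

definition sdp_feasible :: "('n::finite, 'p::finite, 't::finite) data \<Rightarrow> nat
    \<Rightarrow> (('n + 'p) mon \<Rightarrow> real) \<Rightarrow> (('n + 'p) mon \<Rightarrow> real) \<Rightarrow> (('n + 't) mon \<Rightarrow> real) \<Rightarrow> bool" where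
  "sdp_feasible = sdp_constraints psd_on psd_on"

definition sdp_strictly_feasible :: "('n::finite, 'p::finite, 't::finite) data \<Rightarrow> nat
    \<Rightarrow> (('n + 'p) mon \<Rightarrow> real) \<Rightarrow> (('n + 'p) mon \<Rightarrow> real) \<Rightarrow> (('n + 't) mon \<Rightarrow> real) \<Rightarrow> bool" where
  "sdp_strictly_feasible = sdp_constraints pd_on pd_on"

definition slater :: "('n::finite, 'p::finite, 't::finite) data \<Rightarrow> nat \<Rightarrow> bool" where
  "slater P d \<longleftrightarrow> (\<exists>y u v. sdp_strictly_feasible P d y u v)"

definition rho_sdp :: "('n::finite, 'p::finite, 't::finite) data \<Rightarrow> nat \<Rightarrow> ereal" where
  "rho_sdp P d = (SUP (y, u, v) \<in> {(y, u, v). sdp_feasible P d y u v}. ereal (y 0))"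

definition dual_feasible :: "('n::finite, 'p::finite, 't::finite) data \<Rightarrow> nat
    \<Rightarrow> ('n + 'p) mpol \<Rightarrow> 'n mpol \<Rightarrow> bool" where
  "dual_feasible P d h w \<longleftrightarrow>
     pol_deg w \<le> 2 * d \<and> Poly_Mapping.keys h \<subseteq> (\<lambda>(\<alpha>, \<beta>). mon_join \<alpha> \<beta>) ` idx P d \<and>
     (\<exists>\<sigma>1 \<sigma>2 \<sigma>3 \<tau>1 \<tau>2 \<tau>3.
        (\<forall>j\<in>{0..ng P + 1}. \<sigma>1 j \<in> sos (d - dg P j)) \<and>
        (\<forall>j\<in>{0..ng P}. \<sigma>2 j \<in> sos (d - dg P j) \<and> \<sigma>3 j \<in> sos (d - dg P j)) \<and>
        (\<forall>l\<in>{1..ns P}. \<tau>1 l \<in> sos (d - half_deg (ss P l)) \<and> \<tau>2 l \<in> sos (d - half_deg (ss P l))) \<and>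
        (\<forall>l\<in>{1..nq P}. \<tau>3 l \<in> sos (d - half_deg (qq P l))) \<and>
        h - 1 = (\<Sum>j=0..ng P + 1. \<sigma>1 j * gw P j) + (\<Sum>l=1..ns P. \<tau>1 l * sw P l) \<and>
        h = (\<Sum>j=0..ng P. \<sigma>2 j * gw P j) + (\<Sum>l=1..ns P. \<tau>2 l * sw P l) \<and>
        pol_rename Inl w
            - (\<Sum>(\<alpha>, \<beta>)\<in>idx P d. const_pol (Poly_Mapping.lookup h (mon_join \<alpha> \<beta>)) * xp P \<alpha> \<beta>)
          = (\<Sum>j=0..ng P. \<sigma>3 j * ga P j) + (\<Sum>l=1..nq P. \<tau>3 l * qa P l))"

definition rho_dual :: "('n::finite, 'p::finite, 't::finite) data \<Rightarrow> nat \<Rightarrow> ereal" where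
  "rho_dual P d = (INF (h, w) \<in> {(h, w). dual_feasible P d h w}. ereal (\<integral>x. ev1 w x \<partial>(lam P)))"

definition dual_optimal :: "('n::finite, 'p::finite, 't::finite) data \<Rightarrow> nat
    \<Rightarrow> ('n + 'p) mpol \<Rightarrow> 'n mpol \<Rightarrow> bool" where
  "dual_optimal P d h w \<longleftrightarrow>
     dual_feasible P d h w \<and> ereal (\<integral>x. ev1 w x \<partial>(lam P)) = rho_dual P d"

definition Xd :: "('n::finite, 'p::finite, 't::finite) data \<Rightarrow> 'n mpol \<Rightarrow> real \<Rightarrow> (real ^ 'n) set" where
  "Xd P w \<epsilon> = {x \<in> XX P. ev1 w x < \<epsilon>}"

end

theory Submission
  imports Defs
begin

text \<open>
  \<^bold>\<open>Slater's condition.\<close> Let \<open>v\<close> be the moments of the product \<open>\<pi>\<close> of \<open>\<lambda>\<close> and the uniform measure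
  on \<open>A\<close>. The functional \<open>x\<^sup>\<alpha> \<omega>\<^sup>\<beta> \<mapsto> L\<^sub>v(x\<^sup>\<alpha> p\<^sub>\<beta>(a))\<close> integrates a polynomial first against \<open>\<mu>\<^sub>a\<close> and then
  against \<open>\<pi>\<close>, so it gives the moments of \<open>T\<^sup>*\<pi>\<close>. As \<open>\<mu>\<^sub>a\<close> charges no zero set of a nonzero
  polynomial, it is strictly positive on every nonzero polynomial that is nonnegative on \<open>X \<times> \<Omega>\<close>
  (\<open>riesz_pull_pos\<close>). However, \<open>T\<^sup>*\<pi>\<close> need not charge \<open>K\<close>, so \<open>y\<close> cannot be taken from its restriction to \<open>K\<close>.
  Instead \<open>y\<close> is \<open>\<epsilon>\<close> times the moments of the uniform measure on a ball in \<open>K\<close>, and \<open>u\<close>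
  is the difference. Positive definiteness is an open condition (\<open>pd_perturb\<close>), so all matrices
  of \<open>u\<close> are positive definite when \<open>\<epsilon>\<close> is small.

  \<^bold>\<open>Strong duality.\<close> The matrix entries are made independent variables that are tied to the moments
  by linear equations. Over the cone of tuples whose matrices are positive semidefinite, these
  equations and those of the program are then replaced by multipliers, one equation at a time
  (\<open>lagrange_multipliers\<close>); the Slater point guarantees that each multiplier is finite. The
  multipliers of the matrix entries form positive semidefinite matrices, which are sums of rank-one
  matrices (\<open>psd_rank_one_sum\<close>) and hence yield the sums of squares of the dual program. Neither
  closedness of the cone of truncated sums of squares nor a separating hyperplane is needed.

  \<^bold>\<open>Inner approximation.\<close> For a dual feasible pair, \<open>h \<ge> 1\<close> on \<open>K\<close> and \<open>h \<ge> 0\<close> on \<open>X \<times> \<Omega>\<close>, so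
  \<open>w(x) \<ge> \<integral> h(x, \<omega>) d\<mu>\<^sub>a \<ge> \<mu>\<^sub>a(K\<^sub>x)\<close> for every \<open>a \<in> A\<close>, that is \<open>w \<ge> \<kappa>\<close> on \<open>X\<close>.

  \<^bold>\<open>Convergence.\<close> Since \<open>w\<^sub>d \<ge> \<kappa>\<close>, the \<open>L\<^sub>1\<close> distance is \<open>\<rho>\<^sub>d - \<integral> \<kappa> d\<lambda>\<close>. It tends to 0 because
  \<open>\<rho> \<le> \<integral> \<kappa> d\<lambda> \<le> \<rho>\<^sub>d\<close> (\<open>rho_le_kappa\<close>); the reverse inequality \<open>\<rho> \<ge> \<integral> \<kappa> d\<lambda>\<close>, which would require a
  measurable selection of worst-case parameters, is not needed. Measurability of \<open>\<kappa>\<close> and the existence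
  of the maxima come from upper semicontinuity of \<open>(x, a) \<mapsto> \<mu>\<^sub>a(K\<^sub>x)\<close> on the compact set \<open>X \<times> A\<close>.
\<close>

section \<open>Polynomials and Riesz functionals\<close>

lemma riesz_superset:
  assumes "finite S" "Poly_Mapping.keys q \<subseteq> S"
  shows "riesz z q = (\<Sum>\<alpha>\<in>S. Poly_Mapping.lookup q \<alpha> * z \<alpha>)"
  unfolding riesz_def
  by (rule sum.mono_neutral_left) (use assms in \<open>auto simp: in_keys_iff\<close>)

lemma riesz_zero [simp]: "riesz z 0 = 0"
  by (simp add: riesz_def)

lemma riesz_add: "riesz z (p + q) = riesz z p + riesz z q"
proof -
  let ?S = "Poly_Mapping.keys p \<union> Poly_Mapping.keys q"
  have "riesz z (p + q) = (\<Sum>\<alpha>\<in>?S. Poly_Mapping.lookup (p + q) \<alpha> * z \<alpha>)"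
    using Poly_Mapping.keys_add[of p q] by (intro riesz_superset) auto
  also have "\<dots> = (\<Sum>\<alpha>\<in>?S. Poly_Mapping.lookup p \<alpha> * z \<alpha>) + (\<Sum>\<alpha>\<in>?S. Poly_Mapping.lookup q \<alpha> * z \<alpha>)"
    by (simp add: lookup_add distrib_right sum.distrib)
  also have "\<dots> = riesz z p + riesz z q"
    by (subst (1 2) riesz_superset[of ?S]) auto
  finally show ?thesis .
qed

lemma riesz_single [simp]: "riesz z (Poly_Mapping.single \<alpha> c) = c * z \<alpha>"
  by (simp add: riesz_def)

lemma riesz_sum: "riesz z (sum f I) = (\<Sum>i\<in>I. riesz z (f i))"
  by (induction I rule: infinite_finite_induct) (auto simp: riesz_add)

lemma riesz_sum_list: "riesz z (sum_list ps) = (\<Sum>p\<leftarrow>ps. riesz z p)"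
  by (induction ps) (auto simp: riesz_add)

lemma riesz_one [simp]: "riesz z 1 = z 0"
  using riesz_single[of z 0 1] by simp

lemma riesz_uminus: "riesz z (- p) = - riesz z p"
  by (simp add: riesz_def sum_negf keys_def)

lemma riesz_diff: "riesz z (p - q) = riesz z p - riesz z q"
  using riesz_add[of z p "- q"] by (simp add: riesz_uminus)

lemma riesz_combine:
  "riesz (\<lambda>\<gamma>. s * y \<gamma> + r * u \<gamma>) q = s * riesz y q + r * riesz u q"
  by (simp add: riesz_def sum_distrib_left sum.distrib[symmetric] algebra_simps)

lemma pol_sum_single:
  "q = (\<Sum>\<alpha>\<in>Poly_Mapping.keys q. Poly_Mapping.single \<alpha> (Poly_Mapping.lookup q \<alpha>))"
  by (rule poly_mapping_eqI) (auto simp: lookup_sum lookup_single when_def in_keys_iff)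

lemma riesz_eqI:
  fixes p q :: "'v mpol"
  assumes "\<And>z. riesz z p = riesz z q"
  shows "p = q"
proof (rule poly_mapping_eqI)
  fix \<alpha>
  have *: "riesz (\<lambda>\<beta>. if \<beta> = \<alpha> then 1 else 0) r = Poly_Mapping.lookup r \<alpha>" for r :: "'v mpol"
    by (auto simp: riesz_def if_distrib in_keys_iff cong: if_cong)
  show "Poly_Mapping.lookup p \<alpha> = Poly_Mapping.lookup q \<alpha>"
    using assms[of "\<lambda>\<beta>. if \<beta> = \<alpha> then 1 else 0"] unfolding * .
qed

lemma riesz_const_mult: "riesz z (const_pol c * q) = c * riesz z q"
proof -
  have "const_pol c * q = (\<Sum>\<alpha>\<in>Poly_Mapping.keys q. Poly_Mapping.single \<alpha> (c * Poly_Mapping.lookup q \<alpha>))"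
    by (subst pol_sum_single[of q]) (simp add: sum_distrib_left mult_single)
  then show ?thesis
    by (simp add: riesz_sum) (simp add: riesz_def sum_distrib_left mult.assoc)
qed

text \<open>Evaluation at a point is the Riesz functional of the point evaluation of monomials.\<close>

lemma pol_eval_riesz: "pol_eval v q = riesz (mon_eval v) q"
  by (simp add: pol_eval_def riesz_def)

lemma mon_eval_add: "mon_eval v (\<alpha> + \<beta>) = mon_eval v \<alpha> * mon_eval v \<beta>"
  by (simp add: mon_eval_def lookup_add power_add prod.distrib)

lemma mon_eval_0 [simp]: "mon_eval v 0 = 1"
  by (simp add: mon_eval_def)

lemma mon_eval_single [simp]: "mon_eval v (Poly_Mapping.single i k) = v i ^ k"
proof -
  have "mon_eval v (Poly_Mapping.single i k) = (\<Prod>j\<in>UNIV. if j = i then v i ^ k else 1)"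
    unfolding mon_eval_def by (intro prod.cong) (auto simp: lookup_single when_def)
  then show ?thesis by simp
qed

lemma mon_eval_sum: "finite I \<Longrightarrow> mon_eval v (\<Sum>i\<in>I. f i) = (\<Prod>i\<in>I. mon_eval v (f i))"
  by (induction I rule: finite_induct) (auto simp: mon_eval_add)

lemma pol_eval_simps:
  "pol_eval v 0 = 0" "pol_eval v 1 = 1"
  "pol_eval v (p + q) = pol_eval v p + pol_eval v q"
  "pol_eval v (p - q) = pol_eval v p - pol_eval v q"
  "pol_eval v (- p) = - pol_eval v p"
  "pol_eval v (Poly_Mapping.single \<alpha> c) = c * mon_eval v \<alpha>"
  "pol_eval v (sum f I) = (\<Sum>i\<in>I. pol_eval v (f i))"
  "pol_eval v (sum_list ps) = (\<Sum>r\<leftarrow>ps. pol_eval v r)"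
  by (auto simp: pol_eval_riesz riesz_add riesz_diff riesz_uminus riesz_sum riesz_sum_list)

lemma pol_eval_mult: "pol_eval v (p * q) = pol_eval v p * pol_eval v q"
proof -
  have "p * q = (\<Sum>\<alpha>\<in>Poly_Mapping.keys p. \<Sum>\<beta>\<in>Poly_Mapping.keys q.
       Poly_Mapping.single (\<alpha> + \<beta>) (Poly_Mapping.lookup p \<alpha> * Poly_Mapping.lookup q \<beta>))"
    by (subst pol_sum_single[of p], subst pol_sum_single[of q])
       (simp add: sum_product mult_single)
  then show ?thesis
    by (simp add: pol_eval_simps) (simp add: pol_eval_def sum_product mon_eval_add algebra_simps)
qed

lemma mon_eval_rename: "mon_eval v (mon_rename \<iota> \<alpha>) = mon_eval (v \<circ> \<iota>) \<alpha>"
proof -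
  have "mon_eval v (mon_rename \<iota> \<alpha>) = (\<Prod>i\<in>Poly_Mapping.keys \<alpha>. v (\<iota> i) ^ Poly_Mapping.lookup \<alpha> i)"
    by (simp add: mon_rename_def mon_eval_sum)
  also have "\<dots> = (\<Prod>i\<in>UNIV. v (\<iota> i) ^ Poly_Mapping.lookup \<alpha> i)"
    by (rule prod.mono_neutral_left) (auto simp: in_keys_iff)
  finally show ?thesis by (simp add: mon_eval_def)
qed

lemma pol_eval_rename: "pol_eval v (pol_rename \<iota> q) = pol_eval (v \<circ> \<iota>) q"
  by (simp add: pol_rename_def pol_eval_simps mon_eval_rename) (simp add: pol_eval_def)

lemma riesz_rename: "riesz z (pol_rename \<iota> q) = riesz (z \<circ> mon_rename \<iota>) q"
  by (simp add: pol_rename_def riesz_sum) (simp add: riesz_def)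

text \<open>The two parts of an exponent of \<open>\<real>[x,\<omega>]\<close>; together they invert \<open>mon_join\<close>.\<close>

definition mon_left :: "('v::finite + 'w::finite) mon \<Rightarrow> 'v mon" where
  "mon_left \<gamma> = (\<Sum>i\<in>UNIV. Poly_Mapping.single i (Poly_Mapping.lookup \<gamma> (Inl i)))"

definition mon_right :: "('v::finite + 'w::finite) mon \<Rightarrow> 'w mon" where
  "mon_right \<gamma> = (\<Sum>i\<in>UNIV. Poly_Mapping.single i (Poly_Mapping.lookup \<gamma> (Inr i)))"

lemma lookup_mon_left [simp]: "Poly_Mapping.lookup (mon_left \<gamma>) i = Poly_Mapping.lookup \<gamma> (Inl i)"
  by (simp add: mon_left_def lookup_sum lookup_single when_def)

lemma lookup_mon_right [simp]: "Poly_Mapping.lookup (mon_right \<gamma>) i = Poly_Mapping.lookup \<gamma> (Inr i)"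
  by (simp add: mon_right_def lookup_sum lookup_single when_def)

lemma lookup_mon_rename_Inl [simp]:
  "Poly_Mapping.lookup (mon_rename Inl \<alpha>) (Inl i) = Poly_Mapping.lookup \<alpha> i"
  "Poly_Mapping.lookup (mon_rename Inl \<alpha>) (Inr j) = 0"
  by (auto simp: mon_rename_def lookup_sum lookup_single when_def in_keys_iff)

lemma lookup_mon_rename_Inr [simp]:
  "Poly_Mapping.lookup (mon_rename Inr \<alpha>) (Inr i) = Poly_Mapping.lookup \<alpha> i"
  "Poly_Mapping.lookup (mon_rename Inr \<alpha>) (Inl j) = 0"
  by (auto simp: mon_rename_def lookup_sum lookup_single when_def in_keys_iff)

lemma mon_left_join [simp]: "mon_left (mon_join \<alpha> \<beta>) = \<alpha>"
  by (rule poly_mapping_eqI) (simp add: mon_join_def lookup_add)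

lemma mon_right_join [simp]: "mon_right (mon_join \<alpha> \<beta>) = \<beta>"
  by (rule poly_mapping_eqI) (simp add: mon_join_def lookup_add)

lemma mon_join_split [simp]: "mon_join (mon_left \<gamma>) (mon_right \<gamma>) = \<gamma>"
proof (rule poly_mapping_eqI)
  fix k show "Poly_Mapping.lookup (mon_join (mon_left \<gamma>) (mon_right \<gamma>)) k = Poly_Mapping.lookup \<gamma> k"
    by (cases k) (simp_all add: mon_join_def lookup_add)
qed

lemma mon_rename_0 [simp]: "mon_rename \<iota> 0 = 0"
  by (simp add: mon_rename_def)

lemma mon_join_0 [simp]: "mon_join 0 0 = 0"
  by (simp add: mon_join_def)

lemma mon_eval_join:
  "mon_eval (case_sum a b) (mon_join \<alpha> \<beta>) = mon_eval a \<alpha> * mon_eval b \<beta>"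
proof -
  have "case_sum a b \<circ> Inl = a" "case_sum a b \<circ> Inr = b" by auto
  then show ?thesis by (simp add: mon_join_def mon_eval_add mon_eval_rename)
qed

lemma pol_eval_rename_Inl [simp]: "pol_eval (case_sum a b) (pol_rename Inl q) = pol_eval a q"
proof -
  have "case_sum a b \<circ> Inl = a" by auto
  then show ?thesis by (simp add: pol_eval_rename)
qed

lemma pol_eval_rename_Inr [simp]: "pol_eval (case_sum a b) (pol_rename Inr q) = pol_eval b q"
proof -
  have "case_sum a b \<circ> Inr = b" by auto
  then show ?thesis by (simp add: pol_eval_rename)
qed

section \<open>Degrees\<close>

lemma finite_mons [simp]: "finite (mons d :: 'v::finite mon set)"
proof -
  have "Poly_Mapping.lookup ` (mons d :: 'v mon set) \<subseteq> PiE UNIV (\<lambda>_. {..d})"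
  proof clarify
    fix \<alpha> :: "'v mon" assume "\<alpha> \<in> mons d"
    then have *: "(\<Sum>i\<in>UNIV. Poly_Mapping.lookup \<alpha> i) \<le> d" by (simp add: mons_def mon_deg_def)
    have "Poly_Mapping.lookup \<alpha> i \<le> d" for i
      using member_le_sum[of i UNIV "Poly_Mapping.lookup \<alpha>"] * by simp
    then show "Poly_Mapping.lookup \<alpha> \<in> PiE UNIV (\<lambda>_. {..d})" by auto
  qed
  moreover have "finite (PiE (UNIV :: 'v set) (\<lambda>_. {..d}))" by (intro finite_PiE) auto
  ultimately have "finite (Poly_Mapping.lookup ` (mons d :: 'v mon set))" by (rule finite_subset)
  then show ?thesis
    by (rule finite_imageD) (auto intro!: inj_onI poly_mapping_eqI)
qed

lemma pol_deg_le_iff: "pol_deg q \<le> k \<longleftrightarrow> Poly_Mapping.keys q \<subseteq> mons k"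
  by (auto simp: pol_deg_def mons_def)

lemma finite_idx [simp]: "finite (idx P d)"
proof -
  have "idx P d \<subseteq> mons (2 * d) \<times> mons (2 * d)" by (auto simp: idx_def mons_def)
  then show ?thesis by (rule finite_subset) simp
qed

section \<open>Localizing matrices as quadratic forms\<close>

text \<open>The polynomial with coefficient vector \<open>c\<close> on the exponents in \<open>I\<close>.\<close>

definition coeff_pol :: "'v mon set \<Rightarrow> ('v mon \<Rightarrow> real) \<Rightarrow> 'v mpol" where
  "coeff_pol I c = (\<Sum>\<alpha>\<in>I. Poly_Mapping.single \<alpha> (c \<alpha>))"

lemma lookup_coeff_pol:
  "finite I \<Longrightarrow> Poly_Mapping.lookup (coeff_pol I c) \<alpha> = (if \<alpha> \<in> I then c \<alpha> else 0)"
  by (simp add: coeff_pol_def lookup_sum lookup_single when_def)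

lemma coeff_pol_eq:
  assumes "finite I" "Poly_Mapping.keys q \<subseteq> I"
  shows "coeff_pol I (Poly_Mapping.lookup q) = q"
  by (rule poly_mapping_eqI) (use assms in \<open>auto simp: lookup_coeff_pol in_keys_iff\<close>)

lemma pol_deg_coeff_pol: "pol_deg (coeff_pol (mons k) c) \<le> k"
  unfolding pol_deg_le_iff by (auto simp: in_keys_iff lookup_coeff_pol split: if_splits)

lemma loc_mat_form:
  "(\<Sum>\<alpha>\<in>I. \<Sum>\<beta>\<in>I. c \<alpha> * loc_mat g z \<alpha> \<beta> * e \<beta>) = riesz z (g * (coeff_pol I c * coeff_pol I e))"
proof -
  have *: "g * (Poly_Mapping.single \<alpha> (c \<alpha>) * Poly_Mapping.single \<beta> (e \<beta>))
      = const_pol (c \<alpha> * e \<beta>) * (g * (mono_pol \<alpha> * mono_pol \<beta>))" for \<alpha> \<beta>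
  proof -
    have "Poly_Mapping.single \<alpha> (c \<alpha>) * Poly_Mapping.single \<beta> (e \<beta>)
      = const_pol (c \<alpha> * e \<beta>) * (mono_pol \<alpha> * mono_pol \<beta> :: 'a mpol)"
      by (simp add: mult_single)
    then show ?thesis by (simp add: mult.left_commute)
  qed
  have "g * (coeff_pol I c * coeff_pol I e)
     = (\<Sum>\<alpha>\<in>I. \<Sum>\<beta>\<in>I. g * (Poly_Mapping.single \<alpha> (c \<alpha>) * Poly_Mapping.single \<beta> (e \<beta>)))"
    unfolding coeff_pol_def sum_product by (simp add: sum_distrib_left)
  also have "riesz z \<dots> = (\<Sum>\<alpha>\<in>I. \<Sum>\<beta>\<in>I. c \<alpha> * e \<beta> * loc_mat g z \<alpha> \<beta>)"
    unfolding * by (simp add: riesz_sum riesz_const_mult loc_mat_def)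
  finally show ?thesis by (simp add: ac_simps)
qed

lemma loc_mat_sym: "loc_mat g z \<alpha> \<beta> = loc_mat g z \<beta> \<alpha>"
  by (simp add: loc_mat_def mult.commute)

lemma mom_mat_loc_mat: "mom_mat z = loc_mat 1 z"
  by (intro ext) (simp add: mom_mat_def loc_mat_def)

section \<open>Nonzero polynomials on open sets\<close>

text \<open>Monomial functions are linearly independent on any product of infinite sets. The proof
  adds one variable at a time: for fixed values of the others, the coefficients of the resulting
  univariate polynomial vanish.\<close>

lemma mon_fun_indep:
  fixes S :: "'v \<Rightarrow> real set" and c :: "('v \<Rightarrow> nat) \<Rightarrow> real"
  assumes "finite I" "\<And>i. i \<in> I \<Longrightarrow> infinite (S i)" "finite F"
    "\<And>\<alpha> \<beta>. \<lbrakk>\<alpha> \<in> F; \<beta> \<in> F; \<forall>i\<in>I. \<alpha> i = \<beta> i\<rbrakk> \<Longrightarrow> \<alpha> = \<beta>"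
    "\<And>v. (\<forall>i\<in>I. v i \<in> S i) \<Longrightarrow> (\<Sum>\<alpha>\<in>F. c \<alpha> * (\<Prod>i\<in>I. v i ^ \<alpha> i)) = 0"
    "\<alpha> \<in> F"
  shows "c \<alpha> = 0"
  using assms
proof (induction I arbitrary: F c \<alpha> rule: finite_induct)
  case empty
  have "F = {\<alpha>}" using empty.prems(3,5) by auto
  then show ?case using empty.prems(4) by simp
next
  case (insert j I)
  define Fk where "Fk k = {\<beta>\<in>F. \<beta> j = k}" for k
  define N where "N = Max ((\<lambda>\<beta>. \<beta> j) ` F)"
  have N: "\<beta> j \<le> N" if "\<beta> \<in> F" for \<beta>
    unfolding N_def using that \<open>finite F\<close> by auto
  have "(\<Sum>\<beta>\<in>Fk k. c \<beta> * (\<Prod>i\<in>I. v i ^ \<beta> i)) = 0" if v: "\<forall>i\<in>I. v i \<in> S i" and k: "k \<le> N" for v k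
  proof -
    define e where "e k = (\<Sum>\<beta>\<in>Fk k. c \<beta> * (\<Prod>i\<in>I. v i ^ \<beta> i))" for k
    have zero: "(\<Sum>k\<le>N. e k * t ^ k) = 0" if t: "t \<in> S j" for t
    proof -
      have "(\<Sum>\<beta>\<in>F. c \<beta> * (\<Prod>i\<in>insert j I. (v(j := t)) i ^ \<beta> i)) = 0"
        by (rule insert.prems(4)) (use v t insert.hyps in auto)
      moreover have "(\<Prod>i\<in>insert j I. (v(j := t)) i ^ \<beta> i) = t ^ \<beta> j * (\<Prod>i\<in>I. v i ^ \<beta> i)" for \<beta>
      proof -
        have "(\<Prod>i\<in>I. (v(j := t)) i ^ \<beta> i) = (\<Prod>i\<in>I. v i ^ \<beta> i)"
          using insert.hyps by (intro prod.cong) auto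
        then show ?thesis using insert.hyps by simp
      qed
      ultimately have "0 = (\<Sum>\<beta>\<in>F. c \<beta> * (\<Prod>i\<in>I. v i ^ \<beta> i) * t ^ \<beta> j)"
        by (simp add: ac_simps)
      also have "\<dots> = (\<Sum>k\<le>N. \<Sum>\<beta>\<in>{\<beta>\<in>F. \<beta> j = k}. c \<beta> * (\<Prod>i\<in>I. v i ^ \<beta> i) * t ^ \<beta> j)"
        by (rule sum.group[symmetric]) (use \<open>finite F\<close> N in auto)
      also have "\<dots> = (\<Sum>k\<le>N. e k * t ^ k)"
        by (simp add: e_def Fk_def sum_distrib_right)
      finally show ?thesis by simp
    qed
    have "\<forall>k\<le>N. e k = 0"
    proof (rule ccontr)
      assume "\<not> ?thesis"
      then obtain k0 where "k0 \<le> N" "e k0 \<noteq> 0" by blast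
      then have "finite {t. (\<Sum>k\<le>N. e k * t ^ k) = 0}" using polyfun_rootbound_finite by blast
      moreover have "S j \<subseteq> {t. (\<Sum>k\<le>N. e k * t ^ k) = 0}" using zero by auto
      ultimately show False using insert.prems(1)[of j] finite_subset by auto
    qed
    then show ?thesis using k e_def by simp
  qed
  note coeff = this
  show ?case
  proof (rule insert.IH[of "Fk (\<alpha> j)"])
    show "finite (Fk (\<alpha> j))" using \<open>finite F\<close> by (simp add: Fk_def)
    show "\<beta> = \<gamma>" if "\<beta> \<in> Fk (\<alpha> j)" "\<gamma> \<in> Fk (\<alpha> j)" "\<forall>i\<in>I. \<beta> i = \<gamma> i" for \<beta> \<gamma>
      using that insert.prems(3)[of \<beta> \<gamma>] by (simp add: Fk_def)
    show "(\<Sum>\<beta>\<in>Fk (\<alpha> j). c \<beta> * (\<Prod>i\<in>I. v i ^ \<beta> i)) = 0" if "\<forall>i\<in>I. v i \<in> S i" for v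
      using coeff[OF that] N insert.prems(5) by blast
    show "\<alpha> \<in> Fk (\<alpha> j)" using insert.prems(5) by (simp add: Fk_def)
    show "infinite (S i)" if "i \<in> I" for i using insert.prems(1) that by blast
  qed
qed

lemma pol_zeroI:
  fixes q :: "'v::finite mpol"
  assumes "\<And>i. infinite (S i)" "\<And>v. (\<forall>i. v i \<in> S i) \<Longrightarrow> pol_eval v q = 0"
  shows "q = 0"
proof (rule ccontr)
  assume "q \<noteq> 0"
  then obtain \<alpha> where \<alpha>: "\<alpha> \<in> Poly_Mapping.keys q"
    by (metis ex_in_conv in_keys_iff lookup_zero poly_mapping_eqI)
  let ?F = "Poly_Mapping.lookup ` Poly_Mapping.keys q"
  let ?c = "\<lambda>f. Poly_Mapping.lookup q (Abs_poly_mapping f)"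
  have inj: "inj_on Poly_Mapping.lookup (Poly_Mapping.keys q)"
    by (auto intro!: inj_onI poly_mapping_eqI)
  have "?c (Poly_Mapping.lookup \<alpha>) = 0"
  proof (rule mon_fun_indep[of UNIV S ?F ?c])
    fix v :: "'v \<Rightarrow> real" assume "\<forall>i\<in>UNIV. v i \<in> S i"
    then have "pol_eval v q = 0" using assms(2) by auto
    then show "(\<Sum>\<alpha>\<in>?F. ?c \<alpha> * (\<Prod>i\<in>UNIV. v i ^ \<alpha> i)) = 0"
      by (simp add: sum.reindex[OF inj] pol_eval_def mon_eval_def)
  qed (use \<alpha> assms(1) in \<open>auto simp: fun_eq_iff\<close>)
  then show False using \<alpha> by (simp add: in_keys_iff)
qed

lemma infinite_ball_real: "e > 0 \<Longrightarrow> infinite {t::real. \<bar>t - c\<bar> < e}"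
proof -
  assume "e > 0"
  then have "infinite {c - e <..< c + e}" by (simp add: infinite_Ioo)
  moreover have "{c - e <..< c + e} = {t. \<bar>t - c\<bar> < e}" by (auto simp: abs_less_iff)
  ultimately show ?thesis by simp
qed

lemma norm_vec_bound:
  fixes x :: "real ^ 'n::finite"
  assumes "\<And>i. \<bar>x $ i\<bar> < e"
  shows "norm x < real CARD('n) * e"
proof -
  have "norm x \<le> (\<Sum>i\<in>UNIV. \<bar>x $ i\<bar>)" by (rule norm_le_l1_cart)
  also have "\<dots> < (\<Sum>i\<in>(UNIV::'n set). e)" by (rule sum_strict_mono) (use assms in auto)
  finally show ?thesis by simp
qed

lemma ev1_nonzero_open:
  fixes q :: "'v::finite mpol"
  assumes "q \<noteq> 0" "open U" "U \<noteq> {}"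
  obtains z where "z \<in> U" "ev1 q z \<noteq> 0"
proof -
  obtain z0 where "z0 \<in> U" using assms by auto
  then obtain e where e: "e > 0" "ball z0 e \<subseteq> U" using assms(2) openE by blast
  define e' where "e' = e / CARD('v)"
  have e': "e' > 0" using e by (simp add: e'_def)
  have "\<exists>v. (\<forall>i. v i \<in> {t. \<bar>t - z0 $ i\<bar> < e'}) \<and> pol_eval v q \<noteq> 0"
    using pol_zeroI[of "\<lambda>i. {t. \<bar>t - z0 $ i\<bar> < e'}" q] infinite_ball_real[OF e'] assms(1) by blast
  then obtain v where v: "\<And>i. \<bar>v i - z0 $ i\<bar> < e'" "pol_eval v q \<noteq> 0" by auto
  define z where "z = (\<chi> i. v i)"
  have "norm (z - z0) < CARD('v) * e'"
    by (rule norm_vec_bound) (use v in \<open>simp add: z_def\<close>)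
  then have "z \<in> U" using e by (auto simp: e'_def dist_norm norm_minus_commute subset_iff)
  moreover have "($) z = v" by (auto simp: z_def)
  ultimately show ?thesis using that v by metis
qed

lemma ev2_nonzero_open:
  fixes q :: "('v::finite + 'w::finite) mpol"
  assumes "q \<noteq> 0" "open U" "U \<noteq> {}"
  obtains z where "z \<in> U" "ev2 q z \<noteq> 0"
proof -
  obtain a0 b0 where "(a0, b0) \<in> U" using assms by auto
  then obtain A B where AB: "open A" "open B" "a0 \<in> A" "b0 \<in> B" "A \<times> B \<subseteq> U"
    using assms(2) open_prod_elim by (metis mem_Sigma_iff)
  obtain e1 where e1: "e1 > 0" "ball a0 e1 \<subseteq> A" using AB openE by metis
  obtain e2 where e2: "e2 > 0" "ball b0 e2 \<subseteq> B" using AB openE by metis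
  define e' where "e' = e1 / CARD('v)"
  define e'' where "e'' = e2 / CARD('w)"
  have e': "e' > 0" "e'' > 0" using e1 e2 by (simp_all add: e'_def e''_def)
  let ?S = "case_sum (\<lambda>i. {t. \<bar>t - a0 $ i\<bar> < e'}) (\<lambda>i. {t. \<bar>t - b0 $ i\<bar> < e''})"
  have "infinite (?S i)" for i
    using infinite_ball_real[OF e'(1)] infinite_ball_real[OF e'(2)] by (cases i) simp_all
  then have "\<exists>v. (\<forall>i. v i \<in> ?S i) \<and> pol_eval v q \<noteq> 0"
    using pol_zeroI[of ?S q] assms(1) by blast
  then obtain v where v: "\<And>i. v i \<in> ?S i" "pol_eval v q \<noteq> 0" by auto
  define a where "a = (\<chi> i. v (Inl i))"
  define b where "b = (\<chi> i. v (Inr i))"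
  have "norm (a - a0) < CARD('v) * e'"
    by (rule norm_vec_bound) (use v(1)[of "Inl _"] in \<open>simp add: a_def\<close>)
  then have "a \<in> A" using e1 by (auto simp: e'_def dist_norm norm_minus_commute subset_iff)
  moreover have "norm (b - b0) < CARD('w) * e''"
    by (rule norm_vec_bound) (use v(1)[of "Inr _"] in \<open>simp add: b_def\<close>)
  then have "b \<in> B" using e2 by (auto simp: e''_def dist_norm norm_minus_commute subset_iff)
  ultimately have "(a, b) \<in> U" using AB by auto
  moreover have "case_sum (($) a) (($) b) = v" by (auto simp: a_def b_def fun_eq_iff split: sum.splits)
  ultimately show ?thesis using that[of "(a, b)"] v by auto
qed

lemma continuous_on_mon_eval [continuous_intros]:
  "(\<And>i. continuous_on S (\<lambda>z. f z i)) \<Longrightarrow> continuous_on S (\<lambda>z. mon_eval (f z) \<alpha>)"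
  unfolding mon_eval_def by (intro continuous_intros)

lemma continuous_on_pol_eval [continuous_intros]:
  "(\<And>i. continuous_on S (\<lambda>z. f z i)) \<Longrightarrow> continuous_on S (\<lambda>z. pol_eval (f z) q)"
  unfolding pol_eval_def by (intro continuous_intros)

lemma continuous_on_ev1 [continuous_intros]: "continuous_on S f \<Longrightarrow> continuous_on S (\<lambda>z. ev1 q (f z))"
  by (intro continuous_intros)

lemma continuous_on_ev2 [continuous_intros]: "continuous_on S f \<Longrightarrow> continuous_on S (\<lambda>z. ev2 q (f z))"
proof (intro continuous_on_pol_eval)
  fix i assume f: "continuous_on S f"
  then show "continuous_on S (\<lambda>z. case_sum (($) (fst (f z))) (($) (snd (f z))) i)"
    by (cases i) (auto intro!: continuous_intros)
qed

text \<open>For two polynomials a common point of nonvanishing is found by shrinking the open set; this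
  replaces the absence of zero divisors.\<close>

lemma ev2_nonzero_open_mult:
  fixes p q :: "('v::finite + 'w::finite) mpol"
  assumes "p \<noteq> 0" "q \<noteq> 0" "open U" "U \<noteq> {}"
  obtains z where "z \<in> U" "ev2 p z \<noteq> 0" "ev2 q z \<noteq> 0"
proof -
  have "open {z. ev2 p z \<noteq> 0}" by (intro open_Collect_neq continuous_intros)
  moreover obtain z where "z \<in> U" "ev2 p z \<noteq> 0" using ev2_nonzero_open assms by blast
  ultimately have "open (U \<inter> {z. ev2 p z \<noteq> 0})" "U \<inter> {z. ev2 p z \<noteq> 0} \<noteq> {}" using assms by auto
  from ev2_nonzero_open[OF assms(2) this] that show ?thesis by auto
qed

section \<open>Finite quadratic forms\<close>

text \<open>The value at \<open>c\<close> of the quadratic form of \<open>A\<close>, for index sets that are not types.\<close>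

definition qform :: "'i set \<Rightarrow> ('i \<Rightarrow> 'i \<Rightarrow> real) \<Rightarrow> ('i \<Rightarrow> real) \<Rightarrow> real" where
  "qform I A c = (\<Sum>i\<in>I. \<Sum>j\<in>I. c i * A i j * c j)"

lemma qform_insert:
  assumes "finite I" "k \<notin> I" "\<And>i. i \<in> I \<Longrightarrow> A i k = A k i"
  shows "qform (insert k I) A c = A k k * (c k)\<^sup>2 + 2 * c k * (\<Sum>i\<in>I. A k i * c i) + qform I A c"
proof -
  have "qform (insert k I) A c
      = c k * A k k * c k + (\<Sum>j\<in>I. c k * A k j * c j) + (\<Sum>i\<in>I. c i * A i k * c k) + qform I A c"
    using assms(1,2) by (simp add: qform_def sum.distrib)
  also have "(\<Sum>i\<in>I. c i * A i k * c k) = (\<Sum>j\<in>I. c k * A k j * c j)"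
    using assms(3) by (intro sum.cong) auto
  also have "(\<Sum>j\<in>I. c k * A k j * c j) = c k * (\<Sum>j\<in>I. A k j * c j)"
    by (simp add: sum_distrib_left mult.assoc)
  finally show ?thesis by (simp add: power2_eq_square)
qed

lemma qform_rank_one:
  assumes "finite I"
  shows "qform I (\<lambda>i j. b i * b j) c = (\<Sum>i\<in>I. b i * c i)\<^sup>2"
  by (simp add: qform_def power2_eq_square sum_product algebra_simps)

lemma qform_diff: "qform I (\<lambda>i j. A i j - s * B i j) c = qform I A c - s * qform I B c"
  by (simp add: qform_def sum_subtractf sum_distrib_left algebra_simps)

lemma qform_cong:
  "(\<And>i. i \<in> I \<Longrightarrow> c i = e i) \<Longrightarrow> qform I A c = qform I A e"
  by (simp add: qform_def)

text \<open>Completing the square: the Schur complement of a positive pivot.\<close>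

lemma qform_schur:
  assumes "finite I" "k \<notin> I" "\<And>i. i \<in> I \<Longrightarrow> A i k = A k i" "A k k > 0"
  shows "qform (insert k I) A c = A k k * (c k + (\<Sum>i\<in>I. A k i / A k k * c i))\<^sup>2
      + qform I (\<lambda>i j. A i j - A k i * A k j / A k k) c"
proof -
  define s where "s = (\<Sum>i\<in>I. A k i * c i)"
  have 1: "(\<Sum>i\<in>I. A k i / A k k * c i) = s / A k k"
    by (simp add: s_def sum_divide_distrib)
  have "qform I (\<lambda>i j. A i j - A k i * A k j / A k k) c
      = qform I A c - 1 / A k k * qform I (\<lambda>i j. A k i * A k j) c"
    unfolding qform_diff[symmetric] by simp
  also have "\<dots> = qform I A c - s\<^sup>2 / A k k"
    using assms(1) by (simp add: qform_rank_one s_def)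
  finally have 2: "qform I (\<lambda>i j. A i j - A k i * A k j / A k k) c = qform I A c - s\<^sup>2 / A k k" .
  have 3: "A k k * (c k + s / A k k)\<^sup>2 = A k k * (c k)\<^sup>2 + 2 * c k * s + s\<^sup>2 / A k k"
    using assms(4) by (simp add: power2_eq_square field_simps)
  have "qform (insert k I) A c = A k k * (c k)\<^sup>2 + 2 * c k * s + qform I A c"
    unfolding s_def using assms(1-3) by (intro qform_insert) auto
  then show ?thesis unfolding 1 2 3 by simp
qed

text \<open>A positive definite form dominates a multiple of the sum of squares. The induction removes
  one index at a time by taking the Schur complement.\<close>

lemma pd_coercive:
  assumes "finite I" "pd_on I A"
  shows "\<exists>\<delta>>0. \<forall>c. \<delta> * (\<Sum>i\<in>I. (c i)\<^sup>2) \<le> qform I A c"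
  using assms
proof (induction I arbitrary: A rule: finite_induct)
  case empty
  show ?case by (intro exI[of _ 1]) (simp add: qform_def)
next
  case (insert k I)
  have sym: "A i j = A j i" if "i \<in> insert k I" "j \<in> insert k I" for i j
    using insert.prems that by (auto simp: pd_on_def)
  have pos: "qform (insert k I) A c > 0" if "\<exists>i\<in>insert k I. c i \<noteq> 0" for c
    using insert.prems that by (auto simp: pd_on_def qform_def)
  define a where "a = A k k"
  have "qform (insert k I) A (\<lambda>i. if i = k then 1 else 0) = a"
  proof -
    have "(\<Sum>i\<in>I. A k i * (if i = k then 1 else 0)) = 0"
      using insert.hyps by (intro sum.neutral) auto
    moreover have "qform I A (\<lambda>i. if i = k then 1 else 0) = qform I A (\<lambda>i. 0)"
      using insert.hyps by (intro qform_cong) auto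
    ultimately show ?thesis
      using insert.hyps sym by (subst qform_insert) (auto simp: a_def qform_def)
  qed
  then have a: "a > 0" using pos[of "\<lambda>i. if i = k then 1 else 0"] by simp
  define b where "b i = A k i / a" for i
  define B where "B = (\<lambda>i j. A i j - A k i * A k j / A k k)"
  have schur: "qform (insert k I) A c = a * (c k + (\<Sum>i\<in>I. b i * c i))\<^sup>2 + qform I B c" for c
    unfolding a_def b_def B_def using insert.hyps sym a[unfolded a_def] by (intro qform_schur) auto
  have "pd_on I B"
    unfolding pd_on_def
  proof (intro conjI ballI allI impI)
    show "B i j = B j i" if "i \<in> I" "j \<in> I" for i j using sym that by (simp add: B_def)
    fix c assume c: "\<exists>i\<in>I. c i \<noteq> (0::real)"
    define e where "e = c(k := - (\<Sum>i\<in>I. b i * c i))"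
    have e: "e i = c i" if "i \<in> I" for i using that insert.hyps by (auto simp: e_def)
    have "qform (insert k I) A e = qform I B c"
      unfolding schur using e by (simp add: e_def cong: qform_cong sum.cong)
    moreover have "\<exists>i\<in>insert k I. e i \<noteq> 0" using c e by auto
    ultimately show "0 < (\<Sum>i\<in>I. \<Sum>j\<in>I. c i * B i j * c j)" using pos[of e] by (simp add: qform_def)
  qed
  from insert.IH[OF this] obtain \<delta>
    where \<delta>: "\<delta> > 0" "\<And>c. \<delta> * (\<Sum>i\<in>I. (c i)\<^sup>2) \<le> qform I B c" by auto
  define \<beta> where "\<beta> = (\<Sum>i\<in>I. (b i)\<^sup>2)"
  have \<beta>: "\<beta> \<ge> 0" by (simp add: \<beta>_def sum_nonneg)
  define K where "K = 2 / a + (2 * \<beta> + 1) / \<delta>"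
  have K: "K > 0" unfolding K_def using a \<delta> \<beta> by (intro add_pos_nonneg divide_pos_pos divide_nonneg_pos) auto
  have "(\<Sum>i\<in>insert k I. (c i)\<^sup>2) \<le> K * qform (insert k I) A c" for c
  proof -
    define s N where "s = (\<Sum>i\<in>I. b i * c i)" and "N = (\<Sum>i\<in>I. (c i)\<^sup>2)"
    have "s\<^sup>2 \<le> \<beta> * N"
      unfolding s_def \<beta>_def N_def by (rule Cauchy_Schwarz_ineq_sum)
    moreover have "(c k)\<^sup>2 \<le> 2 * (c k + s)\<^sup>2 + 2 * s\<^sup>2"
      using sum_squares_ge_zero[of "c k + 2 * s" 0] by (simp add: power2_eq_square algebra_simps)
    ultimately have "(c k)\<^sup>2 + N \<le> 2 * (c k + s)\<^sup>2 + (2 * \<beta> + 1) * N"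
      by (simp add: algebra_simps)
    also have "\<dots> \<le> 2 / a * (a * (c k + s)\<^sup>2) + (2 * \<beta> + 1) / \<delta> * qform I B c"
    proof -
      have "(2 * \<beta> + 1) * N = (2 * \<beta> + 1) / \<delta> * (\<delta> * N)" using \<delta> by simp
      also have "\<dots> \<le> (2 * \<beta> + 1) / \<delta> * qform I B c"
        using \<delta> \<beta> unfolding N_def by (intro mult_left_mono) auto
      finally show ?thesis using a by simp
    qed
    also have "\<dots> \<le> K * (a * (c k + s)\<^sup>2) + K * qform I B c"
    proof -
      have "2 / a \<le> K" "(2 * \<beta> + 1) / \<delta> \<le> K" using a \<delta> \<beta> by (auto simp: K_def)
      moreover have "0 \<le> \<delta> * N" using \<delta> by (simp add: N_def sum_nonneg)
      with \<delta>(2)[of c] have "0 \<le> qform I B c" by (simp add: N_def)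
      ultimately show ?thesis using a by (intro add_mono mult_right_mono) auto
    qed
    finally show ?thesis
      unfolding schur s_def[symmetric] using insert.hyps by (simp add: N_def algebra_simps)
  qed
  then show ?case using K
    by (intro exI[of _ "1 / K"]) (simp add: field_simps)
qed

lemma qform_bound:
  assumes "finite I"
  shows "\<exists>C\<ge>0. \<forall>c::'i \<Rightarrow> real. \<bar>qform I B c\<bar> \<le> C * (\<Sum>i\<in>I. (c i)\<^sup>2)"
proof (intro exI conjI allI)
  let ?C = "\<Sum>i\<in>I. \<Sum>j\<in>I. \<bar>B i j\<bar>"
  show "?C \<ge> 0" by (simp add: sum_nonneg)
  fix c :: "'i \<Rightarrow> real"
  define N where "N = (\<Sum>i\<in>I. (c i)\<^sup>2)"
  have N: "(c i)\<^sup>2 \<le> N" if "i \<in> I" for i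
    unfolding N_def using assms that by (intro member_le_sum) auto
  have "\<bar>c i * B i j * c j\<bar> \<le> \<bar>B i j\<bar> * N" if "i \<in> I" "j \<in> I" for i j
  proof -
    have "2 * (\<bar>c i\<bar> * \<bar>c j\<bar>) \<le> (c i)\<^sup>2 + (c j)\<^sup>2"
      using sum_squares_bound[of "\<bar>c i\<bar>" "\<bar>c j\<bar>"] by simp
    then have "\<bar>c i\<bar> * \<bar>c j\<bar> \<le> N" using N[OF that(1)] N[OF that(2)] by simp
    then have "\<bar>B i j\<bar> * (\<bar>c i\<bar> * \<bar>c j\<bar>) \<le> \<bar>B i j\<bar> * N" by (intro mult_left_mono) auto
    then show ?thesis by (simp add: abs_mult ac_simps)
  qed
  then have "\<bar>qform I B c\<bar> \<le> (\<Sum>i\<in>I. \<Sum>j\<in>I. \<bar>B i j\<bar> * N)"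
    unfolding qform_def by (intro order_trans[OF sum_abs] sum_mono) auto
  then show "\<bar>qform I B c\<bar> \<le> ?C * (\<Sum>i\<in>I. (c i)\<^sup>2)"
    by (simp add: N_def sum_distrib_right)
qed

text \<open>Positive definiteness is an open condition.\<close>

lemma pd_perturb:
  assumes "finite I" "pd_on I A"
  shows "\<forall>\<^sub>F e in at_right 0. \<forall>c. (\<exists>i\<in>I. c i \<noteq> 0) \<longrightarrow> qform I (\<lambda>i j. A i j - e * B i j) c > 0"
proof -
  from pd_coercive[OF assms] obtain \<delta>
    where \<delta>: "\<delta> > 0" "\<And>c. \<delta> * (\<Sum>i\<in>I. (c i)\<^sup>2) \<le> qform I A c" by auto
  from qform_bound[OF assms(1), of B] obtain C
    where C: "C \<ge> 0" "\<And>c. \<bar>qform I B c\<bar> \<le> C * (\<Sum>i\<in>I. (c i)\<^sup>2)" by auto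
  have "\<forall>\<^sub>F e in at_right 0. e < \<delta> / (C + 1)"
    by (rule eventually_mono[OF eventually_at_right_real[of 0 "\<delta> / (C + 1)"]]) (use \<delta> C in auto)
  then show ?thesis
    using eventually_at_right_less[of 0]
  proof eventually_elim
    case (elim e)
    have eC: "e * C < \<delta>"
    proof -
      have "e * C \<le> e * (C + 1)" using elim by simp
      also have "\<dots> < \<delta>" using elim C by (simp add: field_simps)
      finally show ?thesis .
    qed
    show ?case
    proof (intro allI impI)
      fix c assume "\<exists>i\<in>I. c i \<noteq> (0::real)"
      then have "(\<Sum>i\<in>I. (c i)\<^sup>2) > 0" using assms(1) by (auto intro!: sum_pos2)
      then have "0 < (\<delta> - e * C) * (\<Sum>i\<in>I. (c i)\<^sup>2)" using eC by simp
      also have "\<dots> \<le> qform I A c - e * \<bar>qform I B c\<bar>"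
      proof -
        have "e * \<bar>qform I B c\<bar> \<le> e * (C * (\<Sum>i\<in>I. (c i)\<^sup>2))"
          using C(2)[of c] elim by (intro mult_left_mono) auto
        then show ?thesis using \<delta>(2)[of c] by (simp add: left_diff_distrib mult.assoc)
      qed
      also have "\<dots> \<le> qform I A c - e * qform I B c" using elim by simp
      finally show "qform I (\<lambda>i j. A i j - e * B i j) c > 0" by (simp add: qform_diff)
    qed
  qed
qed

text \<open>A positive semidefinite matrix is a sum of rank-one squares; the statement pairs both sides
  with an arbitrary symmetric matrix, so that \<open>Q\<close> itself need not be symmetric.\<close>

lemma psd_rank_one_sum:
  assumes "finite I" "\<And>c. qform I Q c \<ge> 0"
  shows "\<exists>bs. \<forall>S. (\<forall>i\<in>I. \<forall>j\<in>I. S i j = S j i) \<longrightarrow>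
    (\<Sum>i\<in>I. \<Sum>j\<in>I. Q i j * S i j) = (\<Sum>b\<leftarrow>bs. qform I S b)"
  using assms
proof (induction I arbitrary: Q rule: finite_induct)
  case empty
  show ?case by (intro exI[of _ "[]"]) simp
next
  case (insert k I)
  let ?J = "insert k I"
  define R where "R = (\<lambda>i j. (Q i j + Q j i) / 2)"
  have Rsym: "R i j = R j i" for i j by (simp add: R_def)
  have qR: "qform ?J R c = qform ?J Q c" for c
  proof -
    have "qform ?J (\<lambda>i j. Q j i) c = qform ?J Q c"
      unfolding qform_def by (subst sum.swap) (simp add: ac_simps)
    moreover have "qform ?J R c = (qform ?J Q c + qform ?J (\<lambda>i j. Q j i) c) / 2"
      unfolding qform_def by (simp add: R_def sum.distrib[symmetric] sum_divide_distrib field_simps)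
    ultimately show ?thesis by simp
  qed
  have Rpair: "(\<Sum>i\<in>?J. \<Sum>j\<in>?J. Q i j * S i j) = (\<Sum>i\<in>?J. \<Sum>j\<in>?J. R i j * S i j)"
    if S: "\<forall>i\<in>?J. \<forall>j\<in>?J. S i j = S j i" for S
  proof -
    have "(\<Sum>i\<in>?J. \<Sum>j\<in>?J. Q j i * S i j) = (\<Sum>i\<in>?J. \<Sum>j\<in>?J. Q i j * S i j)"
      by (subst sum.swap) (intro sum.cong, use S in auto)
    then have "(\<Sum>i\<in>?J. \<Sum>j\<in>?J. Q i j * S i j)
      = ((\<Sum>i\<in>?J. \<Sum>j\<in>?J. Q i j * S i j) + (\<Sum>i\<in>?J. \<Sum>j\<in>?J. Q j i * S i j)) / 2" by simp
    also have "\<dots> = (\<Sum>i\<in>?J. \<Sum>j\<in>?J. R i j * S i j)"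
      by (simp only: R_def sum.distrib[symmetric] sum_divide_distrib)
         (intro sum.cong refl, simp add: field_simps)
    finally show ?thesis .
  qed
  have R_psd: "qform ?J R c \<ge> 0" for c using insert.prems by (simp add: qR)
  have exp: "qform ?J R c = R k k * (c k)\<^sup>2 + 2 * c k * (\<Sum>i\<in>I. R k i * c i) + qform I R c" for c
    by (intro qform_insert insert.hyps Rsym)
  have pairsplit: "(\<Sum>i\<in>?J. \<Sum>j\<in>?J. R i j * S i j)
      = R k k * S k k + 2 * (\<Sum>i\<in>I. R k i * S k i) + (\<Sum>i\<in>I. \<Sum>j\<in>I. R i j * S i j)"
    if S: "\<forall>i\<in>?J. \<forall>j\<in>?J. S i j = S j i" for S
  proof -
    have "(\<Sum>i\<in>I. R i k * S i k) = (\<Sum>i\<in>I. R k i * S k i)"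
      by (intro sum.cong refl arg_cong2[where f = "(*)"] Rsym) (use S in blast)
    then show ?thesis using insert.hyps by (simp add: sum.distrib)
  qed
  have a0: "R k k \<ge> 0"
  proof -
    have "qform I R (\<lambda>i. if i = k then 1 else 0) = qform I R (\<lambda>i. 0)"
      using insert.hyps by (intro qform_cong) auto
    moreover have "(\<Sum>i\<in>I. R k i * (if i = k then 1 else 0)) = 0"
      using insert.hyps by (intro sum.neutral) auto
    ultimately show ?thesis
      using R_psd[of "\<lambda>i. if i = k then 1 else 0"] unfolding exp by (simp add: qform_def)
  qed
  \<comment> \<open>Vectors on \<open>I\<close> are extended by 0 at the new index \<open>k\<close>.\<close>
  have ext0: "qform ?J S (b(k := 0)) = qform I S b"
    if S: "\<forall>i\<in>?J. \<forall>j\<in>?J. S i j = S j i" for S b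
  proof -
    have "qform I S (b(k := 0)) = qform I S b"
      using insert.hyps by (intro qform_cong) auto
    moreover have "qform ?J S (b(k := 0)) = S k k * ((b(k := 0)) k)\<^sup>2
        + 2 * (b(k := 0)) k * (\<Sum>i\<in>I. S k i * (b(k := 0)) i) + qform I S (b(k := 0))"
      by (intro qform_insert insert.hyps) (use S in blast)
    ultimately show ?thesis by simp
  qed
  show ?case
  proof (cases "R k k = 0")
    case True
    have zero: "R k i = 0" if "i \<in> I" for i
    proof (rule ccontr)
      assume nz: "R k i \<noteq> 0"
      \<comment> \<open>With \<open>R k k = 0\<close> and \<open>R k i \<noteq> 0\<close>, the form is unbounded below in the direction of \<open>k\<close>; the
        chosen \<open>t\<close> makes its value \<open>- 1\<close>.\<close>
      define r where "r = R i i"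
      define t where "t = - (r + 1) / (2 * R k i)"
      define c where "c = (\<lambda>j. if j = k then t else if j = i then 1 else 0)"
      have ik: "i \<noteq> k" using insert.hyps that by auto
      have "(\<Sum>j\<in>I. R k j * c j) = (\<Sum>j\<in>I. if j = i then R k i else 0)"
        using insert.hyps by (intro sum.cong) (auto simp: c_def)
      then have 1: "(\<Sum>j\<in>I. R k j * c j) = R k i" using that insert.hyps by simp
      have "qform I R c = qform I R (\<lambda>j. if j = i then 1 else 0)"
        using insert.hyps by (intro qform_cong) (auto simp: c_def)
      also have "\<dots> = (\<Sum>j\<in>I. if j = i then r else 0)"
        unfolding qform_def using insert.hyps that
        by (intro sum.cong) (auto simp: r_def if_distrib cong: if_cong)
      finally have 2: "qform I R c = r" using that insert.hyps by simp
      have "qform ?J R c = 2 * t * R k i + r"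
        unfolding exp 1 2 True by (simp add: c_def)
      also have "\<dots> = -1" using nz by (simp add: t_def field_simps)
      finally show False using R_psd[of c] by simp
    qed
    have "qform I R c \<ge> 0" for c
    proof -
      have "qform ?J R (c(k := 0)) = qform I R c" by (intro ext0 ballI Rsym)
      then show ?thesis using R_psd[of "c(k := 0)"] by simp
    qed
    from insert.IH[OF this] obtain bs where bs:
      "\<And>S. \<forall>i\<in>I. \<forall>j\<in>I. S i j = S j i \<Longrightarrow> (\<Sum>i\<in>I. \<Sum>j\<in>I. R i j * S i j) = (\<Sum>b\<leftarrow>bs. qform I S b)"
      by auto
    show ?thesis
    proof (intro exI[of _ "map (\<lambda>b. b(k := 0)) bs"] allI impI)
      fix S :: "'a \<Rightarrow> 'a \<Rightarrow> real" assume S: "\<forall>i\<in>?J. \<forall>j\<in>?J. S i j = S j i"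
      have "(\<Sum>i\<in>I. R k i * S k i) = 0" using zero by simp
      moreover have "(\<Sum>i\<in>I. \<Sum>j\<in>I. R i j * S i j) = (\<Sum>b\<leftarrow>bs. qform I S b)"
        using bs[of S] S by blast
      moreover have "(\<Sum>b\<leftarrow>map (\<lambda>b. b(k := 0)) bs. qform ?J S b) = (\<Sum>b\<leftarrow>bs. qform I S b)"
        by (simp add: o_def ext0[OF S])
      ultimately show "(\<Sum>i\<in>?J. \<Sum>j\<in>?J. Q i j * S i j) = (\<Sum>b\<leftarrow>map (\<lambda>b. b(k := 0)) bs. qform ?J S b)"
        unfolding Rpair[OF S] pairsplit[OF S] True by simp
    qed
  next
    case False
    then have a: "R k k > 0" using a0 by simp
    define B where "B = (\<lambda>i j. R i j - R k i * R k j / R k k)"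
    have schur: "qform ?J R c = R k k * (c k + (\<Sum>i\<in>I. R k i / R k k * c i))\<^sup>2 + qform I B c" for c
      unfolding B_def by (intro qform_schur insert.hyps Rsym a)
    have "qform I B c \<ge> 0" for c
    proof -
      define e where "e = c(k := - (\<Sum>i\<in>I. R k i / R k k * c i))"
      have e: "e i = c i" if "i \<in> I" for i using that insert.hyps by (auto simp: e_def)
      have "qform ?J R e = qform I B c"
        unfolding schur using e by (simp add: e_def cong: qform_cong sum.cong)
      then show ?thesis using R_psd[of e] by simp
    qed
    from insert.IH[OF this] obtain bs where bs:
      "\<And>S. \<forall>i\<in>I. \<forall>j\<in>I. S i j = S j i \<Longrightarrow> (\<Sum>i\<in>I. \<Sum>j\<in>I. B i j * S i j) = (\<Sum>b\<leftarrow>bs. qform I S b)"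
      by auto
    define b0 where "b0 = (\<lambda>i. R k i / sqrt (R k k))"
    have b0: "b0 i * b0 j = R k i * R k j / R k k" for i j using a by (simp add: b0_def)
    show ?thesis
    proof (intro exI[of _ "b0 # map (\<lambda>b. b(k := 0)) bs"] allI impI)
      fix S :: "'a \<Rightarrow> 'a \<Rightarrow> real" assume S: "\<forall>i\<in>?J. \<forall>j\<in>?J. S i j = S j i"
      have "(\<Sum>i\<in>I. \<Sum>j\<in>I. B i j * S i j)
          = (\<Sum>i\<in>I. \<Sum>j\<in>I. R i j * S i j) - qform I S b0"
        unfolding qform_def B_def b0[symmetric]
        by (simp add: sum_subtractf[symmetric] algebra_simps)
      moreover have "(\<Sum>i\<in>I. \<Sum>j\<in>I. B i j * S i j) = (\<Sum>b\<leftarrow>bs. qform I S b)"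
        using bs[of S] S by blast
      moreover have "(\<Sum>b\<leftarrow>map (\<lambda>b. b(k := 0)) bs. qform ?J S b) = (\<Sum>b\<leftarrow>bs. qform I S b)"
        by (simp add: o_def ext0[OF S])
      moreover have "qform ?J S b0 = R k k * S k k + 2 * (\<Sum>i\<in>I. R k i * S k i) + qform I S b0"
      proof -
        have "qform ?J S b0 = S k k * (b0 k)\<^sup>2 + 2 * b0 k * (\<Sum>i\<in>I. S k i * b0 i) + qform I S b0"
          by (intro qform_insert insert.hyps) (use S in blast)
        also have "S k k * (b0 k)\<^sup>2 = R k k * S k k" using a by (simp add: power2_eq_square b0)
        also have "2 * b0 k * (\<Sum>i\<in>I. S k i * b0 i) = 2 * (\<Sum>i\<in>I. (b0 k * b0 i) * S k i)"
          by (simp add: sum_distrib_left ac_simps)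
        also have "(\<Sum>i\<in>I. (b0 k * b0 i) * S k i) = (\<Sum>i\<in>I. R k i * S k i)"
          using a by (simp add: b0)
        finally show ?thesis .
      qed
      ultimately show "(\<Sum>i\<in>?J. \<Sum>j\<in>?J. Q i j * S i j)
          = (\<Sum>b\<leftarrow>b0 # map (\<lambda>b. b(k := 0)) bs. qform ?J S b)"
        unfolding Rpair[OF S] pairsplit[OF S] by simp
    qed
  qed
qed

section \<open>Lagrange multipliers for conic programs\<close>

text \<open>Linearity of a functional, relative to a function \<open>comb\<close> for which \<open>comb s a r b\<close> stands for
  \<open>s a + r b\<close>. No vector space laws are required of \<open>comb\<close>, so tuples of real functions on
  infinite index sets can be used as they are.\<close>

definition lin :: "(real \<Rightarrow> 'a \<Rightarrow> real \<Rightarrow> 'a \<Rightarrow> 'a) \<Rightarrow> ('a \<Rightarrow> real) \<Rightarrow> bool" where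
  "lin comb \<phi> \<longleftrightarrow> (\<forall>s a r b. \<phi> (comb s a r b) = s * \<phi> a + r * \<phi> b)"

lemma linD: "lin comb \<phi> \<Longrightarrow> \<phi> (comb s a r b) = s * \<phi> a + r * \<phi> b"
  by (simp add: lin_def)

text \<open>One multiplier. If \<open>\<phi>\<close> is nonnegative where \<open>l\<close> vanishes, then the slopes \<open>- \<phi> / l\<close> on the part of
  the cone with \<open>l > 0\<close> lie below those on the part with \<open>l < 0\<close>, because a suitable positive
  combination of two points, one from each part, lies on the hyperplane \<open>l = 0\<close>.\<close>

lemma lagrange_step:
  assumes cone: "\<And>a b s r. \<lbrakk>a \<in> D; b \<in> D; s \<ge> 0; r \<ge> 0\<rbrakk> \<Longrightarrow> comb s a r b \<in> D"
    and lin: "lin comb l" "lin comb \<phi>"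
    and D: "p \<in> D" "l p > 0" "m \<in> D" "l m < 0"
    and nonneg: "\<And>z. \<lbrakk>z \<in> D; l z = 0\<rbrakk> \<Longrightarrow> \<phi> z \<ge> 0"
  shows "\<exists>\<nu>. \<forall>z\<in>D. \<phi> z + \<nu> * l z \<ge> 0"
proof -
  let ?S = "(\<lambda>z. - \<phi> z / l z) ` {z\<in>D. l z > 0}"
  have key: "- \<phi> z / l z \<le> - \<phi> w / l w" if "z \<in> D" "l z > 0" "w \<in> D" "l w < 0" for z w
  proof -
    let ?c = "comb (1 / l z) z (- 1 / l w) w"
    have "?c \<in> D" using that by (intro cone) (auto simp: divide_nonpos_neg)
    moreover have "l ?c = 0" using that by (simp add: linD[OF lin(1)])
    ultimately have "\<phi> ?c \<ge> 0" by (rule nonneg)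
    then show ?thesis by (simp add: linD[OF lin(2)])
  qed
  have bdd: "bdd_above ?S"
    by (rule bdd_aboveI[of _ "- \<phi> m / l m"]) (use key D in auto)
  show ?thesis
  proof (intro exI ballI)
    fix z assume z: "z \<in> D"
    show "\<phi> z + Sup ?S * l z \<ge> 0"
    proof (cases "l z" "0::real" rule: linorder_cases)
      case equal
      then show ?thesis using nonneg z by simp
    next
      case greater
      then have "- \<phi> z / l z \<le> Sup ?S" using z bdd by (intro cSup_upper) auto
      then show ?thesis using greater by (simp add: field_simps)
    next
      case less
      then have "Sup ?S \<le> - \<phi> z / l z" using z key D by (intro cSup_least) auto
      then show ?thesis using less by (simp add: field_simps)
    qed
  qed
qed

text \<open>Finitely many multipliers. The point \<open>z0\<close> is feasible and algebraically interior to \<open>C\<close>: from it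
  one can move in every direction and stay in \<open>C\<close>.\<close>

lemma lagrange_multipliers:
  fixes comb :: "real \<Rightarrow> 'a \<Rightarrow> real \<Rightarrow> 'a \<Rightarrow> 'a"
  assumes "finite I"
    and cone: "\<And>a b s r. \<lbrakk>a \<in> C; b \<in> C; s \<ge> 0; r \<ge> 0\<rbrakk> \<Longrightarrow> comb s a r b \<in> C"
    and int: "\<And>e. \<exists>\<epsilon>>0. comb 1 z0 \<epsilon> e \<in> C"
    and z0: "z0 \<in> C"
    and "\<And>i. i \<in> I \<Longrightarrow> lin comb (l i)" "\<And>i. i \<in> I \<Longrightarrow> l i z0 = 0"
    and "lin comb \<phi>" "\<And>z. \<lbrakk>z \<in> C; \<forall>i\<in>I. l i z = 0\<rbrakk> \<Longrightarrow> \<phi> z \<ge> 0"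
  shows "\<exists>\<nu>. \<forall>z\<in>C. \<phi> z + (\<Sum>i\<in>I. \<nu> i * l i z) \<ge> 0"
  using assms(1,5-)
proof (induction I arbitrary: \<phi> rule: finite_induct)
  case empty
  then show ?case by simp
next
  case (insert j I)
  note linI = linD[OF insert.prems(1)]
  define D where "D = {z\<in>C. \<forall>i\<in>I. l i z = 0}"
  have "\<exists>\<nu>. \<forall>z\<in>D. \<phi> z + \<nu> * l j z \<ge> 0"
  proof (cases "\<exists>e. (\<forall>i\<in>I. l i e = 0) \<and> l j e \<noteq> 0")
    case True
    then obtain e where e: "\<And>i. i \<in> I \<Longrightarrow> l i e = 0" "l j e \<noteq> 0" by auto
    have *: "\<exists>z\<in>D. sgn (l j z) = sgn (l j e)" if e: "\<And>i. i \<in> I \<Longrightarrow> l i e = 0" for e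
    proof -
      obtain \<epsilon> where \<epsilon>: "\<epsilon> > 0" "comb 1 z0 \<epsilon> e \<in> C" using int by blast
      then have "comb 1 z0 \<epsilon> e \<in> D"
        using e insert.prems(2) by (simp add: D_def linI)
      moreover have "sgn (l j (comb 1 z0 \<epsilon> e)) = sgn (l j e)"
        using \<epsilon> insert.prems(2) by (simp add: linI sgn_mult)
      ultimately show ?thesis by blast
    qed
    let ?e = "comb (- 1) e 0 e"
    have neg: "l i ?e = - l i e" if "i \<in> insert j I" for i using linI[OF that] by simp
    \<comment> \<open>Moving from \<open>z0\<close> along \<open>e\<close> and along \<open>- e\<close> produces points of both signs.\<close>
    obtain z where z: "z \<in> D" "sgn (l j z) = sgn (l j e)" using * e by blast
    have "l i ?e = 0" if "i \<in> I" for i using neg[of i] e(1) that by simp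
    with * obtain w where w: "w \<in> D" "sgn (l j w) = sgn (l j ?e)" by blast
    then have w': "sgn (l j w) = - sgn (l j e)" using neg[of j] by (simp add: sgn_minus)
    have "\<exists>p\<in>D. l j p > 0" "\<exists>p\<in>D. l j p < 0"
      using z w(1) w' e(2) by (cases "l j e > 0"; force simp: sgn_1_pos sgn_1_neg)+
    then obtain p m where "p \<in> D" "l j p > 0" "m \<in> D" "l j m < 0" by blast
    then show ?thesis
    proof (intro lagrange_step[where comb = comb and p = p and m = m])
      show "comb s a r b \<in> D" if "a \<in> D" "b \<in> D" "s \<ge> 0" "r \<ge> 0" for a b s r
        using that by (simp add: D_def cone linI)
      show "lin comb (l j)" by (rule insert.prems(1)) simp
      show "\<phi> z \<ge> 0" if "z \<in> D" "l j z = 0" for z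
        using that by (intro insert.prems(4)) (simp_all add: D_def)
    qed (rule insert.prems(3))
  next
    case False
    then have "l j z = 0" if "z \<in> D" for z using that by (auto simp: D_def)
    then show ?thesis using insert.prems(4) by (auto simp: D_def)
  qed
  then obtain \<nu>j where \<nu>j: "\<And>z. z \<in> D \<Longrightarrow> \<phi> z + \<nu>j * l j z \<ge> 0" by blast
  have "\<exists>\<nu>. \<forall>z\<in>C. (\<phi> z + \<nu>j * l j z) + (\<Sum>i\<in>I. \<nu> i * l i z) \<ge> 0"
  proof (rule insert.IH)
    show "lin comb (\<lambda>z. \<phi> z + \<nu>j * l j z)"
      using insert.prems(1)[of j] insert.prems(3) by (simp add: lin_def algebra_simps)
  qed (use insert.prems \<nu>j in \<open>auto simp: D_def\<close>)
  then obtain \<nu> where \<nu>: "\<And>z. z \<in> C \<Longrightarrow> (\<phi> z + \<nu>j * l j z) + (\<Sum>i\<in>I. \<nu> i * l i z) \<ge> 0" by blast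
  show ?case
  proof (intro exI ballI)
    fix z assume "z \<in> C"
    have "(\<Sum>i\<in>I. (\<nu>(j := \<nu>j)) i * l i z) = (\<Sum>i\<in>I. \<nu> i * l i z)"
      using insert.hyps by (intro sum.cong) auto
    then show "\<phi> z + (\<Sum>i\<in>insert j I. (\<nu>(j := \<nu>j)) i * l i z) \<ge> 0"
      using \<nu>[OF \<open>z \<in> C\<close>] insert.hyps by simp
  qed
qed

section \<open>Semidefinite duality\<close>

text \<open>A semidefinite program in variables \<open>z\<close> maximizes \<open>c z\<close> subject to \<open>L e z = rhs e\<close> and to positive
  semidefiniteness of the blocks \<open>Ent b\<close>, which depend linearly on \<open>z\<close>. If some \<open>z0\<close> satisfies the
  equations with positive definite blocks and \<open>\<rho>\<close> bounds the objective, then the bound has a certificate.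

  The multipliers live in the space of triples \<open>(M, z, t)\<close>, with \<open>M\<close> a family of matrices, the cone
  \<open>M \<succeq> 0\<close>, \<open>t \<ge> 0\<close>, the equations \<open>M b i j = Ent b i j z\<close> and \<open>L e z = t rhs e\<close>, and the functional
  \<open>t \<rho> - c z\<close>. The variable \<open>t\<close> homogenizes the program: points with \<open>t > 0\<close> are scaled feasible
  points, and those with \<open>t = 0\<close> are recession directions, along which \<open>c\<close> cannot increase.\<close>

theorem sdp_strong_duality:
  fixes comb :: "real \<Rightarrow> 'z \<Rightarrow> real \<Rightarrow> 'z \<Rightarrow> 'z"
    and Ent :: "'b \<Rightarrow> 'i \<Rightarrow> 'i \<Rightarrow> 'z \<Rightarrow> real"
  assumes fin: "finite Bl" "\<And>b. b \<in> Bl \<Longrightarrow> finite (I b)" "finite E"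
    and linear: "\<And>b i j. b \<in> Bl \<Longrightarrow> lin comb (Ent b i j)" "\<And>e. e \<in> E \<Longrightarrow> lin comb (L e)" "lin comb c"
    and sym: "\<And>b i j z. Ent b i j z = Ent b j i z"
    and slater: "\<And>b. b \<in> Bl \<Longrightarrow> pd_on (I b) (\<lambda>i j. Ent b i j z0)" "\<And>e. e \<in> E \<Longrightarrow> L e z0 = rhs e"
    and bound: "\<And>z. \<lbrakk>\<And>b. b \<in> Bl \<Longrightarrow> psd_on (I b) (\<lambda>i j. Ent b i j z); \<And>e. e \<in> E \<Longrightarrow> L e z = rhs e\<rbrakk>
      \<Longrightarrow> c z \<le> \<rho>"
  shows "\<exists>\<nu> bs. (\<forall>z. (\<Sum>e\<in>E. \<nu> e * L e z) - c z
        = (\<Sum>b\<in>Bl. \<Sum>q\<leftarrow>bs b. qform (I b) (\<lambda>i j. Ent b i j z) q))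
      \<and> (\<Sum>e\<in>E. \<nu> e * rhs e) \<le> \<rho>"
proof -
  define cmb where "cmb = (\<lambda>s (M, z, t) r (N, w, u).
     ((\<lambda>b i j. s * M b i j + r * N b i j) :: 'b \<Rightarrow> 'i \<Rightarrow> 'i \<Rightarrow> real, comb s z r w, s * t + r * u :: real))"
  define C where "C = {(M, z :: 'z, t). (\<forall>b\<in>Bl. \<forall>q. qform (I b) (M b) q \<ge> 0) \<and> t \<ge> (0::real)}"
  define Z0 where "Z0 = ((\<lambda>b i j. Ent b i j z0), z0, 1::real)"
  define K where "K = (SIGMA b:Bl. I b \<times> I b) <+> E"
  define l where "l k = (\<lambda>(M, z, t). case k of Inl (b, i, j) \<Rightarrow> M b i j - Ent b i j z
     | Inr e \<Rightarrow> L e z - t * rhs e)" for k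
  define \<phi> where "\<phi> = (\<lambda>(M :: 'b \<Rightarrow> 'i \<Rightarrow> 'i \<Rightarrow> real, z, t). t * \<rho> - c z)"
  have qform_comb: "qform J (\<lambda>i j. s * A i j + r * B i j) q = s * qform J A q + r * qform J B q"
    for J s r q and A B :: "'i \<Rightarrow> 'i \<Rightarrow> real"
    by (simp add: qform_def sum.distrib[symmetric] sum_distrib_left algebra_simps)
  have psdI: "psd_on (I b) (\<lambda>i j. Ent b i j z)" if "\<And>q. qform (I b) (\<lambda>i j. Ent b i j z) q \<ge> 0" for b z
    using that sym unfolding psd_on_def qform_def by blast
  have "\<exists>\<nu>. \<forall>x\<in>C. \<phi> x + (\<Sum>k\<in>K. \<nu> k * l k x) \<ge> 0"
  proof (rule lagrange_multipliers[where comb = cmb and ?z0.0 = Z0])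
    show "finite K" using fin unfolding K_def by (intro finite_Plus finite_SigmaI) auto
    show "cmb s a r b \<in> C" if "a \<in> C" "b \<in> C" "s \<ge> 0" "r \<ge> 0" for a b s r
      using that by (auto simp: C_def cmb_def qform_comb)
    show "Z0 \<in> C"
    proof -
      have "qform (I b) (\<lambda>i j. Ent b i j z0) q \<ge> 0" if "b \<in> Bl" for b q
      proof (cases "\<exists>i\<in>I b. q i \<noteq> 0")
        case True
        then show ?thesis using slater(1)[OF that] by (auto simp: pd_on_def qform_def less_imp_le)
      next
        case False
        then show ?thesis by (simp add: qform_def)
      qed
      then show ?thesis by (auto simp: C_def Z0_def)
    qed
    show "lin cmb (l k)" if kK: "k \<in> K" for k
    proof (cases k)
      case (Inl bij)
      then obtain b i j where k: "k = Inl (b, i, j)" "b \<in> Bl" using kK by (cases bij) (auto simp: K_def)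
      then show ?thesis
        using linD[OF linear(1)] by (auto simp: lin_def l_def cmb_def algebra_simps)
    next
      case (Inr e)
      then have "e \<in> E" using kK by (auto simp: K_def)
      then show ?thesis using Inr
        using linD[OF linear(2)] by (auto simp: lin_def l_def cmb_def algebra_simps)
    qed
    show "l k Z0 = 0" if "k \<in> K" for k
      using that slater(2) by (auto simp: K_def l_def Z0_def)
    show "lin cmb \<phi>"
      using linD[OF linear(3)] by (auto simp: lin_def \<phi>_def cmb_def algebra_simps)
    show "\<exists>\<epsilon>>0. cmb 1 Z0 \<epsilon> x \<in> C" for x
    proof -
      obtain M z t where x: "x = (M, z, t)" by (cases x)
      have "\<forall>\<^sub>F \<epsilon> in at_right 0. \<forall>q. qform (I b) (\<lambda>i j. Ent b i j z0 - \<epsilon> * (- M b i j)) q \<ge> 0" if "b \<in> Bl" for b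
        using pd_perturb[OF fin(2)[OF that] slater(1)[OF that], of "\<lambda>i j. - M b i j"]
      proof eventually_elim
        case (elim \<epsilon>)
        show ?case
        proof
          fix q
          show "qform (I b) (\<lambda>i j. Ent b i j z0 - \<epsilon> * (- M b i j)) q \<ge> 0"
          proof (cases "\<exists>i\<in>I b. q i \<noteq> 0")
            case True
            then show ?thesis using elim[rule_format, of q] by linarith
          next
            case False
            then show ?thesis by (simp add: qform_def)
          qed
        qed
      qed
      then have ev: "\<forall>\<^sub>F \<epsilon> in at_right 0. \<forall>b\<in>Bl. \<forall>q. qform (I b) (\<lambda>i j. Ent b i j z0 - \<epsilon> * (- M b i j)) q \<ge> 0"
        using fin(1) by (simp add: eventually_ball_finite)
      have ev2: "\<forall>\<^sub>F \<epsilon> in at_right 0. 0 \<le> 1 + \<epsilon> * t"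
        by (rule eventually_mono[OF eventually_at_right_real[of 0 "1 / (\<bar>t\<bar> + 1)"]])
           (auto simp: field_simps abs_if split: if_splits)
      have "\<exists>\<epsilon>. (\<forall>b\<in>Bl. \<forall>q. qform (I b) (\<lambda>i j. Ent b i j z0 - \<epsilon> * (- M b i j)) q \<ge> 0)
          \<and> 0 \<le> 1 + \<epsilon> * t \<and> \<epsilon> > 0"
        using eventually_happens'[OF _ eventually_conj[OF ev eventually_conj[OF ev2 eventually_at_right_less[of 0]]]]
        by (simp add: trivial_limit_at_right_real)
      then show ?thesis by (auto simp: x cmb_def Z0_def C_def)
    qed
    show "\<phi> x \<ge> 0" if x: "x \<in> C" "\<forall>k\<in>K. l k x = 0" for x
    proof -
      obtain M z t where xd: "x = (M, z, t)" by (cases x)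
      have t: "t \<ge> 0" using x by (simp add: C_def xd)
      have M: "M b i j = Ent b i j z" if "b \<in> Bl" "i \<in> I b" "j \<in> I b" for b i j
        using x(2)[rule_format, of "Inl (b, i, j)"] that by (auto simp: K_def l_def xd)
      have Lz: "L e z = t * rhs e" if "e \<in> E" for e
        using x(2)[rule_format, of "Inr e"] that by (auto simp: K_def l_def xd)
      have pos: "qform (I b) (\<lambda>i j. Ent b i j z) q \<ge> 0" if "b \<in> Bl" for b q
      proof -
        have "qform (I b) (\<lambda>i j. Ent b i j z) q = qform (I b) (M b) q"
          unfolding qform_def using M that by (intro sum.cong) auto
        then show ?thesis using x(1) that by (auto simp: C_def xd)
      qed
      have entc: "qform (I b) (\<lambda>i j. Ent b i j (comb s v r w)) q
          = s * qform (I b) (\<lambda>i j. Ent b i j v) q + r * qform (I b) (\<lambda>i j. Ent b i j w) q"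
        if "b \<in> Bl" for b s v r w q
        using linD[OF linear(1)[OF that]] by (simp add: qform_comb)
      show ?thesis
      proof (cases "t = 0")
        case False
        let ?w = "comb (1 / t) z 0 z"
        have "c ?w \<le> \<rho>"
        proof (rule bound)
          show "psd_on (I b) (\<lambda>i j. Ent b i j ?w)" if "b \<in> Bl" for b
            using pos[OF that] t by (intro psdI) (simp add: entc that)
          show "L e ?w = rhs e" if "e \<in> E" for e
            using linD[OF linear(2)[OF that]] Lz[OF that] False by simp
        qed
        then show ?thesis using t False by (simp add: \<phi>_def xd linD[OF linear(3)] field_simps)
      next
        case True
        have "c z0 + k * c z \<le> \<rho>" if k: "k \<ge> 0" for k
        proof -
          let ?w = "comb 1 z0 k z"
          have "c ?w \<le> \<rho>"
          proof (rule bound)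
            show "psd_on (I b) (\<lambda>i j. Ent b i j ?w)" if "b \<in> Bl" for b
            proof -
              have "qform (I b) (\<lambda>i j. Ent b i j z0) q \<ge> 0" for q
                using \<open>Z0 \<in> C\<close> that by (auto simp: C_def Z0_def)
              then show ?thesis using pos[OF that] k by (intro psdI) (simp add: entc that)
            qed
            show "L e ?w = rhs e" if "e \<in> E" for e
              using linD[OF linear(2)[OF that]] Lz[OF that] slater(2)[OF that] True by simp
          qed
          then show ?thesis by (simp add: linD[OF linear(3)])
        qed
        note unb = this
        have "c z \<le> 0"
        proof (rule ccontr)
          assume "\<not> c z \<le> 0"
          define k where "k = (\<bar>\<rho> - c z0\<bar> + 1) / c z"
          have "k \<ge> 0" "k * c z = \<bar>\<rho> - c z0\<bar> + 1"
            using \<open>\<not> c z \<le> 0\<close> by (auto simp: k_def)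
          then show False using unb[of k] by linarith
        qed
        then show ?thesis using True by (simp add: \<phi>_def xd)
      qed
    qed
  qed
  then obtain \<nu> where \<nu>: "\<And>x. x \<in> C \<Longrightarrow> \<phi> x + (\<Sum>k\<in>K. \<nu> k * l k x) \<ge> 0" by blast
  define Q where "Q b i j = \<nu> (Inl (b, i, j))" for b i j
  define \<mu> where "\<mu> e = \<nu> (Inr e)" for e
  define ent where "ent z = (\<Sum>b\<in>Bl. \<Sum>i\<in>I b. \<Sum>j\<in>I b. Q b i j * Ent b i j z)" for z
  have expand: "(\<Sum>k\<in>K. \<nu> k * l k (M, z, t)) = (\<Sum>b\<in>Bl. \<Sum>i\<in>I b. \<Sum>j\<in>I b. Q b i j * M b i j)
       - ent z + ((\<Sum>e\<in>E. \<mu> e * L e z) - t * (\<Sum>e\<in>E. \<mu> e * rhs e))" for M z t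
  proof -
    have "(\<Sum>k\<in>K. \<nu> k * l k (M, z, t))
       = (\<Sum>k\<in>(SIGMA b:Bl. I b \<times> I b). \<nu> (Inl k) * l (Inl k) (M, z, t)) + (\<Sum>e\<in>E. \<nu> (Inr e) * l (Inr e) (M, z, t))"
      unfolding K_def using fin by (subst sum.Plus) auto
    also have "(\<Sum>k\<in>(SIGMA b:Bl. I b \<times> I b). \<nu> (Inl k) * l (Inl k) (M, z, t))
       = (\<Sum>b\<in>Bl. \<Sum>i\<in>I b. \<Sum>j\<in>I b. \<nu> (Inl (b, i, j)) * l (Inl (b, i, j)) (M, z, t))"
      using fin by (simp add: sum.Sigma sum.cartesian_product split_def)
    also have "\<dots> = (\<Sum>b\<in>Bl. \<Sum>i\<in>I b. \<Sum>j\<in>I b. Q b i j * M b i j) - ent z"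
      by (simp add: l_def Q_def ent_def sum_subtractf right_diff_distrib)
    also have "(\<Sum>e\<in>E. \<nu> (Inr e) * l (Inr e) (M, z, t)) = (\<Sum>e\<in>E. \<mu> e * L e z) - t * (\<Sum>e\<in>E. \<mu> e * rhs e)"
      by (simp add: l_def \<mu>_def sum_subtractf sum_distrib_left right_diff_distrib mult.left_commute)
    finally show ?thesis .
  qed
  have ineq: "t * \<rho> - c z + (\<Sum>b\<in>Bl. \<Sum>i\<in>I b. \<Sum>j\<in>I b. Q b i j * M b i j)
       - ent z + ((\<Sum>e\<in>E. \<mu> e * L e z) - t * (\<Sum>e\<in>E. \<mu> e * rhs e)) \<ge> 0"
    if "\<And>b q. b \<in> Bl \<Longrightarrow> qform (I b) (M b) q \<ge> 0" "t \<ge> 0" for M z t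
    using \<nu>[of "(M, z, t)"] that unfolding expand by (simp add: C_def \<phi>_def)
  define f where "f z = (\<Sum>e\<in>E. \<mu> e * L e z) - c z - ent z" for z
  \<comment> \<open>The variable \<open>z\<close> is free in the cone, so its total coefficient vanishes.\<close>
  have f0: "f z = 0" for z
  proof -
    have nn: "f w \<ge> 0" for w
      using ineq[of "\<lambda>_ _ _. 0" 0 w] by (simp add: f_def qform_def)
    have "f (comb (-1) z 0 z) = - f z"
    proof -
      have "ent (comb (-1) z 0 z) = - ent z"
        unfolding ent_def sum_negf[symmetric] using linD[OF linear(1)] by (intro sum.cong) auto
      moreover have "(\<Sum>e\<in>E. \<mu> e * L e (comb (-1) z 0 z)) = - (\<Sum>e\<in>E. \<mu> e * L e z)"
        unfolding sum_negf[symmetric] using linD[OF linear(2)] by (intro sum.cong) auto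
      ultimately show ?thesis by (simp add: f_def linD[OF linear(3)])
    qed
    then show ?thesis using nn[of z] nn[of "comb (-1) z 0 z"] by simp
  qed
  \<comment> \<open>The coefficient of \<open>t\<close> is nonnegative.\<close>
  have "(\<Sum>e\<in>E. \<mu> e * rhs e) \<le> \<rho>"
    using ineq[of "\<lambda>_ _ _. 0" 1 z0] f0[of z0] by (simp add: f_def qform_def)
  moreover have "\<exists>bs. \<forall>S. (\<forall>i\<in>I b. \<forall>j\<in>I b. S i j = S j i) \<longrightarrow>
      (\<Sum>i\<in>I b. \<Sum>j\<in>I b. Q b i j * S i j) = (\<Sum>q\<leftarrow>bs. qform (I b) S q)" if b: "b \<in> Bl" for b
  proof (rule psd_rank_one_sum[OF fin(2)[OF b]])
    \<comment> \<open>Testing with rank-one matrices supported in one block shows that the multipliers of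
      that block form a positive semidefinite matrix.\<close>
    fix q :: "'i \<Rightarrow> real"
    define M where "M = (\<lambda>b' i j. if b' = b then q i * q j else (0::real))"
    have "qform (I b') (M b') e \<ge> 0" if "b' \<in> Bl" for b' e
      using fin(2)[OF that] qform_rank_one[of "I b'" q e]
      by (cases "b' = b") (auto simp: M_def qform_def)
    from ineq[of M 0 z0, OF this] f0[of z0]
    have "0 \<le> (\<Sum>b'\<in>Bl. \<Sum>i\<in>I b'. \<Sum>j\<in>I b'. Q b' i j * M b' i j)" by (simp add: f_def)
    also have "\<dots> = (\<Sum>b'\<in>Bl. if b' = b then qform (I b) (Q b) q else 0)"
      by (intro sum.cong) (auto simp: M_def qform_def ac_simps)
    also have "\<dots> = qform (I b) (Q b) q" using b fin(1) by simp
    finally show "qform (I b) (Q b) q \<ge> 0" .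
  qed
  then have "\<exists>bs. \<forall>b\<in>Bl. \<forall>S. (\<forall>i\<in>I b. \<forall>j\<in>I b. S i j = S j i) \<longrightarrow>
      (\<Sum>i\<in>I b. \<Sum>j\<in>I b. Q b i j * S i j) = (\<Sum>q\<leftarrow>bs b. qform (I b) S q)"
    by (intro bchoice ballI)
  then obtain bs where bs: "\<forall>b\<in>Bl. \<forall>S. (\<forall>i\<in>I b. \<forall>j\<in>I b. S i j = S j i) \<longrightarrow>
      (\<Sum>i\<in>I b. \<Sum>j\<in>I b. Q b i j * S i j) = (\<Sum>q\<leftarrow>bs b. qform (I b) S q)" ..
  have "ent z = (\<Sum>b\<in>Bl. \<Sum>q\<leftarrow>bs b. qform (I b) (\<lambda>i j. Ent b i j z) q)" for z
    unfolding ent_def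
    by (intro sum.cong refl bs[rule_format, where S = "\<lambda>i j. Ent _ i j z"] sym)
  then have "(\<Sum>e\<in>E. \<mu> e * L e z) - c z = (\<Sum>b\<in>Bl. \<Sum>q\<leftarrow>bs b. qform (I b) (\<lambda>i j. Ent b i j z) q)" for z
    using f0[of z] by (simp add: f_def)
  ultimately show ?thesis by blast
qed

section \<open>Uniform measures on compact sets\<close>

text \<open>The normalized Lebesgue measure on \<open>S\<close>, with the traces of Borel sets as its \<open>\<sigma>\<close>-field.\<close>

definition unif :: "'a::euclidean_space set \<Rightarrow> 'a measure" where
  "unif S = uniform_measure (restrict_space lborel S) S"

lemma emeasure_lborel_open_pos:
  fixes U :: "'a::euclidean_space set"
  assumes "open U" "U \<noteq> {}"
  shows "emeasure lborel U > 0"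
proof (rule ccontr)
  assume "\<not> ?thesis"
  then have "U \<in> null_sets lborel" using assms(1) by (auto simp: null_sets_def)
  then have "negligible U" by (simp add: negligible_iff_null_sets null_sets_completionI)
  then show False using open_not_negligible assms by blast
qed

context
  fixes S :: "'a::euclidean_space set"
  assumes S: "compact S" "interior S \<noteq> {}"
begin

lemma unif_base:
  "S \<in> sets lborel" "emeasure lborel S \<noteq> 0" "emeasure lborel S \<noteq> \<infinity>"
proof -
  show "S \<in> sets lborel" using S(1) by (simp add: borel_compact)
  then have "emeasure lborel (interior S) \<le> emeasure lborel S"
    by (intro emeasure_mono interior_subset) auto
  then show "emeasure lborel S \<noteq> 0"
    using emeasure_lborel_open_pos[OF open_interior S(2)] by auto
  show "emeasure lborel S \<noteq> \<infinity>" using emeasure_lborel_cbox_finite emeasure_compact_finite[OF S(1)] by auto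
qed

lemma space_unif [simp]: "space (unif S) = S"
  by (simp add: unif_def space_restrict_space)

lemma sets_unif: "sets (unif S) = sets (borel_on S)"
  by (simp add: unif_def borel_on_def sets_restrict_space)

lemma prob_space_unif: "prob_space (unif S)"
  unfolding unif_def using unif_base
  by (intro prob_space_uniform_measure) (simp_all add: emeasure_restrict_space)

lemma emeasure_unif_open_pos:
  assumes "open U" "U \<noteq> {}" "U \<subseteq> S"
  shows "U \<in> sets (unif S)" "emeasure (unif S) U > 0"
proof -
  have U: "U \<in> sets (restrict_space lborel S)"
    using assms unif_base by (auto simp: sets_restrict_space_iff)
  then show "U \<in> sets (unif S)" by (simp add: unif_def)
  have "emeasure (unif S) U = emeasure lborel U / emeasure lborel S"
    unfolding unif_def using U assms(3) unif_base
    by (subst emeasure_uniform_measure) (auto simp: emeasure_restrict_space sets_restrict_space_iff Int_absorb1)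
  then show "emeasure (unif S) U > 0"
    using emeasure_lborel_open_pos[OF assms(1,2)] unif_base
    by (simp add: ennreal_divide_eq_0_iff zero_less_iff_neq_zero)
qed

end

lemma lam_unif: "lam P = unif (XX P)"
  by (simp add: lam_def unif_def)

lemma integral_pos_of_pos_on:
  fixes f :: "'a \<Rightarrow> real"
  assumes "integrable \<pi> f" "\<And>z. z \<in> space \<pi> \<Longrightarrow> f z \<ge> 0"
    and "B \<in> sets \<pi>" "emeasure \<pi> B > 0" "\<And>z. z \<in> B \<Longrightarrow> f z > 0"
  shows "(\<integral>z. f z \<partial>\<pi>) > 0"
proof (rule ccontr)
  assume "\<not> ?thesis"
  moreover have "(\<integral>z. f z \<partial>\<pi>) \<ge> 0" using assms(2) by (intro integral_nonneg_AE) auto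
  ultimately have "(\<integral>z. f z \<partial>\<pi>) = 0" by simp
  then have "AE z in \<pi>. f z = 0"
    using integral_nonneg_eq_0_iff_AE[OF assms(1)] assms(2) by auto
  then have "AE z in \<pi>. z \<notin> B" by eventually_elim (use assms(5) in force)
  then have "emeasure \<pi> B = 0" using assms(3) AE_iff_null_sets by blast
  then show False using assms(4) by simp
qed

text \<open>Continuous functions are bounded on compact sets, so they are integrable against any finite measure
  living on a compact set whose \<open>\<sigma>\<close>-field contains the traces of Borel sets.\<close>

lemma integrable_continuous_bounded:
  fixes f :: "'a::topological_space \<Rightarrow> real"
  assumes "finite_measure \<pi>" "(\<lambda>z. z) \<in> measurable \<pi> borel" "compact (space \<pi>)" "continuous_on UNIV f"
  shows "integrable \<pi> f"
proof -
  interpret finite_measure \<pi> by fact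
  have "f \<in> borel_measurable borel" using assms(4) by (rule borel_measurable_continuous_onI)
  from measurable_compose[OF assms(2) this] have meas: "f \<in> borel_measurable \<pi>" .
  have "bounded (f ` space \<pi>)"
    using assms(3,4) by (intro compact_imp_bounded compact_continuous_image) (auto intro: continuous_on_subset)
  then obtain B where "\<And>z. z \<in> space \<pi> \<Longrightarrow> norm (f z) \<le> B" by (auto simp: bounded_iff)
  then show ?thesis using meas by (intro integrable_const_bound[of _ B]) auto
qed

lemma unif_id_measurable:
  assumes "compact S" "interior S \<noteq> {}"
  shows "(\<lambda>z. z) \<in> measurable (unif S) borel"
  unfolding measurable_cong_sets[OF sets_unif[OF assms] refl] borel_on_def
  by (simp add: measurable_restrict_space1)

text \<open>The moments of a measure in two groups of variables.\<close>

definition moment2 :: "((real ^ 'v::finite) \<times> (real ^ 'w::finite)) measure \<Rightarrow> ('v + 'w) mon \<Rightarrow> real" where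
  "moment2 \<pi> \<gamma> = (\<integral>z. ev2 (mono_pol \<gamma>) z \<partial>\<pi>)"

lemma riesz_moment2:
  assumes "finite_measure \<pi>" "(\<lambda>z. z) \<in> measurable \<pi> borel" "compact (space \<pi>)"
  shows "riesz (moment2 \<pi>) q = (\<integral>z. ev2 q z \<partial>\<pi>)"
proof -
  have "integrable \<pi> (\<lambda>z. ev2 (mono_pol \<gamma>) z)" for \<gamma>
    using assms by (intro integrable_continuous_bounded continuous_intros) auto
  then have "(\<integral>z. (\<Sum>\<gamma>\<in>Poly_Mapping.keys q. Poly_Mapping.lookup q \<gamma> * ev2 (mono_pol \<gamma>) z) \<partial>\<pi>)
     = riesz (moment2 \<pi>) q"
    by (subst Bochner_Integration.integral_sum) (auto simp: riesz_def moment2_def)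
  then show ?thesis by (simp add: pol_eval_simps) (simp add: pol_eval_def)
qed

text \<open>The hypothesis on \<open>\<pi>\<close> is stated for products of open sets, since these are what a product
  measure handles directly.\<close>

lemma riesz_moment2_pos:
  fixes q :: "('v::finite + 'w::finite) mpol"
  assumes \<pi>: "finite_measure \<pi>" "(\<lambda>z. z) \<in> measurable \<pi> borel" "compact (space \<pi>)"
    and nonneg: "\<And>z. z \<in> space \<pi> \<Longrightarrow> ev2 q z \<ge> 0"
    and z0: "ev2 q z0 > 0" "z0 \<in> interior (space \<pi>)"
    and open_pos: "\<And>U V. \<lbrakk>open U; open V; U \<noteq> {}; V \<noteq> {}; U \<times> V \<subseteq> space \<pi>\<rbrakk>
      \<Longrightarrow> U \<times> V \<in> sets \<pi> \<and> emeasure \<pi> (U \<times> V) > 0"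
  shows "riesz (moment2 \<pi>) q > 0"
proof -
  have "open {z. ev2 q z > 0}" by (intro open_Collect_less continuous_intros)
  then have "open (interior (space \<pi>) \<inter> {z. ev2 q z > 0})" by auto
  moreover have "z0 \<in> interior (space \<pi>) \<inter> {z. ev2 q z > 0}" using z0 by auto
  ultimately obtain U V where UV: "open U" "open V" "z0 \<in> U \<times> V"
      "U \<times> V \<subseteq> interior (space \<pi>) \<inter> {z. ev2 q z > 0}"
    by (rule open_prod_elim)
  then have "U \<times> V \<subseteq> space \<pi>" using interior_subset by fastforce
  then have *: "U \<times> V \<in> sets \<pi>" "emeasure \<pi> (U \<times> V) > 0" using open_pos UV by auto
  show ?thesis
    unfolding riesz_moment2[OF \<pi>]
    using \<pi> nonneg * UV
    by (intro integral_pos_of_pos_on[where B = "U \<times> V"] integrable_continuous_bounded continuous_intros) auto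
qed

lemma pd_loc_mat:
  assumes "\<And>p. p \<noteq> 0 \<Longrightarrow> riesz z (g * (p * p)) > 0" and "finite I"
  shows "pd_on I (loc_mat g z)"
  unfolding pd_on_def
proof (intro conjI ballI allI impI)
  show "loc_mat g z \<alpha> \<beta> = loc_mat g z \<beta> \<alpha>" for \<alpha> \<beta> by (rule loc_mat_sym)
  fix c assume "\<exists>\<alpha>\<in>I. c \<alpha> \<noteq> (0::real)"
  then obtain \<alpha> where "\<alpha> \<in> I" "c \<alpha> \<noteq> 0" by auto
  then have "Poly_Mapping.lookup (coeff_pol I c) \<alpha> \<noteq> 0" using assms(2) by (simp add: lookup_coeff_pol)
  then have "coeff_pol I c \<noteq> 0" by auto
  then show "0 < (\<Sum>i\<in>I. \<Sum>j\<in>I. c i * loc_mat g z i j * c j)"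
    unfolding loc_mat_form by (rule assms(1))
qed

lemma pol_rename_Inl_nonzero: "g \<noteq> 0 \<Longrightarrow> (pol_rename Inl g :: ('v::finite + 'w::finite) mpol) \<noteq> 0"
proof
  assume g: "g \<noteq> 0" "(pol_rename Inl g :: ('v + 'w) mpol) = 0"
  obtain z where "ev1 g z \<noteq> 0" using ev1_nonzero_open[OF g(1) open_UNIV] by auto
  moreover have "ev1 g z = ev2 (pol_rename Inl g :: ('v + 'w) mpol) (z, 0)" by simp
  ultimately show False unfolding g(2) by (simp add: pol_eval_simps)
qed

lemma pol_rename_Inr_nonzero: "g \<noteq> 0 \<Longrightarrow> (pol_rename Inr g :: ('v::finite + 'w::finite) mpol) \<noteq> 0"
proof
  assume g: "g \<noteq> 0" "(pol_rename Inr g :: ('v + 'w) mpol) = 0"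
  obtain z where "ev1 g z \<noteq> 0" using ev1_nonzero_open[OF g(1) open_UNIV] by auto
  moreover have "ev1 g z = ev2 (pol_rename Inr g :: ('v + 'w) mpol) (0, z)" by simp
  ultimately show False unfolding g(2) by (simp add: pol_eval_simps)
qed

section \<open>The setting\<close>

text \<open>The standing hypotheses on the sets, the polynomials and the family of measures.\<close>

locale mixture_setting =
  fixes P :: "('n::finite, 'p::finite, 't::finite) data"
  assumes compact_X: "compact (XX P)" and compact_A: "compact (AA P)"
    and gg_nz: "\<And>j. j \<in> {1..ng P} \<Longrightarrow> gg P j \<noteq> 0"
    and qq_nz: "\<And>l. l \<in> {1..nq P} \<Longrightarrow> qq P l \<noteq> 0"
    and ss_nz: "\<And>l. l \<in> {1..ns P} \<Longrightarrow> ss P l \<noteq> 0"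
    and mu_prob: "\<And>a. a \<in> AA P \<Longrightarrow> mu P a \<in> prob_meas (Om P)"
    and mu_meas: "\<And>B. B \<in> sets (borel_on (Om P)) \<Longrightarrow>
      (\<lambda>a. measure (mu P a) B) \<in> borel_measurable (borel_on (AA P))"
    and mu_moment: "\<And>\<beta> a. a \<in> AA P \<Longrightarrow>
      has_bochner_integral (mu P a) (\<lambda>\<omega>. mon_eval (($) \<omega>) \<beta>) (ev1 (pp P \<beta>) a)"
    and mu_null: "\<And>a g. \<lbrakk>a \<in> AA P; g \<noteq> 0\<rbrakk> \<Longrightarrow> measure (mu P a) {\<omega> \<in> Om P. ev1 g \<omega> = 0} = 0"
    and mu_measurable: "\<And>q. bdd_measurable_on (XX P \<times> Om P) q \<Longrightarrow>
      bdd_measurable_on (XX P \<times> AA P) (\<lambda>(x, a). \<integral>\<omega>. q (x, \<omega>) \<partial>(mu P a))"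
    and mu_continuous: "\<And>q. bdd_continuous_on (XX P \<times> Om P) q \<Longrightarrow>
      bdd_continuous_on (XX P \<times> AA P) (\<lambda>(x, a). \<integral>\<omega>. q (x, \<omega>) \<partial>(mu P a))"
    and int_K: "interior (KK P) \<noteq> {}" and int_A: "interior (AA P) \<noteq> {}"
    and int_XO: "interior (XX P \<times> Om P) \<noteq> {}"
    and int_compl: "interior ((XX P \<times> Om P) - KK P) \<noteq> {}"
begin

lemma int_X: "interior (XX P) \<noteq> {}"
  using int_XO by (auto simp: interior_Times)

lemma int_XA: "interior (XX P \<times> AA P) \<noteq> {}"
  using int_X int_A by (simp add: interior_Times)

lemma closed_Om: "closed (Om P)"
proof -
  have "Om P = (\<Inter>l\<in>{1..ns P}. {\<omega>. 0 \<le> ev1 (ss P l) \<omega>})" by (auto simp: Om_def)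
  then show ?thesis by (auto intro!: closed_INT closed_Collect_le continuous_intros)
qed

lemma prob_space_lam: "prob_space (lam P)"
  unfolding lam_unif by (rule prob_space_unif[OF compact_X int_X])

lemma space_lam [simp]: "space (lam P) = XX P"
  by (simp add: lam_unif compact_X int_X)

lemma sets_lam: "sets (lam P) = sets (borel_on (XX P))"
  unfolding lam_unif by (rule sets_unif[OF compact_X int_X])

lemma integrable_lam_ev1: "integrable (lam P) (\<lambda>x. ev1 w x)"
proof (rule integrable_continuous_bounded)
  show "finite_measure (lam P)" using prob_space_lam by (rule prob_space.finite_measure)
qed (auto simp: compact_X lam_unif int_X intro!: unif_id_measurable continuous_intros)

lemma space_mu: "a \<in> AA P \<Longrightarrow> space (mu P a) = Om P"
  using mu_prob[of a] sets_eq_imp_space_eq[of "mu P a" "borel_on (Om P)"]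
  by (auto simp: prob_meas_def borel_on_def space_restrict_space)

lemma sets_mu: "a \<in> AA P \<Longrightarrow> sets (mu P a) = sets (borel_on (Om P))"
  using mu_prob[of a] by (auto simp: prob_meas_def)

lemma prob_space_mu: "a \<in> AA P \<Longrightarrow> prob_space (mu P a)"
  using mu_prob[of a] by (auto simp: prob_meas_def)

lemma ff_nz: "ff P \<noteq> 0"
proof
  assume "ff P = 0"
  then have "KK P = XX P \<times> Om P" by (auto simp: KK_def pol_eval_simps)
  then show False using int_compl by simp
qed

text \<open>Both sides agree on \<open>A\<close>, because each \<open>\<mu>\<^sub>a\<close> is a probability measure, and \<open>A\<close> has interior points.\<close>

lemma pp_0: "pp P 0 = 1"
proof (rule ccontr)
  assume "\<not> ?thesis"
  then have "pp P 0 - 1 \<noteq> 0" by simp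
  then obtain a where a: "a \<in> interior (AA P)" "ev1 (pp P 0 - 1) a \<noteq> 0"
    using ev1_nonzero_open[OF _ open_interior int_A] by blast
  then have aA: "a \<in> AA P" using interior_subset by blast
  have "(\<integral>\<omega>. 1 \<partial>mu P a) = ev1 (pp P 0) a"
    using has_bochner_integral_integral_eq[OF mu_moment[OF aA, of 0]] by simp
  then have "ev1 (pp P 0) a = 1" using prob_space.prob_space[OF prob_space_mu[OF aA]] by simp
  then show False using a by (simp add: pol_eval_simps)
qed

section \<open>Integration of polynomials against the family\<close>

lemma ev2_split: "ev2 q (x, \<omega>) = (\<Sum>\<gamma>\<in>Poly_Mapping.keys q. Poly_Mapping.lookup q \<gamma> *
    (mon_eval (($) x) (mon_left \<gamma>) * mon_eval (($) \<omega>) (mon_right \<gamma>)))"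
  unfolding pol_eval_def
proof (intro sum.cong refl arg_cong2[where f = "(*)"])
  fix \<gamma>
  show "mon_eval (case_sum (($) (fst (x, \<omega>))) (($) (snd (x, \<omega>)))) \<gamma>
      = mon_eval (($) x) (mon_left \<gamma>) * mon_eval (($) \<omega>) (mon_right \<gamma>)"
    using mon_eval_join[of "($) x" "($) \<omega>" "mon_left \<gamma>" "mon_right \<gamma>"] by simp
qed

lemma ev2_xp: "ev2 (xp P \<alpha> \<beta>) (x, a) = mon_eval (($) x) \<alpha> * ev1 (pp P \<beta>) a"
proof -
  have "case_sum (($) x) (($) a) \<circ> Inl = ($) x" by auto
  then show ?thesis by (simp add: xp_def pol_eval_mult pol_eval_simps mon_eval_rename)
qed

lemma has_integral_mu_ev2:
  assumes "a \<in> AA P"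
  shows "has_bochner_integral (mu P a) (\<lambda>\<omega>. ev2 q (x, \<omega>))
    (\<Sum>\<gamma>\<in>Poly_Mapping.keys q. Poly_Mapping.lookup q \<gamma> * ev2 (xp P (mon_left \<gamma>) (mon_right \<gamma>)) (x, a))"
  unfolding ev2_split[of x _ q] ev2_xp
  by (intro has_bochner_integral_sum has_bochner_integral_mult_right mu_moment assms)

text \<open>The sequence indexed by the exponents of \<open>\<real>[x,\<omega>]\<close> with entries \<open>L\<^sub>v(x\<^sup>\<alpha> p\<^sub>\<beta>(a))\<close>. If \<open>v\<close> consists of
  the moments of a measure \<open>\<psi>\<close> on \<open>X \<times> A\<close>, these are the moments of \<open>T\<^sup>*\<psi>\<close>.\<close>

definition pull :: "(('n + 't) mon \<Rightarrow> real) \<Rightarrow> ('n + 'p) mon \<Rightarrow> real" where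
  "pull v \<gamma> = riesz v (xp P (mon_left \<gamma>) (mon_right \<gamma>))"

text \<open>The product of \<open>\<lambda>\<close> and the uniform distribution on \<open>A\<close>.\<close>

definition pi_XA :: "((real ^ 'n) \<times> (real ^ 't)) measure" where
  "pi_XA = lam P \<Otimes>\<^sub>M unif (AA P)"

lemma pi_XA:
  shows "prob_space pi_XA" "finite_measure pi_XA" "(\<lambda>z. z) \<in> measurable pi_XA borel"
    "compact (space pi_XA)" "space pi_XA = XX P \<times> AA P"
proof -
  interpret L: prob_space "lam P" by (rule prob_space_lam)
  interpret N: prob_space "unif (AA P)" by (rule prob_space_unif[OF compact_A int_A])
  interpret pair_prob_space "lam P" "unif (AA P)" ..
  show "prob_space pi_XA" "finite_measure pi_XA"
    unfolding pi_XA_def by (rule prob_space_axioms, rule finite_measure_axioms)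
  show sp: "space pi_XA = XX P \<times> AA P"
    by (simp add: pi_XA_def space_pair_measure compact_A int_A)
  then show "compact (space pi_XA)" by (simp add: compact_Times compact_X compact_A)
  have "(\<lambda>z. (fst z, snd z)) \<in> measurable pi_XA (borel \<Otimes>\<^sub>M borel)"
    unfolding pi_XA_def lam_unif
    by (intro measurable_Pair measurable_compose[OF measurable_fst] measurable_compose[OF measurable_snd]
      unif_id_measurable compact_A compact_X int_A int_X)
  then show "(\<lambda>z. z) \<in> measurable pi_XA borel" by (simp add: borel_prod)
qed

lemma pi_XA_open_pos:
  assumes "open U" "open V" "U \<noteq> {}" "V \<noteq> {}" "U \<times> V \<subseteq> space pi_XA"
  shows "U \<times> V \<in> sets pi_XA \<and> emeasure pi_XA (U \<times> V) > 0"
proof -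
  interpret N: prob_space "unif (AA P)" by (rule prob_space_unif[OF compact_A int_A])
  have UV: "U \<subseteq> XX P" "V \<subseteq> AA P" using assms by (auto simp: pi_XA(5) times_subset_iff)
  have "U \<in> sets (lam P)" "emeasure (lam P) U > 0" "V \<in> sets (unif (AA P))" "emeasure (unif (AA P)) V > 0"
    using emeasure_unif_open_pos[OF compact_X int_X assms(1,3) UV(1)]
      emeasure_unif_open_pos[OF compact_A int_A assms(2,4) UV(2)] by (auto simp: lam_unif)
  then show ?thesis
    unfolding pi_XA_def
    by (auto simp: N.emeasure_pair_measure_Times ennreal_zero_less_mult_iff)
qed

text \<open>A polynomial in \<open>\<omega>\<close> that is nonnegative on \<open>\<Omega>\<close> and not the zero polynomial has a positive
  integral, because \<open>\<mu>\<^sub>a\<close> does not charge its zero set.\<close>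

lemma integral_mu_pos:
  fixes x :: "real ^ 'n"
  assumes a: "a \<in> AA P" and nonneg: "\<And>\<omega>. \<omega> \<in> Om P \<Longrightarrow> ev2 q (x, \<omega>) \<ge> 0"
    and nz: "ev2 q (x, \<omega>') \<noteq> 0"
  shows "(\<integral>\<omega>. ev2 q (x, \<omega>) \<partial>mu P a) > 0"
proof -
  define r where "r = (\<Sum>\<gamma>\<in>Poly_Mapping.keys q. Poly_Mapping.single (mon_right \<gamma>)
      (Poly_Mapping.lookup q \<gamma> * mon_eval (($) x) (mon_left \<gamma>)))"
  have r: "ev1 r \<omega> = ev2 q (x, \<omega>)" for \<omega>
    unfolding ev2_split[of x \<omega> q] by (simp add: r_def pol_eval_simps(6,7) mult.assoc)
  then have "r \<noteq> 0" using nz by (auto simp: pol_eval_simps)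
  from mu_null[OF a this] have null: "measure (mu P a) {\<omega> \<in> Om P. ev2 q (x, \<omega>) = 0} = 0"
    by (simp add: r)
  interpret prob_space "mu P a" by (rule prob_space_mu[OF a])
  have int: "integrable (mu P a) (\<lambda>\<omega>. ev2 q (x, \<omega>))"
    using has_integral_mu_ev2[OF a, of x q] unfolding has_bochner_integral_iff by blast
  then have meas: "(\<lambda>\<omega>. ev2 q (x, \<omega>)) \<in> borel_measurable (mu P a)" by auto
  define B where "B = {\<omega> \<in> space (mu P a). ev2 q (x, \<omega>) > 0}"
  have B: "B \<in> sets (mu P a)" unfolding B_def using meas by measurable
  have "prob B = 1 - prob {\<omega> \<in> space (mu P a). \<not> ev2 q (x, \<omega>) > 0}"
    unfolding B_def using meas by (subst prob_neg) auto
  also have "{\<omega> \<in> space (mu P a). \<not> ev2 q (x, \<omega>) > 0} = {\<omega> \<in> Om P. ev2 q (x, \<omega>) = 0}"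
    using nonneg by (auto simp: space_mu[OF a] not_less intro: antisym)
  finally have "prob B = 1" unfolding null by simp
  then have "emeasure (mu P a) B > 0" by (simp add: emeasure_eq_measure)
  then show ?thesis
    using int B nonneg by (intro integral_pos_of_pos_on[of _ _ B]) (auto simp: space_mu[OF a] B_def)
qed

text \<open>Strict positivity of the moments of \<open>T\<^sup>*\<pi>\<close>: integrating \<open>q\<close> against \<open>\<mu>\<^sub>a\<close> gives a polynomial \<open>F\<close> in
  \<open>(x, a)\<close> that is nonnegative on \<open>X \<times> A\<close> and positive at some interior point.\<close>

lemma riesz_pull_pos:
  assumes nonneg: "\<And>z. z \<in> XX P \<times> Om P \<Longrightarrow> ev2 q z \<ge> 0" and nz: "q \<noteq> 0"
  shows "riesz (pull (moment2 pi_XA)) q > 0"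
proof -
  have "open (interior (XX P) \<times> (UNIV :: (real ^ 'p) set))" "interior (XX P) \<times> (UNIV :: (real ^ 'p) set) \<noteq> {}"
    using int_X by (auto intro: open_Times)
  from ev2_nonzero_open[OF nz this] obtain z where "z \<in> interior (XX P) \<times> UNIV" "ev2 q z \<noteq> 0" .
  then obtain x0 \<omega>0 where x0: "x0 \<in> interior (XX P)" "ev2 q (x0, \<omega>0) \<noteq> 0" by (cases z) auto
  obtain a0 where a0: "a0 \<in> interior (AA P)" using int_A by auto
  have in0: "x0 \<in> XX P" "a0 \<in> AA P" using x0 a0 interior_subset by auto
  define F where "F = (\<Sum>\<gamma>\<in>Poly_Mapping.keys q. const_pol (Poly_Mapping.lookup q \<gamma>) * xp P (mon_left \<gamma>) (mon_right \<gamma>))"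
  have F: "ev2 F (x, a) = (\<integral>\<omega>. ev2 q (x, \<omega>) \<partial>mu P a)" if "a \<in> AA P" for x a
    using has_bochner_integral_integral_eq[OF has_integral_mu_ev2[OF that, of x q]]
    by (simp add: F_def pol_eval_simps pol_eval_mult)
  have "riesz (moment2 pi_XA) F > 0"
  proof (rule riesz_moment2_pos[OF pi_XA(2-4)])
    show "ev2 F z \<ge> 0" if zs: "z \<in> space pi_XA" for z
    proof -
      obtain x a where z: "z = (x, a)" "x \<in> XX P" "a \<in> AA P" using zs by (auto simp: pi_XA(5))
      have "(\<integral>\<omega>. ev2 q (x, \<omega>) \<partial>mu P a) \<ge> 0"
        using nonneg z by (intro integral_nonneg_AE AE_I2) (auto simp: space_mu)
      then show ?thesis using z F[OF z(3)] by simp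
    qed
    show "ev2 F (x0, a0) > 0"
      using integral_mu_pos[OF in0(2), where q = q and x = x0 and \<omega>' = \<omega>0] nonneg in0 x0 F[OF in0(2)] by auto
    show "(x0, a0) \<in> interior (space pi_XA)"
      using x0 a0 by (simp add: pi_XA(5) interior_Times)
  qed (use pi_XA_open_pos in blast)
  also have "riesz (moment2 pi_XA) F = riesz (pull (moment2 pi_XA)) q"
    by (simp add: F_def riesz_sum riesz_const_mult) (simp add: riesz_def[of "pull _"] pull_def)
  finally show ?thesis .
qed

section \<open>Slater's condition\<close>

lemma gw_nz: "j \<in> {0..ng P + 1} \<Longrightarrow> gw P j \<noteq> 0"
  using gg_nz[of j] ff_nz by (auto simp: gw_def pol_rename_Inl_nonzero)

lemma ga_nz: "j \<in> {0..ng P} \<Longrightarrow> ga P j \<noteq> 0"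
  using gg_nz[of j] by (auto simp: ga_def pol_rename_Inl_nonzero)

lemma sw_nz: "l \<in> {1..ns P} \<Longrightarrow> sw P l \<noteq> 0"
  using ss_nz[of l] by (auto simp: sw_def pol_rename_Inr_nonzero)

lemma qa_nz: "l \<in> {1..nq P} \<Longrightarrow> qa P l \<noteq> 0"
  using qq_nz[of l] by (auto simp: qa_def pol_rename_Inr_nonzero)

lemma gw_nonneg: "\<lbrakk>j \<in> {0..ng P}; z \<in> XX P \<times> Om P\<rbrakk> \<Longrightarrow> ev2 (gw P j) z \<ge> 0"
  by (cases z) (auto simp: gw_def XX_def pol_eval_simps)

lemma gw_nonneg_K: "\<lbrakk>j \<in> {0..ng P + 1}; z \<in> KK P\<rbrakk> \<Longrightarrow> ev2 (gw P j) z \<ge> 0"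
  by (cases z) (auto simp: gw_def KK_def XX_def pol_eval_simps)

lemma ga_nonneg: "\<lbrakk>j \<in> {0..ng P}; z \<in> XX P \<times> AA P\<rbrakk> \<Longrightarrow> ev2 (ga P j) z \<ge> 0"
  by (cases z) (auto simp: ga_def XX_def pol_eval_simps)

lemma sw_nonneg: "\<lbrakk>l \<in> {1..ns P}; z \<in> XX P \<times> Om P\<rbrakk> \<Longrightarrow> ev2 (sw P l) z \<ge> 0"
  by (cases z) (auto simp: sw_def Om_def)

lemma qa_nonneg: "\<lbrakk>l \<in> {1..nq P}; z \<in> XX P \<times> AA P\<rbrakk> \<Longrightarrow> ev2 (qa P l) z \<ge> 0"
  by (cases z) (auto simp: qa_def AA_def)

lemma mult_square_nz:
  fixes g p :: "('v::finite + 'w::finite) mpol"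
  assumes "g \<noteq> 0" "p \<noteq> 0"
  shows "g * (p * p) \<noteq> 0"
proof
  assume "g * (p * p) = 0"
  moreover obtain z where "ev2 g z \<noteq> 0" "ev2 p z \<noteq> 0"
    using ev2_nonzero_open_mult[OF assms open_UNIV] by auto
  moreover have "ev2 (g * (p * p)) z = ev2 g z * (ev2 p z * ev2 p z)" by (simp only: pol_eval_mult)
  ultimately show False by (simp add: pol_eval_simps)
qed

lemma pd_pull:
  assumes "g \<noteq> 0" "\<And>z. z \<in> XX P \<times> Om P \<Longrightarrow> ev2 g z \<ge> 0"
  shows "pd_on (mons k) (loc_mat g (pull (moment2 pi_XA)))"
proof (rule pd_loc_mat)
  fix p :: "('n + 'p) mpol" assume p: "p \<noteq> 0"
  show "riesz (pull (moment2 pi_XA)) (g * (p * p)) > 0"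
    using assms(2) by (intro riesz_pull_pos mult_square_nz assms(1) p) (simp add: pol_eval_mult)
qed simp

lemma pd_pi_XA:
  assumes "g \<noteq> 0" "\<And>z. z \<in> XX P \<times> AA P \<Longrightarrow> ev2 g z \<ge> 0"
  shows "pd_on (mons k) (loc_mat g (moment2 pi_XA))"
proof (rule pd_loc_mat)
  fix p :: "('n + 't) mpol" assume p: "p \<noteq> 0"
  obtain z0 where z0: "z0 \<in> interior (XX P \<times> AA P)" "ev2 g z0 \<noteq> 0" "ev2 p z0 \<noteq> 0"
    using ev2_nonzero_open_mult[OF assms(1) p open_interior int_XA] .
  have "z0 \<in> XX P \<times> AA P" using z0(1) interior_subset by blast
  then have "ev2 g z0 > 0" using assms(2)[of z0] z0(2) by simp
  then have pos: "ev2 (g * (p * p)) z0 > 0" using z0(3) by (auto simp: pol_eval_mult zero_less_mult_iff linorder_neq_iff)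
  show "riesz (moment2 pi_XA) (g * (p * p)) > 0"
  proof (rule riesz_moment2_pos[OF pi_XA(2-4)])
    show "ev2 (g * (p * p)) z \<ge> 0" if "z \<in> space pi_XA" for z
      using assms(2)[of z] that unfolding pol_eval_mult by (simp add: pi_XA(5))
    show "z0 \<in> interior (space pi_XA)" using z0(1) by (simp add: pi_XA(5))
  qed (use pos pi_XA_open_pos in auto)
qed simp

text \<open>The moments of the uniform measure on a ball contained in \<open>K\<close>.\<close>

lemma exists_pd_on_K:
  "\<exists>y0. \<forall>g. g \<noteq> 0 \<longrightarrow> (\<forall>z\<in>KK P. ev2 g z \<ge> 0) \<longrightarrow> (\<forall>k. pd_on (mons k) (loc_mat g y0))"
proof -
  obtain z1 where "z1 \<in> interior (KK P)" using int_K by auto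
  then obtain r where r: "r > 0" "cball z1 r \<subseteq> KK P"
    by (meson open_contains_cball open_interior interior_subset subset_trans)
  define B where "B = cball z1 r"
  have B: "compact B" "interior B \<noteq> {}" using r by (auto simp: B_def)
  have uB: "finite_measure (unif B)" "(\<lambda>z. z) \<in> measurable (unif B) borel" "compact (space (unif B))"
    using B by (auto simp: prob_space_unif prob_space.finite_measure intro: unif_id_measurable)
  show ?thesis
  proof (intro exI allI impI pd_loc_mat)
    fix g p :: "('n + 'p) mpol" assume g: "g \<noteq> 0" "\<forall>z\<in>KK P. ev2 g z \<ge> 0" and p: "p \<noteq> 0"
    obtain z0 where z0: "z0 \<in> interior B" "ev2 g z0 \<noteq> 0" "ev2 p z0 \<noteq> 0"
      using ev2_nonzero_open_mult[OF g(1) p open_interior B(2)] .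
    have "z0 \<in> KK P" using z0(1) interior_subset r by (auto simp: B_def)
    then have "ev2 g z0 > 0" using g(2) z0(2) by (metis order_le_less)
    then have pos: "ev2 (g * (p * p)) z0 > 0" using z0(3) by (auto simp: pol_eval_mult zero_less_mult_iff linorder_neq_iff)
    show "riesz (moment2 (unif B)) (g * (p * p)) > 0"
    proof (rule riesz_moment2_pos[OF uB])
      show "ev2 (g * (p * p)) z \<ge> 0" if "z \<in> space (unif B)" for z
        using g(2) that r unfolding pol_eval_mult by (auto simp: B B_def[symmetric])
      show "z0 \<in> interior (space (unif B))" using z0(1) B by simp
      show "U \<times> V \<in> sets (unif B) \<and> emeasure (unif B) (U \<times> V) > 0"
        if "open U" "open V" "U \<noteq> {}" "V \<noteq> {}" "U \<times> V \<subseteq> space (unif B)"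
        for U :: "(real ^ 'n) set" and V :: "(real ^ 'p) set"
        using emeasure_unif_open_pos[OF B, of "U \<times> V"] that B by (auto simp: open_Times)
    qed (rule pos)
  qed simp
qed

lemma slater: "slater P d"
proof -
  obtain y0 where y0: "\<And>g k. \<lbrakk>g \<noteq> 0; \<And>z. z \<in> KK P \<Longrightarrow> ev2 g z \<ge> 0\<rbrakk> \<Longrightarrow> pd_on (mons k) (loc_mat g y0)"
    using exists_pd_on_K by blast
  define v where "v = moment2 pi_XA"
  define G where "G = gw P ` {0..ng P} \<union> sw P ` {1..ns P}"
  define ks where "ks = {..d}"
  \<comment> \<open>The coefficients 1 and, below, 0 bring the sequences into the form of \<open>riesz_combine\<close>.\<close>
  define u where "u e \<gamma> = 1 * pull v \<gamma> + (- e) * y0 \<gamma>" for e \<gamma>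
  have G: "finite G" "\<And>g. g \<in> G \<Longrightarrow> g \<noteq> 0" "\<And>g z. \<lbrakk>g \<in> G; z \<in> XX P \<times> Om P\<rbrakk> \<Longrightarrow> ev2 g z \<ge> 0"
    using gw_nz sw_nz gw_nonneg sw_nonneg by (auto simp: G_def)
  have u: "loc_mat g (u e) \<alpha> \<beta> = loc_mat g (pull v) \<alpha> \<beta> - e * loc_mat g y0 \<alpha> \<beta>" for g e \<alpha> \<beta>
    unfolding loc_mat_def u_def riesz_combine by simp
  have "\<forall>\<^sub>F e in at_right 0. pd_on (mons k) (loc_mat g (u e))" if "g \<in> G" for g k
  proof -
    have "pd_on (mons k) (loc_mat g (pull v))" unfolding v_def using G that by (intro pd_pull) auto
    from pd_perturb[OF finite_mons this, of "loc_mat g y0"] show ?thesis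
      by eventually_elim (auto simp: pd_on_def qform_def u[symmetric] intro: loc_mat_sym)
  qed
  then have "\<forall>\<^sub>F e in at_right 0. \<forall>g\<in>G. \<forall>k\<in>ks. pd_on (mons k) (loc_mat g (u e))"
    using G(1) by (auto simp: eventually_ball_finite_distrib ks_def)
  from eventually_happens'[OF _ eventually_conj[OF this eventually_at_right_less[of 0]]]
  obtain e where e: "e > 0" "\<And>g k. \<lbrakk>g \<in> G; k \<le> d\<rbrakk> \<Longrightarrow> pd_on (mons k) (loc_mat g (u e))"
    by (auto simp: ks_def)
  define y where "y \<gamma> = e * y0 \<gamma> + 0 * y0 \<gamma>" for \<gamma>
  have y: "pd_on (mons k) (loc_mat g y)" if "g \<noteq> 0" "\<And>z. z \<in> KK P \<Longrightarrow> ev2 g z \<ge> 0" for g k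
  proof -
    have *: "loc_mat g y \<alpha> \<beta> = e * loc_mat g y0 \<alpha> \<beta>" for \<alpha> \<beta>
      unfolding loc_mat_def y_def riesz_combine by simp
    have "(\<Sum>i\<in>mons k. \<Sum>j\<in>mons k. c i * loc_mat g y i j * c j)
       = e * (\<Sum>i\<in>mons k. \<Sum>j\<in>mons k. c i * loc_mat g y0 i j * c j)" for c
      unfolding * sum_distrib_left by (simp add: ac_simps)
    then show ?thesis using y0[OF that, of k] e(1) by (simp add: pd_on_def *)
  qed
  have KX: "z \<in> XX P \<times> Om P" if "z \<in> KK P" for z using that by (auto simp: KK_def)
  have g0: "gw P 0 = 1" "ga P 0 = 1" by (simp_all add: gw_def ga_def)
  have v: "pd_on (mons k) (loc_mat g v)" if "g \<noteq> 0" "\<And>z. z \<in> XX P \<times> AA P \<Longrightarrow> ev2 g z \<ge> 0" for g k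
    unfolding v_def using that by (rule pd_pi_XA)
  have "sdp_constraints pd_on pd_on P d y (u e) v"
    unfolding sdp_constraints_def mom_mat_loc_mat
  proof (intro conjI ballI)
    show "case x of (\<alpha>, \<beta>) \<Rightarrow> riesz (\<lambda>\<gamma>. y \<gamma> + u e \<gamma>) (mono_pol (mon_join \<alpha> \<beta>)) - riesz v (xp P \<alpha> \<beta>) = 0"
      if "x \<in> idx P d" for x
      by (cases x) (simp add: y_def u_def pull_def)
    show "riesz v (mono_pol (mon_rename Inl \<alpha>)) = (\<integral>x. mon_eval (($) x) \<alpha> \<partial>lam P)" if "\<alpha> \<in> mons (2 * d)" for \<alpha>
    proof -
      interpret L: prob_space "lam P" by (rule prob_space_lam)
      interpret N: prob_space "unif (AA P)" by (rule prob_space_unif[OF compact_A int_A])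
      interpret pair_prob_space "lam P" "unif (AA P)" ..
      let ?f = "\<lambda>z :: (real ^ 'n) \<times> (real ^ 't). mon_eval (($) (fst z)) \<alpha>"
      have ev: "ev2 (mono_pol (mon_rename Inl \<alpha>)) z = ?f z" for z :: "(real ^ 'n) \<times> (real ^ 't)"
      proof -
        have "case_sum (($) (fst z)) (($) (snd z)) \<circ> Inl = ($) (fst z)" by auto
        then show ?thesis by (simp add: pol_eval_simps mon_eval_rename)
      qed
      have "integrable (lam P \<Otimes>\<^sub>M unif (AA P)) ?f"
        unfolding pi_XA_def[symmetric]
        using pi_XA by (intro integrable_continuous_bounded continuous_intros) auto
      from integral_fst'[OF this]
      have "(\<integral>z. ?f z \<partial>pi_XA) = (\<integral>x. mon_eval (($) x) \<alpha> \<partial>lam P)"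
        by (simp add: pi_XA_def N.prob_space)
      then show ?thesis unfolding v_def riesz_moment2[OF pi_XA(2-4)] ev .
    qed
    show "pd_on (mons d) (loc_mat 1 y)" using y[of "gw P 0"] gw_nz[of 0] gw_nonneg_K[of 0] by (auto simp: g0)
    show "pd_on (mons d) (loc_mat 1 (u e))" 
    proof -
      have "gw P 0 \<in> G" by (auto simp: G_def)
      from e(2)[OF this order_refl] show ?thesis by (simp add: g0)
    qed
    show "pd_on (mons d) (loc_mat 1 v)" using v[of "ga P 0"] ga_nz[of 0] ga_nonneg[of 0] by (auto simp: g0)
    show "pd_on (mons (d - dg P (ng P + 1))) (loc_mat (gw P (ng P + 1)) y)"
      by (intro y gw_nz gw_nonneg_K) auto
    show "pd_on (mons (d - dg P j)) (loc_mat (gw P j) y)" if "j \<in> {1..ng P}" for j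
      using that by (intro y gw_nz gw_nonneg_K) auto
    show "pd_on (mons (d - dg P j)) (loc_mat (gw P j) (u e))" if "j \<in> {1..ng P}" for j
      using that by (intro e) (auto simp: G_def)
    show "pd_on (mons (d - dg P j)) (loc_mat (ga P j) v)" if "j \<in> {1..ng P}" for j
      using that by (intro v ga_nz ga_nonneg) auto
    show "pd_on (mons (d - half_deg (ss P l))) (loc_mat (sw P l) y)" if "l \<in> {1..ns P}" for l
      using that KX by (intro y sw_nz sw_nonneg) auto
    show "pd_on (mons (d - half_deg (ss P l))) (loc_mat (sw P l) (u e))" if "l \<in> {1..ns P}" for l
      using that by (intro e) (auto simp: G_def)
    show "pd_on (mons (d - half_deg (qq P l))) (loc_mat (qa P l) v)" if "l \<in> {1..nq P}" for l
      using that by (intro v qa_nz qa_nonneg) auto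
  qed
  then show ?thesis unfolding slater_def sdp_strictly_feasible_def by blast
qed

end

section \<open>Sums of squares and localizing matrices\<close>

text \<open>The sum of the squares of the polynomials with the given coefficient vectors.\<close>

definition squares :: "nat \<Rightarrow> ('v::finite mon \<Rightarrow> real) list \<Rightarrow> 'v mpol" where
  "squares k qs = (\<Sum>q\<leftarrow>qs. coeff_pol (mons k) q * coeff_pol (mons k) q)"

lemma squares_sos: "squares k qs \<in> sos k"
  unfolding sos_def squares_def
  by (auto intro!: exI[of _ "map (coeff_pol (mons k)) qs"] simp: pol_deg_coeff_pol o_def)

lemma sos_squares:
  assumes "\<sigma> \<in> sos k"
  obtains qs where "\<sigma> = squares k qs"
proof -
  obtain ps where ps: "\<sigma> = (\<Sum>q\<leftarrow>ps. q * q)" "\<forall>q\<in>set ps. pol_deg q \<le> k"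
    using assms by (auto simp: sos_def)
  have "\<sigma> = squares k (map Poly_Mapping.lookup ps)"
    unfolding ps(1) squares_def map_map
    by (intro arg_cong[where f = sum_list] map_cong)
       (use ps(2) in \<open>auto simp: coeff_pol_eq pol_deg_le_iff\<close>)
  then show ?thesis by (rule that)
qed

lemma riesz_squares:
  "riesz z (squares k qs * g) = (\<Sum>q\<leftarrow>qs. qform (mons k) (loc_mat g z) q)"
proof (induction qs)
  case Nil
  show ?case by (simp add: squares_def)
next
  case (Cons q qs)
  have "squares k (q # qs) * g = g * (coeff_pol (mons k) q * coeff_pol (mons k) q) + squares k qs * g"
    by (simp add: squares_def algebra_simps)
  then show ?case
    using Cons.IH by (simp add: riesz_add qform_def loc_mat_form)
qed

lemma riesz_sos_nonneg:
  assumes "\<sigma> \<in> sos k" "psd_on (mons k) (loc_mat g z)"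
  shows "riesz z (\<sigma> * g) \<ge> 0"
proof -
  obtain qs where "\<sigma> = squares k qs" using assms(1) by (rule sos_squares)
  moreover have "qform (mons k) (loc_mat g z) q \<ge> 0" for q
    using assms(2) by (simp add: psd_on_def qform_def)
  ultimately show ?thesis by (auto simp: riesz_squares intro!: sum_list_nonneg)
qed

context mixture_setting
begin

section \<open>Weak duality\<close>

text \<open>The polynomial \<open>\<Sum> h\<^sub>\<alpha>\<^sub>\<beta> x\<^sup>\<alpha> p\<^sub>\<beta>(a)\<close> of the third dual constraint; its value at \<open>(x, a)\<close> is the integral of
  \<open>h(x, \<cdot>)\<close> against \<open>\<mu>\<^sub>a\<close> when \<open>h\<close> is supported on the index set.\<close>

definition pull_pol :: "nat \<Rightarrow> ('n + 'p) mpol \<Rightarrow> ('n + 't) mpol" where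
  "pull_pol d h = (\<Sum>(\<alpha>, \<beta>)\<in>idx P d. const_pol (Poly_Mapping.lookup h (mon_join \<alpha> \<beta>)) * xp P \<alpha> \<beta>)"

lemma inj_mon_join: "inj_on (\<lambda>(\<alpha>, \<beta>). mon_join \<alpha> \<beta>) (S :: ('n mon \<times> 'p mon) set)"
  by (rule inj_on_inverseI[where g = "\<lambda>\<gamma>. (mon_left \<gamma>, mon_right \<gamma>)"]) auto

lemma riesz_idx:
  assumes "Poly_Mapping.keys h \<subseteq> (\<lambda>(\<alpha>, \<beta>). mon_join \<alpha> \<beta>) ` idx P d"
  shows "riesz z h = (\<Sum>(\<alpha>, \<beta>)\<in>idx P d. Poly_Mapping.lookup h (mon_join \<alpha> \<beta>) * z (mon_join \<alpha> \<beta>))"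
  unfolding riesz_superset[OF finite_imageI[OF finite_idx] assms]
  by (subst sum.reindex[OF inj_mon_join]) (auto intro!: sum.cong)

lemma riesz_pull_pol:
  "riesz v (pull_pol d h) = (\<Sum>(\<alpha>, \<beta>)\<in>idx P d. Poly_Mapping.lookup h (mon_join \<alpha> \<beta>) * riesz v (xp P \<alpha> \<beta>))"
  by (simp add: pull_pol_def riesz_sum riesz_const_mult split_def)

lemma integral_lam_ev1:
  assumes "pol_deg w \<le> 2 * d"
    and "\<And>\<alpha>. \<alpha> \<in> mons (2 * d) \<Longrightarrow> riesz v (mono_pol (mon_rename Inl \<alpha>)) = (\<integral>x. mon_eval (($) x) \<alpha> \<partial>lam P)"
  shows "riesz v (pol_rename Inl w) = (\<integral>x. ev1 w x \<partial>lam P)"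
proof -
  have int: "integrable (lam P) (\<lambda>x. mon_eval (($) x) \<alpha>)" for \<alpha>
    using integrable_lam_ev1[of "mono_pol \<alpha>"] by (simp add: pol_eval_simps)
  have "riesz v (pol_rename Inl w) = (\<Sum>\<alpha>\<in>Poly_Mapping.keys w. Poly_Mapping.lookup w \<alpha> * (\<integral>x. mon_eval (($) x) \<alpha> \<partial>lam P))"
    unfolding riesz_rename riesz_def[of _ w]
    using assms by (intro sum.cong refl) (auto simp: pol_deg_le_iff)
  also have "\<dots> = (\<integral>x. ev1 w x \<partial>lam P)"
    unfolding pol_eval_def using int by (subst Bochner_Integration.integral_sum) auto
  finally show ?thesis .
qed

lemma idx_0: "(0, 0) \<in> idx P d"
  by (simp add: idx_def pp_0 pol_deg_def mon_deg_def)

text \<open>The moment matrices are the localizing matrices of \<open>g\<^sub>0 = 1\<close>, so the index 0 is included here.\<close>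

lemma sdp_psd:
  assumes "sdp_feasible P d y u v"
  shows "\<And>j. j \<in> {0..ng P + 1} \<Longrightarrow> psd_on (mons (d - dg P j)) (loc_mat (gw P j) y)"
    "\<And>j. j \<in> {0..ng P} \<Longrightarrow> psd_on (mons (d - dg P j)) (loc_mat (gw P j) u)"
    "\<And>j. j \<in> {0..ng P} \<Longrightarrow> psd_on (mons (d - dg P j)) (loc_mat (ga P j) v)"
    "\<And>l. l \<in> {1..ns P} \<Longrightarrow> psd_on (mons (d - half_deg (ss P l))) (loc_mat (sw P l) y)"
    "\<And>l. l \<in> {1..ns P} \<Longrightarrow> psd_on (mons (d - half_deg (ss P l))) (loc_mat (sw P l) u)"
    "\<And>l. l \<in> {1..nq P} \<Longrightarrow> psd_on (mons (d - half_deg (qq P l))) (loc_mat (qa P l) v)"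
proof -
  note f = assms[unfolded sdp_feasible_def sdp_constraints_def mom_mat_loc_mat]
  have 0: "gw P 0 = 1" "ga P 0 = 1" "dg P 0 = 0" by (simp_all add: gw_def ga_def dg_def)
  have cases: "j = 0 \<or> j \<in> {1..ng P} \<or> j = ng P + 1" if "j \<in> {0..ng P + 1}" for j using that by auto
  show "psd_on (mons (d - dg P j)) (loc_mat (gw P j) y)" if "j \<in> {0..ng P + 1}" for j
    using cases[OF that] f by (elim disjE) (simp_all add: 0)
  show "psd_on (mons (d - dg P j)) (loc_mat (gw P j) u)" if "j \<in> {0..ng P}" for j
    using that f by (cases "j = 0") (simp_all add: 0)
  show "psd_on (mons (d - dg P j)) (loc_mat (ga P j) v)" if "j \<in> {0..ng P}" for j
    using that f by (cases "j = 0") (simp_all add: 0)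
qed (use assms in \<open>auto simp: sdp_feasible_def sdp_constraints_def\<close>)

lemma weak_duality:
  assumes "sdp_feasible P d y u v" "dual_feasible P d h w"
  shows "y 0 \<le> (\<integral>x. ev1 w x \<partial>lam P)"
proof -
  from assms(2) obtain \<sigma>1 \<sigma>2 \<sigma>3 \<tau>1 \<tau>2 \<tau>3 where D: "pol_deg w \<le> 2 * d"
    "Poly_Mapping.keys h \<subseteq> (\<lambda>(\<alpha>, \<beta>). mon_join \<alpha> \<beta>) ` idx P d"
    "\<forall>j\<in>{0..ng P + 1}. \<sigma>1 j \<in> sos (d - dg P j)"
    "\<forall>j\<in>{0..ng P}. \<sigma>2 j \<in> sos (d - dg P j) \<and> \<sigma>3 j \<in> sos (d - dg P j)"
    "\<forall>l\<in>{1..ns P}. \<tau>1 l \<in> sos (d - half_deg (ss P l)) \<and> \<tau>2 l \<in> sos (d - half_deg (ss P l))"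
    "\<forall>l\<in>{1..nq P}. \<tau>3 l \<in> sos (d - half_deg (qq P l))"
    "h - 1 = (\<Sum>j=0..ng P + 1. \<sigma>1 j * gw P j) + (\<Sum>l=1..ns P. \<tau>1 l * sw P l)"
    "h = (\<Sum>j=0..ng P. \<sigma>2 j * gw P j) + (\<Sum>l=1..ns P. \<tau>2 l * sw P l)"
    "pol_rename Inl w - pull_pol d h = (\<Sum>j=0..ng P. \<sigma>3 j * ga P j) + (\<Sum>l=1..nq P. \<tau>3 l * qa P l)"
    unfolding dual_feasible_def pull_pol_def by (elim conjE exE) blast
  note psd = sdp_psd[OF assms(1)]
  have eq1: "\<forall>(\<alpha>, \<beta>)\<in>idx P d. riesz (\<lambda>\<gamma>. y \<gamma> + u \<gamma>) (mono_pol (mon_join \<alpha> \<beta>)) - riesz v (xp P \<alpha> \<beta>) = 0"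
    and eq2: "\<forall>\<alpha>\<in>mons (2 * d). riesz v (mono_pol (mon_rename Inl \<alpha>)) = (\<integral>x. mon_eval (($) x) \<alpha> \<partial>lam P)"
    using assms(1) unfolding sdp_feasible_def sdp_constraints_def by blast+
  have "riesz y (h - 1) \<ge> 0"
    unfolding D(7) riesz_add riesz_sum
    by (intro add_nonneg_nonneg sum_nonneg riesz_sos_nonneg[OF _ psd(1)] riesz_sos_nonneg[OF _ psd(4)])
       (use D(3,5) in auto)
  then have 1: "y 0 \<le> riesz y h" by (simp add: riesz_diff)
  have 2: "riesz u h \<ge> 0"
    by (subst D(8), unfold riesz_add riesz_sum,
        intro add_nonneg_nonneg sum_nonneg riesz_sos_nonneg[OF _ psd(2)] riesz_sos_nonneg[OF _ psd(5)])
       (use D(4,5) in auto)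
  have "riesz v (pol_rename Inl w - pull_pol d h) \<ge> 0"
    unfolding D(9) riesz_add riesz_sum
    by (intro add_nonneg_nonneg sum_nonneg riesz_sos_nonneg[OF _ psd(3)] riesz_sos_nonneg[OF _ psd(6)])
       (use D(4,6) in auto)
  then have 3: "riesz v (pull_pol d h) \<le> (\<integral>x. ev1 w x \<partial>lam P)"
    using integral_lam_ev1[OF D(1), of v] eq2 by (simp add: riesz_diff)
  have "riesz y h + riesz u h = riesz v (pull_pol d h)"
    unfolding riesz_idx[OF D(2)] riesz_pull_pol sum.distrib[symmetric]
  proof (intro sum.cong refl)
    fix p assume "p \<in> idx P d"
    then obtain \<alpha> \<beta> where p: "p = (\<alpha>, \<beta>)" "riesz v (xp P \<alpha> \<beta>) = y (mon_join \<alpha> \<beta>) + u (mon_join \<alpha> \<beta>)"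
      using eq1 by fastforce
    then show "(case p of (\<alpha>, \<beta>) \<Rightarrow> Poly_Mapping.lookup h (mon_join \<alpha> \<beta>) * y (mon_join \<alpha> \<beta>))
        + (case p of (\<alpha>, \<beta>) \<Rightarrow> Poly_Mapping.lookup h (mon_join \<alpha> \<beta>) * u (mon_join \<alpha> \<beta>))
      = (case p of (\<alpha>, \<beta>) \<Rightarrow> Poly_Mapping.lookup h (mon_join \<alpha> \<beta>) * riesz v (xp P \<alpha> \<beta>))"
      by (simp add: distrib_left)
  qed
  with 1 2 3 show ?thesis by linarith
qed

text \<open>The constraint with index \<open>(0, 0)\<close> reads \<open>y\<^sub>0 + u\<^sub>0 = 1\<close>, since \<open>p\<^sub>0 = 1\<close> and \<open>\<lambda>\<close> is a probability measure.\<close>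

lemma sdp_objective_le_1:
  assumes "sdp_feasible P d y u v"
  shows "y 0 \<le> 1"
proof -
  have "y 0 + u 0 - v 0 = 0"
    using assms idx_0[of d] unfolding sdp_feasible_def sdp_constraints_def xp_def
    by (force simp: pp_0 pol_rename_def)
  moreover have "v 0 = 1"
  proof -
    have "riesz v (mono_pol (mon_rename Inl 0)) = (\<integral>x. mon_eval (($) x) 0 \<partial>lam P)"
      using assms unfolding sdp_feasible_def sdp_constraints_def
      by (elim conjE) (erule bspec, simp add: mons_def mon_deg_def)
    also have "\<dots> = 1" using prob_space.prob_space[OF prob_space_lam] by simp
    finally show ?thesis by simp
  qed
  moreover have "u 0 \<ge> 0"
    using riesz_sos_nonneg[OF _ sdp_psd(2)[OF assms, of 0], of 1] 
    by (force simp: sos_def gw_def pol_deg_def mon_deg_def intro: exI[of _ "[1]"])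
  ultimately show ?thesis by simp
qed

end

section \<open>Strong duality\<close>

text \<open>Names for the matrix blocks of the program: those of \<open>y\<close>, \<open>u\<close> and \<open>v\<close> that localize by some \<open>g\<^sub>j\<close>
  (including \<open>g\<^sub>0 = 1\<close> and, for \<open>y\<close>, also \<open>g\<^sub>m\<^sub>+\<^sub>1 = - f\<close>), and those that localize by some \<open>s\<^sub>l\<close> or \<open>q\<^sub>l\<close>.\<close>

datatype block = Yg nat | Ys nat | Ug nat | Us nat | Vg nat | Vq nat

lemma sum_blocks:
  fixes F :: "block \<Rightarrow> real"
  assumes "finite A1" "finite A2" "finite A3" "finite A4" "finite A5" "finite A6"
  shows "sum F (Yg ` A1 \<union> Ys ` A2 \<union> (Ug ` A3 \<union> Us ` A4) \<union> (Vg ` A5 \<union> Vq ` A6))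
    = (\<Sum>k\<in>A1. F (Yg k)) + (\<Sum>k\<in>A2. F (Ys k)) + ((\<Sum>k\<in>A3. F (Ug k)) + (\<Sum>k\<in>A4. F (Us k)))
      + ((\<Sum>k\<in>A5. F (Vg k)) + (\<Sum>k\<in>A6. F (Vq k)))"
proof -
  have inj: "inj Yg" "inj Ys" "inj Ug" "inj Us" "inj Vg" "inj Vq" by (auto simp: inj_def)
  have r: "sum F (c ` A) = (\<Sum>k\<in>A. F (c k))" if "inj c" for c :: "nat \<Rightarrow> block" and A
    using sum.reindex[OF inj_on_subset[OF that subset_UNIV], of F A] by simp
  show ?thesis
    using assms
    by (subst sum.union_disjoint, auto)+ (simp add: r inj)
qed

lemma qform_Inl:
  "qform (Inl ` I) (\<lambda>i j. A (projl i) (projl j)) q = qform I A (\<lambda>i. q (Inl i))"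
  by (simp add: qform_def sum.reindex)

lemma qform_Inr:
  "qform (Inr ` I) (\<lambda>i j. A (projr i) (projr j)) q = qform I A (\<lambda>i. q (Inr i))"
  by (simp add: qform_def sum.reindex)

lemma pd_on_qform: "pd_on I A \<longleftrightarrow> (\<forall>i\<in>I. \<forall>j\<in>I. A i j = A j i) \<and>
     (\<forall>c. (\<exists>i\<in>I. c i \<noteq> 0) \<longrightarrow> 0 < qform I A c)"
  by (simp add: pd_on_def qform_def)

lemma psd_on_qform: "psd_on I A \<longleftrightarrow> (\<forall>i\<in>I. \<forall>j\<in>I. A i j = A j i) \<and> (\<forall>c. 0 \<le> qform I A c)"
  by (simp add: psd_on_def qform_def)

lemma psd_of_pd:
  assumes "pd_on I A"
  shows "psd_on I A"
proof -
  have "qform I A c \<ge> 0" for c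
  proof (cases "\<exists>i\<in>I. c i \<noteq> 0")
    case True
    then show ?thesis using assms by (auto simp: pd_on_qform less_imp_le)
  next
    case False
    then show ?thesis by (simp add: qform_def)
  qed
  then show ?thesis using assms by (simp add: psd_on_qform pd_on_qform)
qed

lemma pd_on_Inl: "pd_on I A \<Longrightarrow> pd_on (Inl ` I) (\<lambda>i j. A (projl i) (projl j))"
  by (auto simp: pd_on_qform qform_Inl)

lemma pd_on_Inr: "pd_on I A \<Longrightarrow> pd_on (Inr ` I) (\<lambda>i j. A (projr i) (projr j))"
  by (auto simp: pd_on_qform qform_Inr)

lemma psd_on_Inl: "psd_on (Inl ` I) (\<lambda>i j. A (projl i) (projl j)) \<Longrightarrow> psd_on I A"
  unfolding psd_on_qform qform_Inl by (auto dest: spec[where x = "\<lambda>i. _ (projl i)"])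

lemma psd_on_Inr: "psd_on (Inr ` I) (\<lambda>i j. A (projr i) (projr j)) \<Longrightarrow> psd_on I A"
  unfolding psd_on_qform qform_Inr by (auto dest: spec[where x = "\<lambda>i. _ (projr i)"])

context mixture_setting
begin

text \<open>For every upper bound of the primal program there is a dual feasible pair whose value does not
  exceed it. Matrix indices are exponents of
  \<open>\<real>[x,\<omega>]\<close> for the blocks of \<open>y\<close> and \<open>u\<close> and exponents of \<open>\<real>[x,a]\<close> for those of \<open>v\<close>, so the general duality
  theorem is applied with a sum type of indices. Comparing coefficients of \<open>y\<close>, \<open>u\<close> and \<open>v\<close> in its
  certificate gives the three polynomial identities of the dual program.\<close>

lemma dual_attained:
  assumes bound: "\<And>y u v. sdp_feasible P d y u v \<Longrightarrow> y 0 \<le> \<rho>"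
  shows "\<exists>h w. dual_feasible P d h w \<and> (\<integral>x. ev1 w x \<partial>lam P) \<le> \<rho>"
proof -
  define comb :: "real \<Rightarrow> (('n + 'p) mon \<Rightarrow> real) \<times> (('n + 'p) mon \<Rightarrow> real) \<times> (('n + 't) mon \<Rightarrow> real)
      \<Rightarrow> real \<Rightarrow> (('n + 'p) mon \<Rightarrow> real) \<times> (('n + 'p) mon \<Rightarrow> real) \<times> (('n + 't) mon \<Rightarrow> real) \<Rightarrow> _"
    where "comb = (\<lambda>s (y, u, v) r (y', u', v').
    (\<lambda>\<gamma>. s * y \<gamma> + r * y' \<gamma> :: real, \<lambda>\<gamma>. s * u \<gamma> + r * u' \<gamma> :: real, \<lambda>\<gamma>. s * v \<gamma> + r * v' \<gamma> :: real))"
  define Bl where "Bl = Yg ` {0..ng P + 1} \<union> Ys ` {1..ns P} \<union> (Ug ` {0..ng P} \<union> Us ` {1..ns P})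
    \<union> (Vg ` {0..ng P} \<union> Vq ` {1..nq P})"
  define kk where "kk b = (case b of Yg j \<Rightarrow> d - dg P j | Ys l \<Rightarrow> d - half_deg (ss P l)
    | Ug j \<Rightarrow> d - dg P j | Us l \<Rightarrow> d - half_deg (ss P l)
    | Vg j \<Rightarrow> d - dg P j | Vq l \<Rightarrow> d - half_deg (qq P l))" for b
  define I :: "block \<Rightarrow> (('n + 'p) mon + ('n + 't) mon) set" where
    "I b = (case b of Vg _ \<Rightarrow> Inr ` mons (kk b) | Vq _ \<Rightarrow> Inr ` mons (kk b) | _ \<Rightarrow> Inl ` mons (kk b))" for b
  define entL where "entL = (\<lambda>g (z :: ('n + 'p) mon \<Rightarrow> real) (i :: ('n + 'p) mon + ('n + 't) mon)
    (j :: ('n + 'p) mon + ('n + 't) mon).     loc_mat g z (projl i) (projl j))"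
  define entR where "entR = (\<lambda>g (z :: ('n + 't) mon \<Rightarrow> real) (i :: ('n + 'p) mon + ('n + 't) mon)
    (j :: ('n + 'p) mon + ('n + 't) mon).     loc_mat g z (projr i) (projr j))"
  define Ent where "Ent b i j = (\<lambda>(y, u, v). case b of
      Yg k \<Rightarrow> entL (gw P k) y i j | Ys l \<Rightarrow> entL (sw P l) y i j
    | Ug k \<Rightarrow> entL (gw P k) u i j | Us l \<Rightarrow> entL (sw P l) u i j
    | Vg k \<Rightarrow> entR (ga P k) v i j | Vq l \<Rightarrow> entR (qa P l) v i j)" for b i j
  define L where "L e = (\<lambda>(y, u, v). case e of
      Inl (\<alpha>, \<beta>) \<Rightarrow> y (mon_join \<alpha> \<beta>) + u (mon_join \<alpha> \<beta>) - riesz v (xp P \<alpha> \<beta>)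
    | Inr \<alpha> \<Rightarrow> v (mon_rename Inl \<alpha>))" for e :: "('n mon \<times> 'p mon) + 'n mon"
  define rhs where "rhs e = (case e of Inl _ \<Rightarrow> 0 | Inr \<alpha> \<Rightarrow> (\<integral>x. mon_eval (($) x) \<alpha> \<partial>lam P))"
    for e :: "('n mon \<times> 'p mon) + 'n mon"
  define c :: "(('n + 'p) mon \<Rightarrow> real) \<times> (('n + 'p) mon \<Rightarrow> real) \<times> (('n + 't) mon \<Rightarrow> real) \<Rightarrow> real"
    where "c = (\<lambda>(y, u, v). y 0)"
  obtain y0 u0 v0 where s0: "sdp_strictly_feasible P d y0 u0 v0" using slater[of d] by (auto simp: slater_def)
  note f0 = s0[unfolded sdp_strictly_feasible_def sdp_constraints_def mom_mat_loc_mat]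
  have g0: "gw P 0 = 1" "ga P 0 = 1" "dg P 0 = 0" by (simp_all add: gw_def ga_def dg_def)
  have pd: "pd_on (mons (d - dg P j)) (loc_mat (gw P j) y0)" if "j \<in> {0..ng P + 1}" for j
  proof -
    have "j = 0 \<or> j \<in> {1..ng P} \<or> j = ng P + 1" using that by auto
    then show ?thesis using f0 by (elim disjE) (simp_all add: g0)
  qed
  have pd': "pd_on (mons (d - dg P j)) (loc_mat (gw P j) u0)"
    "pd_on (mons (d - dg P j)) (loc_mat (ga P j) v0)" if "j \<in> {0..ng P}" for j
    using that f0 by (cases "j = 0"; simp add: g0)+
  have loc_comb: "loc_mat g (\<lambda>\<gamma>. s * y \<gamma> + r * u \<gamma>) i j = s * loc_mat g y i j + r * loc_mat g u i j"
    for g y u i j and s r :: real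
    by (simp add: loc_mat_def riesz_combine)
  have "\<exists>\<nu> bs. (\<forall>z. (\<Sum>e\<in>idx P d <+> mons (2 * d). \<nu> e * L e z) - c z
        = (\<Sum>b\<in>Bl. \<Sum>q\<leftarrow>bs b. qform (I b) (\<lambda>i j. Ent b i j z) q))
      \<and> (\<Sum>e\<in>idx P d <+> mons (2 * d). \<nu> e * rhs e) \<le> \<rho>"
  proof (rule sdp_strong_duality[where comb = comb and ?z0.0 = "(y0, u0, v0)"])
    show "finite Bl" by (simp add: Bl_def)
    show "finite (I b)" for b by (simp add: I_def split: block.split)
    show "finite (idx P d <+> mons (2 * d))" by simp
    show "lin comb (Ent b i j)" for b i j
      by (cases b) (auto simp: lin_def comb_def Ent_def entL_def entR_def loc_comb)
    show "lin comb (L e)" for e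
      by (cases e) (auto simp: lin_def comb_def L_def riesz_combine algebra_simps)
    show "lin comb c" by (auto simp: lin_def comb_def c_def)
    show "Ent b i j z = Ent b j i z" for b i j z
      by (cases z; cases b) (auto simp: Ent_def entL_def entR_def intro: loc_mat_sym)
    show "pd_on (I b) (\<lambda>i j. Ent b i j (y0, u0, v0))" if "b \<in> Bl" for b
      using that pd pd' f0 unfolding Bl_def
      by (auto simp: I_def Ent_def entL_def entR_def kk_def intro!: pd_on_Inl pd_on_Inr)
    show "L e (y0, u0, v0) = rhs e" if "e \<in> idx P d <+> mons (2 * d)" for e
      using that f0 by (auto simp: L_def rhs_def split: prod.splits)
    show "c z \<le> \<rho>" if psd: "\<And>b. b \<in> Bl \<Longrightarrow> psd_on (I b) (\<lambda>i j. Ent b i j z)"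
      and eq: "\<And>e. e \<in> idx P d <+> mons (2 * d) \<Longrightarrow> L e z = rhs e" for z
    proof -
      obtain y u v where z: "z = (y, u, v)" by (cases z)
      have Y: "psd_on (mons (d - dg P j)) (loc_mat (gw P j) y)" if "j \<in> {0..ng P + 1}" for j
        using psd[of "Yg j"] that by (auto simp: Bl_def I_def Ent_def entL_def kk_def z intro: psd_on_Inl)
      have U: "psd_on (mons (d - dg P j)) (loc_mat (gw P j) u)" if "j \<in> {0..ng P}" for j
        using psd[of "Ug j"] that by (auto simp: Bl_def I_def Ent_def entL_def kk_def z intro: psd_on_Inl)
      have V: "psd_on (mons (d - dg P j)) (loc_mat (ga P j) v)" if "j \<in> {0..ng P}" for j
        using psd[of "Vg j"] that by (auto simp: Bl_def I_def Ent_def entR_def kk_def z intro: psd_on_Inr)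
      have Ys: "psd_on (mons (d - half_deg (ss P l))) (loc_mat (sw P l) y)" if "l \<in> {1..ns P}" for l
        using psd[of "Ys l"] that by (auto simp: Bl_def I_def Ent_def entL_def kk_def z intro: psd_on_Inl)
      have Us: "psd_on (mons (d - half_deg (ss P l))) (loc_mat (sw P l) u)" if "l \<in> {1..ns P}" for l
        using psd[of "Us l"] that by (auto simp: Bl_def I_def Ent_def entL_def kk_def z intro: psd_on_Inl)
      have Vq: "psd_on (mons (d - half_deg (qq P l))) (loc_mat (qa P l) v)" if "l \<in> {1..nq P}" for l
        using psd[of "Vq l"] that by (auto simp: Bl_def I_def Ent_def entR_def kk_def z intro: psd_on_Inr)
      have "sdp_feasible P d y u v"
        unfolding sdp_feasible_def sdp_constraints_def mom_mat_loc_mat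
      proof (intro conjI ballI)
        show "case x of (\<alpha>, \<beta>) \<Rightarrow> riesz (\<lambda>\<gamma>. y \<gamma> + u \<gamma>) (mono_pol (mon_join \<alpha> \<beta>)) - riesz v (xp P \<alpha> \<beta>) = 0"
          if "x \<in> idx P d" for x
          using eq[OF InlI[OF that]] by (cases x) (simp add: L_def rhs_def z)
        show "riesz v (mono_pol (mon_rename Inl \<alpha>)) = (\<integral>x. mon_eval (($) x) \<alpha> \<partial>lam P)"
          if "\<alpha> \<in> mons (2 * d)" for \<alpha>
          using eq[OF InrI[OF that]] by (simp add: L_def rhs_def z)
        show "psd_on (mons d) (loc_mat 1 y)" "psd_on (mons d) (loc_mat 1 u)" "psd_on (mons d) (loc_mat 1 v)"
          using Y[of 0] U[of 0] V[of 0] by (simp_all add: g0)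
      qed (use Y U V Ys Us Vq in auto)
      then show ?thesis using bound by (simp add: c_def z)
    qed
  qed
  then obtain \<nu> bs where id: "\<And>y u v. (\<Sum>e\<in>idx P d <+> mons (2 * d). \<nu> e * L e (y, u, v)) - c (y, u, v)
        = (\<Sum>b\<in>Bl. \<Sum>q\<leftarrow>bs b. qform (I b) (\<lambda>i j. Ent b i j (y, u, v)) q)"
      and val: "(\<Sum>e\<in>idx P d <+> mons (2 * d). \<nu> e * rhs e) \<le> \<rho>" by blast
  define h where "h = (\<Sum>(\<alpha>, \<beta>)\<in>idx P d. Poly_Mapping.single (mon_join \<alpha> \<beta>) (\<nu> (Inl (\<alpha>, \<beta>))))"
  define w where "w = coeff_pol (mons (2 * d)) (\<lambda>\<alpha>. \<nu> (Inr \<alpha>))"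
  define S1 where "S1 b = squares (kk b) (map (\<lambda>q \<alpha>. q (Inl \<alpha>)) (bs b))" for b
  define S2 where "S2 b = squares (kk b) (map (\<lambda>q \<alpha>. q (Inr \<alpha>)) (bs b))" for b
  have hl: "Poly_Mapping.lookup h (mon_join \<alpha> \<beta>) = \<nu> (Inl (\<alpha>, \<beta>))" if "(\<alpha>, \<beta>) \<in> idx P d" for \<alpha> \<beta>
  proof -
    have eq: "mon_join (fst p) (snd p) = mon_join \<alpha> \<beta> \<longleftrightarrow> p = (\<alpha>, \<beta>)" for p
      by (metis mon_left_join mon_right_join prod.collapse fst_conv snd_conv)
    have "Poly_Mapping.lookup h (mon_join \<alpha> \<beta>) = (\<Sum>p\<in>idx P d. if p = (\<alpha>, \<beta>) then \<nu> (Inl p) else 0)"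
      by (simp add: h_def lookup_sum lookup_single when_def split_def eq)
    then show ?thesis using that by simp
  qed
  have hk: "Poly_Mapping.keys h \<subseteq> (\<lambda>(\<alpha>, \<beta>). mon_join \<alpha> \<beta>) ` idx P d"
  proof
    fix \<gamma> assume "\<gamma> \<in> Poly_Mapping.keys h"
    then have "(\<Sum>p\<in>idx P d. Poly_Mapping.lookup (case p of (\<alpha>, \<beta>) \<Rightarrow> Poly_Mapping.single (mon_join \<alpha> \<beta>) (\<nu> (Inl (\<alpha>, \<beta>)))) \<gamma>) \<noteq> 0"
      by (simp add: h_def lookup_sum in_keys_iff)
    then obtain p where "p \<in> idx P d"
       "Poly_Mapping.lookup (case p of (\<alpha>, \<beta>) \<Rightarrow> Poly_Mapping.single (mon_join \<alpha> \<beta>) (\<nu> (Inl (\<alpha>, \<beta>)))) \<gamma> \<noteq> 0"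
      by (meson sum.neutral)
    then show "\<gamma> \<in> (\<lambda>(\<alpha>, \<beta>). mon_join \<alpha> \<beta>) ` idx P d"
      by (force simp: lookup_single when_def split: prod.splits if_splits)
  qed
  have rh: "riesz z h = (\<Sum>(\<alpha>, \<beta>)\<in>idx P d. \<nu> (Inl (\<alpha>, \<beta>)) * z (mon_join \<alpha> \<beta>))" for z
    unfolding riesz_idx[OF hk] using hl by (intro sum.cong) auto
  have rp: "riesz v (pull_pol d h) = (\<Sum>(\<alpha>, \<beta>)\<in>idx P d. \<nu> (Inl (\<alpha>, \<beta>)) * riesz v (xp P \<alpha> \<beta>))" for v
    unfolding riesz_pull_pol using hl by (intro sum.cong) auto
  have rw: "riesz v w = (\<Sum>\<alpha>\<in>mons (2 * d). \<nu> (Inr \<alpha>) * v \<alpha>)" for v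
    by (simp add: w_def coeff_pol_def riesz_sum)
  have lhs: "(\<Sum>e\<in>idx P d <+> mons (2 * d). \<nu> e * L e (y, u, v)) - c (y, u, v)
      = riesz y (h - 1) + riesz u h + riesz v (pol_rename Inl w - pull_pol d h)" for y u v
  proof -
    have "(\<Sum>e\<in>idx P d <+> mons (2 * d). \<nu> e * L e (y, u, v))
      = (\<Sum>(\<alpha>, \<beta>)\<in>idx P d. \<nu> (Inl (\<alpha>, \<beta>)) * (y (mon_join \<alpha> \<beta>) + u (mon_join \<alpha> \<beta>) - riesz v (xp P \<alpha> \<beta>)))
        + (\<Sum>\<alpha>\<in>mons (2 * d). \<nu> (Inr \<alpha>) * v (mon_rename Inl \<alpha>))"
      by (subst sum.Plus) (auto simp: L_def split_def)
    also have "\<dots> = riesz y h + riesz u h - riesz v (pull_pol d h) + riesz v (pol_rename Inl w)"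
      unfolding rh rp riesz_rename rw
      by (simp add: split_def sum.distrib[symmetric] sum_subtractf[symmetric] algebra_simps)
    finally show ?thesis by (simp add: riesz_diff c_def)
  qed
  have block_sums:
    "(\<Sum>q\<leftarrow>bs (Yg k). qform (I (Yg k)) (\<lambda>i j. Ent (Yg k) i j (y, u, v)) q) = riesz y (S1 (Yg k) * gw P k)"
    "(\<Sum>q\<leftarrow>bs (Ys k). qform (I (Ys k)) (\<lambda>i j. Ent (Ys k) i j (y, u, v)) q) = riesz y (S1 (Ys k) * sw P k)"
    "(\<Sum>q\<leftarrow>bs (Ug k). qform (I (Ug k)) (\<lambda>i j. Ent (Ug k) i j (y, u, v)) q) = riesz u (S1 (Ug k) * gw P k)"
    "(\<Sum>q\<leftarrow>bs (Us k). qform (I (Us k)) (\<lambda>i j. Ent (Us k) i j (y, u, v)) q) = riesz u (S1 (Us k) * sw P k)"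
    "(\<Sum>q\<leftarrow>bs (Vg k). qform (I (Vg k)) (\<lambda>i j. Ent (Vg k) i j (y, u, v)) q) = riesz v (S2 (Vg k) * ga P k)"
    "(\<Sum>q\<leftarrow>bs (Vq k). qform (I (Vq k)) (\<lambda>i j. Ent (Vq k) i j (y, u, v)) q) = riesz v (S2 (Vq k) * qa P k)"
    for k y u v
    unfolding S1_def S2_def riesz_squares map_map
    by (intro arg_cong[where f = sum_list] map_cong refl;
        simp add: I_def Ent_def entL_def entR_def qform_Inl qform_Inr)+
  have rhsum: "(\<Sum>b\<in>Bl. \<Sum>q\<leftarrow>bs b. qform (I b) (\<lambda>i j. Ent b i j (y, u, v)) q)
      = riesz y ((\<Sum>j=0..ng P + 1. S1 (Yg j) * gw P j) + (\<Sum>l=1..ns P. S1 (Ys l) * sw P l))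
      + riesz u ((\<Sum>j=0..ng P. S1 (Ug j) * gw P j) + (\<Sum>l=1..ns P. S1 (Us l) * sw P l))
      + riesz v ((\<Sum>j=0..ng P. S2 (Vg j) * ga P j) + (\<Sum>l=1..nq P. S2 (Vq l) * qa P l))" for y u v
    unfolding Bl_def by (subst sum_blocks) (simp_all add: riesz_add riesz_sum block_sums)
  have key: "riesz y (h - 1) + riesz u h + riesz v (pol_rename Inl w - pull_pol d h)
      = riesz y ((\<Sum>j=0..ng P + 1. S1 (Yg j) * gw P j) + (\<Sum>l=1..ns P. S1 (Ys l) * sw P l))
      + riesz u ((\<Sum>j=0..ng P. S1 (Ug j) * gw P j) + (\<Sum>l=1..ns P. S1 (Us l) * sw P l))
      + riesz v ((\<Sum>j=0..ng P. S2 (Vg j) * ga P j) + (\<Sum>l=1..nq P. S2 (Vq l) * qa P l))" for y u v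
    using id[of y u v] unfolding lhs rhsum .
  \<comment> \<open>Letting only one of the three sequences differ from zero isolates one identity.\<close>
  have z0: "riesz (\<lambda>_. 0) q = 0" for q :: "('v \<Rightarrow>\<^sub>0 nat) \<Rightarrow>\<^sub>0 real" by (simp add: riesz_def)
  have E1: "h - 1 = (\<Sum>j=0..ng P + 1. S1 (Yg j) * gw P j) + (\<Sum>l=1..ns P. S1 (Ys l) * sw P l)"
    using key[of _ "\<lambda>_. 0" "\<lambda>_. 0"] unfolding z0 by (intro riesz_eqI) simp
  have E2: "h = (\<Sum>j=0..ng P. S1 (Ug j) * gw P j) + (\<Sum>l=1..ns P. S1 (Us l) * sw P l)"
    using key[of "\<lambda>_. 0" _ "\<lambda>_. 0"] unfolding z0 by (intro riesz_eqI) simp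
  have E3: "pol_rename Inl w - pull_pol d h = (\<Sum>j=0..ng P. S2 (Vg j) * ga P j) + (\<Sum>l=1..nq P. S2 (Vq l) * qa P l)"
    using key[of "\<lambda>_. 0" "\<lambda>_. 0"] unfolding z0 by (intro riesz_eqI) simp
  have wdeg: "pol_deg w \<le> 2 * d" unfolding w_def by (rule pol_deg_coeff_pol)
  have "dual_feasible P d h w"
    unfolding dual_feasible_def
  proof (intro conjI exI)
    show "h - 1 = (\<Sum>j=0..ng P + 1. S1 (Yg j) * gw P j) + (\<Sum>l=1..ns P. S1 (Ys l) * sw P l)" by (rule E1)
    show "h = (\<Sum>j=0..ng P. S1 (Ug j) * gw P j) + (\<Sum>l=1..ns P. S1 (Us l) * sw P l)" by (rule E2)
    show "pol_rename Inl w - (\<Sum>(\<alpha>, \<beta>)\<in>idx P d. const_pol (Poly_Mapping.lookup h (mon_join \<alpha> \<beta>)) * xp P \<alpha> \<beta>)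
        = (\<Sum>j=0..ng P. S2 (Vg j) * ga P j) + (\<Sum>l=1..nq P. S2 (Vq l) * qa P l)"
      using E3 unfolding pull_pol_def .
  qed (use wdeg hk in \<open>auto simp: S1_def S2_def kk_def intro: squares_sos\<close>)
  moreover have "(\<integral>x. ev1 w x \<partial>lam P) \<le> \<rho>"
  proof -
    define v where "v \<gamma> = (\<integral>x. mon_eval (($) x) (mon_left \<gamma>) \<partial>lam P)" for \<gamma> :: "('n + 't) mon"
    have ml: "mon_left (mon_rename Inl \<alpha> :: ('n + 't) mon) = \<alpha>" for \<alpha> :: "'n mon"
      by (rule poly_mapping_eqI) simp
    have "riesz v (pol_rename Inl w) = (\<integral>x. ev1 w x \<partial>lam P)"
      by (rule integral_lam_ev1[OF wdeg]) (simp add: v_def ml)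
    moreover have "riesz v (pol_rename Inl w) = (\<Sum>e\<in>idx P d <+> mons (2 * d). \<nu> e * rhs e)"
      unfolding riesz_rename rw by (subst sum.Plus) (auto simp: rhs_def v_def ml)
    ultimately show ?thesis using val by simp
  qed
  ultimately show ?thesis by blast
qed

lemma strong_duality:
  "rho_dual P d = rho_sdp P d" "\<exists>h w. dual_optimal P d h w" "\<exists>r. rho_sdp P d = ereal r"
proof -
  let ?F = "{(y, u, v). sdp_feasible P d y u v}"
  obtain y0 u0 v0 where "sdp_strictly_feasible P d y0 u0 v0" using slater[of d] by (auto simp: slater_def)
  then have feas: "sdp_feasible P d y0 u0 v0"
    unfolding sdp_feasible_def sdp_strictly_feasible_def sdp_constraints_def
    by (elim conjE) (intro conjI ballI; blast intro: psd_of_pd)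
  have up: "rho_sdp P d \<le> ereal 1"
    unfolding rho_sdp_def using sdp_objective_le_1 by (intro SUP_least) auto
  have lo: "ereal (y0 0) \<le> rho_sdp P d"
    unfolding rho_sdp_def using feas by (intro SUP_upper2[of "(y0, u0, v0)"]) auto
  from up lo obtain r where r: "rho_sdp P d = ereal r"
    by (cases "rho_sdp P d") auto
  then show "\<exists>r. rho_sdp P d = ereal r" by blast
  have bd: "y 0 \<le> r" if "sdp_feasible P d y u v" for y u v
  proof -
    have "ereal (y 0) \<le> rho_sdp P d"
      unfolding rho_sdp_def using that by (intro SUP_upper2[of "(y, u, v)"]) auto
    then show ?thesis by (simp add: r)
  qed
  obtain h w where hw: "dual_feasible P d h w" "(\<integral>x. ev1 w x \<partial>lam P) \<le> r"
    using dual_attained[of d r] bd by blast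
  have ge: "rho_sdp P d \<le> rho_dual P d"
    unfolding rho_sdp_def rho_dual_def using weak_duality by (intro SUP_least INF_greatest) auto
  have le: "rho_dual P d \<le> ereal (\<integral>x. ev1 w x \<partial>lam P)"
    unfolding rho_dual_def using hw by (intro INF_lower2[of "(h, w)"]) auto
  also have "\<dots> \<le> rho_sdp P d" using hw(2) by (simp add: r)
  finally show eq: "rho_dual P d = rho_sdp P d" using ge by (rule antisym)
  have "ereal (\<integral>x. ev1 w x \<partial>lam P) = rho_dual P d"
    using le hw(2) unfolding eq r by auto
  then show "\<exists>h w. dual_optimal P d h w" using hw(1) by (auto simp: dual_optimal_def)
qed

end

context mixture_setting
begin

section \<open>Dual solutions dominate the worst-case probability\<close>

text \<open>The probability \<open>\<mu>\<^sub>a(K\<^sub>x)\<close>.\<close>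

definition prob_K :: "real ^ 'n \<Rightarrow> real ^ 't \<Rightarrow> real" where
  "prob_K x a = measure (mu P a) (Kx P x)"

lemma closed_K: "closed (KK P)"
proof -
  have "KK P = (XX P \<times> Om P) \<inter> {z. ev2 (ff P) z \<le> 0}" by (auto simp: KK_def)
  then show ?thesis
    using compact_X closed_Om
    by (auto intro!: closed_Int closed_Times closed_Collect_le continuous_intros simp: compact_imp_closed)
qed

lemma Kx_sets: "Kx P x \<in> sets (borel_on (Om P))"
proof -
  have "closed (Pair x -` KK P)" by (intro continuous_closed_vimage closed_K continuous_intros)
  moreover have "Kx P x = Om P \<inter> Pair x -` KK P" by (auto simp: Kx_def)
  ultimately show ?thesis by (auto simp: borel_on_def sets_restrict_space)
qed

lemma prob_K_bounds: "a \<in> AA P \<Longrightarrow> 0 \<le> prob_K x a \<and> prob_K x a \<le> 1"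
  unfolding prob_K_def using prob_space.prob_le_1[OF prob_space_mu] by simp

lemma sos_eval_nonneg: "\<sigma> \<in> sos k \<Longrightarrow> pol_eval v \<sigma> \<ge> 0"
  by (auto simp: sos_def pol_eval_simps(8) pol_eval_mult o_def intro!: sum_list_nonneg)

text \<open>The function \<open>h(x, \<cdot>)\<close> dominates the indicator of \<open>K\<^sub>x\<close> on \<open>\<Omega>\<close> by the first two dual constraints,
  and its integral against \<open>\<mu>\<^sub>a\<close> is at most \<open>w(x)\<close> by the third.\<close>

lemma prob_K_le_dual:
  assumes "dual_feasible P d h w" "x \<in> XX P" "a \<in> AA P"
  shows "prob_K x a \<le> ev1 w x"
proof -
  from assms(1) obtain \<sigma>1 \<sigma>2 \<sigma>3 \<tau>1 \<tau>2 \<tau>3 where D: "pol_deg w \<le> 2 * d"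
    "Poly_Mapping.keys h \<subseteq> (\<lambda>(\<alpha>, \<beta>). mon_join \<alpha> \<beta>) ` idx P d"
    "\<forall>j\<in>{0..ng P + 1}. \<sigma>1 j \<in> sos (d - dg P j)"
    "\<forall>j\<in>{0..ng P}. \<sigma>2 j \<in> sos (d - dg P j) \<and> \<sigma>3 j \<in> sos (d - dg P j)"
    "\<forall>l\<in>{1..ns P}. \<tau>1 l \<in> sos (d - half_deg (ss P l)) \<and> \<tau>2 l \<in> sos (d - half_deg (ss P l))"
    "\<forall>l\<in>{1..nq P}. \<tau>3 l \<in> sos (d - half_deg (qq P l))"
    "h - 1 = (\<Sum>j=0..ng P + 1. \<sigma>1 j * gw P j) + (\<Sum>l=1..ns P. \<tau>1 l * sw P l)"
    "h = (\<Sum>j=0..ng P. \<sigma>2 j * gw P j) + (\<Sum>l=1..ns P. \<tau>2 l * sw P l)"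
    "pol_rename Inl w - pull_pol d h = (\<Sum>j=0..ng P. \<sigma>3 j * ga P j) + (\<Sum>l=1..nq P. \<tau>3 l * qa P l)"
    unfolding dual_feasible_def pull_pol_def by (elim conjE exE) blast
  have h1: "ev2 h z \<ge> 1" if "z \<in> KK P" for z
  proof -
    have "z \<in> XX P \<times> Om P" using that by (simp add: KK_def)
    have "ev2 (h - 1) z \<ge> 0"
      unfolding D(7) pol_eval_simps(3,7) pol_eval_mult
      using D(3,5) that \<open>z \<in> XX P \<times> Om P\<close>
      by (intro add_nonneg_nonneg sum_nonneg mult_nonneg_nonneg)
         (blast intro: sos_eval_nonneg gw_nonneg_K sw_nonneg)+
    then show ?thesis by (simp add: pol_eval_simps)
  qed
  have h0: "ev2 h z \<ge> 0" if "z \<in> XX P \<times> Om P" for z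
    unfolding D(8)[THEN arg_cong[where f = "pol_eval _"]] pol_eval_simps(3,7) pol_eval_mult
    using D(4,5) that
    by (intro add_nonneg_nonneg sum_nonneg mult_nonneg_nonneg)
       (blast intro: sos_eval_nonneg gw_nonneg sw_nonneg)+
  have "ev2 (pol_rename Inl w - pull_pol d h) (x, a) \<ge> 0"
  proof -
    have xa: "(x, a) \<in> XX P \<times> AA P" using assms by simp
    show ?thesis
      unfolding D(9) pol_eval_simps(3,7) pol_eval_mult
      using D(4,6) xa
      by (intro add_nonneg_nonneg sum_nonneg mult_nonneg_nonneg)
         (blast intro: sos_eval_nonneg ga_nonneg qa_nonneg)+
  qed
  then have le: "ev2 (pull_pol d h) (x, a) \<le> ev1 w x" by (simp add: pol_eval_simps)
  have int: "has_bochner_integral (mu P a) (\<lambda>\<omega>. ev2 h (x, \<omega>)) (ev2 (pull_pol d h) (x, a))"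
  proof -
    have "(\<Sum>\<gamma>\<in>Poly_Mapping.keys h. Poly_Mapping.lookup h \<gamma> * ev2 (xp P (mon_left \<gamma>) (mon_right \<gamma>)) (x, a))
       = riesz (\<lambda>\<gamma>. ev2 (xp P (mon_left \<gamma>) (mon_right \<gamma>)) (x, a)) h"
      by (simp add: riesz_def)
    also have "\<dots> = ev2 (pull_pol d h) (x, a)"
      unfolding riesz_idx[OF D(2)] pol_eval_riesz[of _ "pull_pol d h"] riesz_pull_pol
      by (simp add: pol_eval_riesz)
    finally show ?thesis using has_integral_mu_ev2[OF assms(3), of x h] by simp
  qed
  interpret prob_space "mu P a" by (rule prob_space_mu[OF assms(3)])
  have K: "Kx P x \<in> sets (mu P a)" using Kx_sets sets_mu[OF assms(3)] by simp
  have "prob_K x a = (\<integral>\<omega>. indicator (Kx P x) \<omega> \<partial>mu P a)"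
    using K by (simp add: prob_K_def)
  also have "\<dots> \<le> (\<integral>\<omega>. ev2 h (x, \<omega>) \<partial>mu P a)"
  proof (rule integral_mono_AE)
    show "integrable (mu P a) (indicator (Kx P x) :: _ \<Rightarrow> real)" using K by (simp add: emeasure_eq_measure)
    show "integrable (mu P a) (\<lambda>\<omega>. ev2 h (x, \<omega>))" using int unfolding has_bochner_integral_iff by blast
    show "AE \<omega> in mu P a. indicator (Kx P x) \<omega> \<le> ev2 h (x, \<omega>)"
    proof (rule AE_I2)
      fix \<omega> assume "\<omega> \<in> space (mu P a)"
      then have "(x, \<omega>) \<in> XX P \<times> Om P" using assms by (simp add: space_mu)
      then show "indicator (Kx P x) \<omega> \<le> ev2 h (x, \<omega>)"
        using h0[of "(x, \<omega>)"] h1[of "(x, \<omega>)"] unfolding Kx_def indicator_def by simp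
    qed
  qed
  also have "\<dots> = ev2 (pull_pol d h) (x, a)" using has_bochner_integral_integral_eq[OF int] .
  finally show ?thesis using le by simp
qed

section \<open>Mixtures\<close>

lemma mixture_prob:
  assumes "\<nu> \<in> mixtures P"
  shows "prob_space \<nu>" "space \<nu> = Om P" "sets \<nu> = sets (borel_on (Om P))"
proof -
  obtain \<phi> where \<phi>: "sets \<nu> = sets (borel_on (Om P))" "\<phi> \<in> prob_meas (AA P)"
    "\<forall>B\<in>sets (borel_on (Om P)). emeasure \<nu> B = (\<integral>\<^sup>+ a. emeasure (mu P a) B \<partial>\<phi>)"
    using assms by (auto simp: mixtures_def)
  show "sets \<nu> = sets (borel_on (Om P))" by fact
  then show sp: "space \<nu> = Om P"
    using sets_eq_imp_space_eq[of \<nu> "borel_on (Om P)"] by (simp add: borel_on_def space_restrict_space)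
  have sA: "space \<phi> = AA P"
    using \<phi>(2) sets_eq_imp_space_eq[of \<phi> "borel_on (AA P)"]
    by (auto simp: prob_meas_def borel_on_def space_restrict_space)
  have "Om P \<in> sets (borel_on (Om P))" using \<phi>(1) sp sets.top[of \<nu>] by simp
  then have "emeasure \<nu> (space \<nu>) = (\<integral>\<^sup>+ a. emeasure (mu P a) (Om P) \<partial>\<phi>)" using \<phi>(3) sp by simp
  also have "\<dots> = (\<integral>\<^sup>+ a. 1 \<partial>\<phi>)"
    using prob_space.emeasure_space_1[OF prob_space_mu] space_mu sA by (intro nn_integral_cong) metis
  also have "\<dots> = 1" using \<phi>(2) by (simp add: prob_meas_def prob_space.emeasure_space_1)
  finally show "prob_space \<nu>" by (rule prob_spaceI)
qed

lemma mixture_le: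
  assumes "\<nu> \<in> mixtures P" "B \<in> sets (borel_on (Om P))" "\<And>a. a \<in> AA P \<Longrightarrow> measure (mu P a) B \<le> r"
  shows "measure \<nu> B \<le> r"
proof -
  obtain \<phi> where \<phi>: "\<phi> \<in> prob_meas (AA P)"
    "\<forall>B\<in>sets (borel_on (Om P)). emeasure \<nu> B = (\<integral>\<^sup>+ a. emeasure (mu P a) B \<partial>\<phi>)"
    using assms by (auto simp: mixtures_def)
  obtain a0 where "a0 \<in> AA P" using int_A interior_subset by blast
  then have r: "r \<ge> 0" using assms(3) measure_nonneg order_trans by blast
  have sA: "space \<phi> = AA P"
    using \<phi>(1) sets_eq_imp_space_eq[of \<phi> "borel_on (AA P)"]
    by (auto simp: prob_meas_def borel_on_def space_restrict_space)
  have "emeasure \<nu> B = (\<integral>\<^sup>+ a. emeasure (mu P a) B \<partial>\<phi>)" using \<phi>(2) assms(2) by blast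
  also have "\<dots> \<le> (\<integral>\<^sup>+ a. ennreal r \<partial>\<phi>)"
  proof (rule nn_integral_mono)
    fix a assume "a \<in> space \<phi>"
    then have a: "a \<in> AA P" by (simp add: sA)
    interpret prob_space "mu P a" by (rule prob_space_mu[OF a])
    show "emeasure (mu P a) B \<le> ennreal r"
      using assms(3)[OF a] by (simp add: emeasure_eq_measure ennreal_leI)
  qed
  also have "\<dots> = ennreal r" using \<phi>(1) by (simp add: prob_meas_def prob_space.emeasure_space_1)
  finally show ?thesis
    using r by (simp add: measure_def enn2real_leI)
qed

text \<open>The mixing distribution is the point mass at \<open>a\<close>.\<close>

lemma mu_mixture:
  assumes "a \<in> AA P"
  shows "mu P a \<in> mixtures P"
proof -
  let ?\<phi> = "return (borel_on (AA P)) a"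
  have a: "a \<in> space (borel_on (AA P))" using assms by (simp add: borel_on_def space_restrict_space)
  have "?\<phi> \<in> prob_meas (AA P)" using prob_space_return[OF a] by (simp add: prob_meas_def)
  moreover have "emeasure (mu P a) B = (\<integral>\<^sup>+ a'. emeasure (mu P a') B \<partial>?\<phi>)"
    if B: "B \<in> sets (borel_on (Om P))" for B
  proof -
    have "(\<lambda>a. ennreal (measure (mu P a) B)) \<in> borel_measurable (borel_on (AA P))"
      using mu_meas[OF B] by measurable
    then have "(\<lambda>a. emeasure (mu P a) B) \<in> borel_measurable (borel_on (AA P))"
    proof (rule measurable_cong[THEN iffD1, rotated])
      fix b assume "b \<in> space (borel_on (AA P))"
      then have "b \<in> AA P" by (simp add: borel_on_def space_restrict_space)
      then interpret prob_space "mu P b" by (rule prob_space_mu)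
      show "ennreal (measure (mu P b) B) = emeasure (mu P b) B" by (simp add: emeasure_eq_measure)
    qed
    from nn_integral_return[OF a this] show ?thesis by simp
  qed
  ultimately show ?thesis using sets_mu[OF assms] by (auto simp: mixtures_def)
qed

section \<open>The worst-case probability\<close>

text \<open>Continuous functions that decrease to the indicator of the closed set \<open>K\<close>. Their integrals
  against \<open>\<mu>\<^sub>a\<close> are continuous in \<open>(x, a)\<close> and bound \<open>\<mu>\<^sub>a(K\<^sub>x)\<close> from above, so \<open>\<mu>\<^sub>a(K\<^sub>x)\<close> is upper
  semicontinuous.\<close>

definition bump :: "nat \<Rightarrow> (real ^ 'n) \<times> (real ^ 'p) \<Rightarrow> real" where
  "bump k z = max 0 (1 - real k * infdist z (KK P))"

lemma bump_bounds: "0 \<le> bump k z" "bump k z \<le> 1"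
  by (auto simp: bump_def infdist_nonneg)

lemma bump_K: "z \<in> KK P \<Longrightarrow> bump k z = 1"
  by (simp add: bump_def)

lemma K_nonempty: "KK P \<noteq> {}"
  using int_K by auto

lemma bump_tendsto: "(\<lambda>k. bump k z) \<longlonglongrightarrow> indicator (KK P) z"
proof (cases "z \<in> KK P")
  case True
  then show ?thesis by (simp add: bump_K)
next
  case False
  define e where "e = infdist z (KK P)"
  have e: "e > 0" unfolding e_def using infdist_pos_not_in_closed[OF closed_K K_nonempty False] .
  obtain N where N: "1 / e < real N" using reals_Archimedean2 by blast
  have "\<forall>\<^sub>F k in sequentially. bump k z = 0"
  proof (rule eventually_sequentiallyI[of N])
    fix k assume "N \<le> k"
    then have "1 / e < real k" using N by linarith
    then show "bump k z = 0" using e by (simp add: bump_def e_def[symmetric] field_simps)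
  qed
  then have "(\<lambda>k. bump k z) \<longlonglongrightarrow> 0" by (rule tendsto_eventually)
  then show ?thesis using False by simp
qed

lemma bump_cont: "continuous_on S (bump k)"
  unfolding bump_def by (intro continuous_intros)

lemma prob_K_approx:
  assumes "x \<in> XX P" "a \<in> AA P"
  shows "(\<lambda>k. \<integral>\<omega>. bump k (x, \<omega>) \<partial>mu P a) \<longlonglongrightarrow> prob_K x a"
    "prob_K x a \<le> (\<integral>\<omega>. bump k (x, \<omega>) \<partial>mu P a)"
proof -
  interpret prob_space "mu P a" by (rule prob_space_mu[OF assms(2)])
  have K: "Kx P x \<in> sets (mu P a)" using Kx_sets sets_mu[OF assms(2)] by simp
  have meas: "(\<lambda>\<omega>. bump k (x, \<omega>)) \<in> borel_measurable (mu P a)" for k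
  proof -
    have "continuous_on UNIV (\<lambda>\<omega>. bump k (x, \<omega>))"
      by (intro continuous_on_compose2[OF bump_cont[of UNIV]] continuous_intros) auto
    then have "(\<lambda>\<omega>. bump k (x, \<omega>)) \<in> borel_measurable borel" by (rule borel_measurable_continuous_onI)
    then show ?thesis
      unfolding measurable_cong_sets[OF sets_mu[OF assms(2)] refl] borel_on_def
      by (rule measurable_restrict_space1)
  qed
  have eq: "prob_K x a = (\<integral>\<omega>. indicator (Kx P x) \<omega> \<partial>mu P a)"
    using K by (simp add: prob_K_def)
  have ind: "indicator (Kx P x) \<omega> = (indicator (KK P) (x, \<omega>) :: real)" for \<omega>
    by (auto simp: Kx_def KK_def indicator_def)
  show "(\<lambda>k. \<integral>\<omega>. bump k (x, \<omega>) \<partial>mu P a) \<longlonglongrightarrow> prob_K x a"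
    unfolding eq
  proof (rule integral_dominated_convergence[where w = "\<lambda>_. 1"])
    show "AE \<omega> in mu P a. (\<lambda>k. bump k (x, \<omega>)) \<longlonglongrightarrow> indicator (Kx P x) \<omega>"
      unfolding ind using bump_tendsto by simp
    show "AE \<omega> in mu P a. norm (bump k (x, \<omega>)) \<le> 1" for k
      using bump_bounds by simp
  qed (use meas K in auto)
  show "prob_K x a \<le> (\<integral>\<omega>. bump k (x, \<omega>) \<partial>mu P a)"
    unfolding eq
  proof (rule integral_mono_AE)
    show "integrable (mu P a) (indicator (Kx P x) :: _ \<Rightarrow> real)" using K by (simp add: emeasure_eq_measure)
    show "integrable (mu P a) (\<lambda>\<omega>. bump k (x, \<omega>))"
      using meas bump_bounds by (intro integrable_const_bound[of _ 1]) auto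
    show "AE \<omega> in mu P a. indicator (Kx P x) \<omega> \<le> bump k (x, \<omega>)"
      unfolding ind using bump_bounds bump_K by (auto simp: indicator_def)
  qed
qed

text \<open>Upper semicontinuity on the compact set \<open>X \<times> A\<close>, in terms of superlevel sets. Sections of
  these sets yield the maximum over \<open>a\<close>, and their projections the superlevel sets of \<open>\<kappa>\<close>.\<close>

lemma compact_prob_K_ge: "compact {z \<in> XX P \<times> AA P. c \<le> prob_K (fst z) (snd z)}"
proof -
  define G where "G k = (\<lambda>(x, a). \<integral>\<omega>. bump k (x, \<omega>) \<partial>mu P a)" for k
  have cont: "continuous_on (XX P \<times> AA P) (G k)" for k
  proof -
    have "bdd_continuous_on (XX P \<times> Om P) (bump k)"
      using bump_bounds by (auto simp: bdd_continuous_on_def bump_cont bounded_iff intro!: exI[of _ 1])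
    from mu_continuous[OF this] show ?thesis by (simp add: bdd_continuous_on_def G_def)
  qed
  have eq: "{z \<in> XX P \<times> AA P. c \<le> prob_K (fst z) (snd z)} = (XX P \<times> AA P) \<inter> (\<Inter>k. (XX P \<times> AA P) \<inter> G k -` {c..})"
  proof (intro set_eqI iffI)
    fix z assume z: "z \<in> {z \<in> XX P \<times> AA P. c \<le> prob_K (fst z) (snd z)}"
    then show "z \<in> (XX P \<times> AA P) \<inter> (\<Inter>k. (XX P \<times> AA P) \<inter> G k -` {c..})"
      using prob_K_approx(2) by (auto simp: G_def intro: order_trans)
  next
    fix z assume z: "z \<in> (XX P \<times> AA P) \<inter> (\<Inter>k. (XX P \<times> AA P) \<inter> G k -` {c..})"
    then obtain x a where xa: "z = (x, a)" "x \<in> XX P" "a \<in> AA P" by auto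
    have "c \<le> (\<integral>\<omega>. bump k (x, \<omega>) \<partial>mu P a)" for k using z by (auto simp: xa(1) G_def)
    then have "c \<le> prob_K x a"
      using LIMSEQ_le_const[OF prob_K_approx(1)[OF xa(2,3)]] by blast
    then show "z \<in> {z \<in> XX P \<times> AA P. c \<le> prob_K (fst z) (snd z)}" using xa by simp
  qed
  have cl: "closed (\<Inter>k. (XX P \<times> AA P) \<inter> G k -` {c..})"
    using cont compact_X compact_A
    by (intro closed_INT ballI continuous_closed_preimage closed_Times) (auto simp: compact_imp_closed)
  show ?thesis
    unfolding eq by (rule compact_Int_closed[OF compact_Times[OF compact_X compact_A] cl])
qed

lemma prob_K_max:
  assumes x: "x \<in> XX P"
  shows "\<exists>a\<in>AA P. \<forall>b\<in>AA P. prob_K x b \<le> prob_K x a"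
proof -
  define s where "s = (SUP a\<in>AA P. prob_K x a)"
  have ne: "AA P \<noteq> {}" using int_A by auto
  have bdd: "bdd_above (prob_K x ` AA P)" using prob_K_bounds by (auto intro!: bdd_aboveI[of _ 1])
  define T where "T n = {a \<in> AA P. s - 1 / real (Suc n) \<le> prob_K x a}" for n
  have T: "T n = snd ` ({z \<in> XX P \<times> AA P. s - 1 / real (Suc n) \<le> prob_K (fst z) (snd z)} \<inter> ({x} \<times> UNIV))" for n
    using x by (force simp: T_def image_iff)
  have "\<Inter>(range T) \<noteq> {}"
  proof (rule compact_nest)
    show "compact (T n)" for n
      unfolding T
      by (intro compact_continuous_image compact_Int_closed compact_prob_K_ge closed_Times
          closed_singleton closed_UNIV continuous_intros)
    show "T n \<noteq> {}" for n
    proof -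
      have "s - 1 / real (Suc n) < s" by simp
      then obtain a where "a \<in> AA P" "s - 1 / real (Suc n) < prob_K x a"
        unfolding s_def using less_cSUP_iff[OF ne bdd] by blast
      then show ?thesis by (auto simp: T_def)
    qed
    show "T n \<subseteq> T m" if "m \<le> n" for m n
    proof -
      have "1 / real (Suc n) \<le> 1 / real (Suc m)" using that by (simp add: frac_le)
      then show ?thesis by (auto simp: T_def)
    qed
  qed
  then obtain a where a: "\<And>n. a \<in> T n" by blast
  have "s - prob_K x a \<le> 0"
  proof (rule LIMSEQ_le_const)
    show "(\<lambda>n. 1 / real (Suc n)) \<longlonglongrightarrow> 0" by (rule LIMSEQ_inverse_real_of_nat[unfolded inverse_eq_divide])
    show "\<exists>N. \<forall>n\<ge>N. s - prob_K x a \<le> 1 / real (Suc n)"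
    proof (intro exI allI impI)
      fix n :: nat
      show "s - prob_K x a \<le> 1 / real (Suc n)" using a[of n] unfolding T_def by simp
    qed
  qed
  moreover have "prob_K x b \<le> s" if "b \<in> AA P" for b
    unfolding s_def using that bdd by (rule cSUP_upper)
  moreover have "a \<in> AA P" using a[of 0] by (simp add: T_def)
  ultimately show ?thesis by force
qed

text \<open>The maximum of \<open>\<nu>(K\<^sub>x)\<close> over all mixtures exists and equals the maximum over the family.\<close>

lemma kappa_props:
  assumes x: "x \<in> XX P"
  shows "\<exists>a\<in>AA P. kappa P x = prob_K x a" "\<And>a. a \<in> AA P \<Longrightarrow> prob_K x a \<le> kappa P x"
    "\<And>\<nu>. \<nu> \<in> mixtures P \<Longrightarrow> measure \<nu> (Kx P x) \<le> kappa P x"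
proof -
  obtain a where a: "a \<in> AA P" "\<And>b. b \<in> AA P \<Longrightarrow> prob_K x b \<le> prob_K x a"
    using prob_K_max[OF x] by blast
  have le: "measure \<nu> (Kx P x) \<le> prob_K x a" if "\<nu> \<in> mixtures P" for \<nu>
    using mixture_le[OF that Kx_sets] a(2) unfolding prob_K_def by blast
  have eq: "kappa P x = prob_K x a"
    unfolding kappa_def
    by (rule Greatest_equality) (use mu_mixture[OF a(1)] le in \<open>auto simp: prob_K_def\<close>)
  show "\<exists>a\<in>AA P. kappa P x = prob_K x a" using a(1) eq by blast
  show "\<And>a. a \<in> AA P \<Longrightarrow> prob_K x a \<le> kappa P x" using a(2) eq by simp
  show "\<And>\<nu>. \<nu> \<in> mixtures P \<Longrightarrow> measure \<nu> (Kx P x) \<le> kappa P x" using le eq by simp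
qed

lemma kappa_bounds: "x \<in> XX P \<Longrightarrow> 0 \<le> kappa P x \<and> kappa P x \<le> 1"
  using kappa_props(1) prob_K_bounds by metis

lemma kappa_measurable: "kappa P \<in> borel_measurable (borel_on (XX P))"
  unfolding borel_measurable_iff_ge
proof
  fix c
  have "{x \<in> XX P. c \<le> kappa P x} = fst ` {z \<in> XX P \<times> AA P. c \<le> prob_K (fst z) (snd z)}" (is "?L = ?R")
  proof (intro set_eqI iffI)
    fix x assume "x \<in> ?L"
    then show "x \<in> ?R" using kappa_props(1)[of x] by (force simp: image_iff)
  next
    fix x assume "x \<in> ?R"
    then show "x \<in> ?L" using kappa_props(2) by (force intro: order_trans)
  qed
  moreover have "compact ?R"
    by (intro compact_continuous_image compact_prob_K_ge continuous_intros)
  ultimately have "closed {x \<in> XX P. c \<le> kappa P x}" by (simp add: compact_imp_closed)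
  then have "{x \<in> XX P. c \<le> kappa P x} \<in> sets (borel_on (XX P))"
    by (auto simp: borel_on_def sets_restrict_space image_iff intro!: bexI[of _ "{x \<in> XX P. c \<le> kappa P x}"])
  then show "{w \<in> space (borel_on (XX P)). c \<le> kappa P w} \<in> sets (borel_on (XX P))"
    by (simp add: borel_on_def space_restrict_space)
qed

lemma kappa_integrable: "integrable (lam P) (kappa P)"
proof -
  interpret prob_space "lam P" by (rule prob_space_lam)
  show ?thesis
    using kappa_measurable kappa_bounds
    by (intro integrable_const_bound[of _ 1]) (auto simp: measurable_cong_sets[OF sets_lam refl])
qed

lemma kappa_le_dual: "\<lbrakk>dual_feasible P d h w; x \<in> XX P\<rbrakk> \<Longrightarrow> kappa P x \<le> ev1 w x"
  using kappa_props(1) prob_K_le_dual by metis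

lemma measure_compl_Kx:
  assumes "\<nu> \<in> mixtures P" "x \<in> XX P"
  shows "measure \<nu> {\<omega> \<in> Om P. ev2 (ff P) (x, \<omega>) > 0} = 1 - measure \<nu> (Kx P x)"
proof -
  interpret prob_space \<nu> by (rule mixture_prob[OF assms(1)])
  have "{\<omega> \<in> Om P. ev2 (ff P) (x, \<omega>) > 0} = space \<nu> - Kx P x"
    unfolding mixture_prob(2)[OF assms(1)] Kx_def KK_def using assms(2) by auto
  moreover have "Kx P x \<in> sets \<nu>" using mixture_prob(3)[OF assms(1)] Kx_sets by simp
  ultimately show ?thesis by (metis prob_compl)
qed

lemma Xd_subset_Xstar:
  assumes "dual_feasible P d h w"
  shows "Xd P w \<epsilon> \<subseteq> Xstar P \<epsilon>"
proof
  fix x assume "x \<in> Xd P w \<epsilon>"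
  then have x: "x \<in> XX P" "ev1 w x < \<epsilon>" by (auto simp: Xd_def)
  have "measure \<nu> {\<omega> \<in> Om P. ev2 (ff P) (x, \<omega>) > 0} > 1 - \<epsilon>" if "\<nu> \<in> mixtures P" for \<nu>
    using kappa_props(3)[OF x(1) that] kappa_le_dual[OF assms x(1)] x(2)
    unfolding measure_compl_Kx[OF that x(1)] by linarith
  then show "x \<in> Xstar P \<epsilon>" using x(1) unfolding Xstar_def by blast
qed

lemma Xstar_kappa: "x \<in> Xstar P \<epsilon> \<Longrightarrow> x \<in> XX P \<and> kappa P x < \<epsilon>"
proof -
  assume *: "x \<in> Xstar P \<epsilon>"
  then have x: "x \<in> XX P" by (simp add: Xstar_def)
  obtain a where a: "a \<in> AA P" "kappa P x = prob_K x a" using kappa_props(1)[OF x] by blast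
  have "measure (mu P a) {\<omega> \<in> Om P. ev2 (ff P) (x, \<omega>) > 0} > 1 - \<epsilon>"
    using * mu_mixture[OF a(1)] unfolding Xstar_def by blast
  then show ?thesis
    unfolding measure_compl_Kx[OF mu_mixture[OF a(1)] x] using a(2) x by (simp add: prob_K_def)
qed

section \<open>The value of the infinite-dimensional program\<close>

text \<open>The description by which \<open>T\<^sup>*\<psi>\<close> is defined has a unique solution: the kernel composition of \<open>\<psi>\<close>
  with the image of \<open>\<mu>\<^sub>a\<close> under \<open>\<omega> \<mapsto> (x, \<omega>)\<close>.\<close>

lemma Tadj_eq:
  assumes \<psi>: "\<psi> \<in> prob_meas (XX P \<times> AA P)"
  shows "Tadj P \<psi> \<in> fin_meas (XX P \<times> Om P)"
    "\<And>g. bdd_measurable_on (XX P \<times> Om P) g \<Longrightarrow> (\<integral>z. g z \<partial>Tadj P \<psi>) = (\<integral>z. TT P g z \<partial>\<psi>)"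
proof -
  let ?S = "borel_on (XX P \<times> Om P)"
  interpret psi: prob_space \<psi> using \<psi> by (simp add: prob_meas_def)
  have sets_psi: "sets \<psi> = sets (borel_on (XX P \<times> AA P))" using \<psi> by (simp add: prob_meas_def)
  have space_psi: "space \<psi> = XX P \<times> AA P"
    using sets_eq_imp_space_eq[OF sets_psi] by (simp add: borel_on_def space_restrict_space)
  have space_S: "space ?S = XX P \<times> Om P" by (simp add: borel_on_def space_restrict_space)
  define k where "k = (\<lambda>(x, a). distr (mu P a) ?S (Pair x))"
  have Pair_meas: "Pair x \<in> measurable (mu P a) ?S" if "x \<in> XX P" "a \<in> AA P" for x a
  proof -
    have "Pair x \<in> measurable borel (borel :: ((real ^ 'n) \<times> (real ^ 'p)) measure)"
      by (intro borel_measurable_continuous_onI continuous_intros)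
    then show ?thesis
      unfolding measurable_cong_sets[OF sets_mu[OF that(2)] refl] borel_on_def
      using that(1) by (intro measurable_restrict_space3) auto
  qed
  have k_prob: "prob_space (k z)" if "z \<in> space \<psi>" for z
    using that Pair_meas by (auto simp: k_def space_psi intro!: prob_space.prob_space_distr prob_space_mu)
  have k_int: "(\<integral>w. g w \<partial>k z) = TT P g z" if "z \<in> space \<psi>" "g \<in> borel_measurable ?S" for z g
    using that Pair_meas by (auto simp: k_def space_psi TT_def integral_distr)
  have k: "k \<in> measurable \<psi> (subprob_algebra ?S)"
  proof (rule measurable_subprob_algebra)
    show "subprob_space (k z)" if "z \<in> space \<psi>" for z
      using k_prob[OF that] by (rule prob_space_imp_subprob_space)
    show "sets (k z) = sets ?S" for z by (simp add: k_def split_def)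
    fix B assume B: "B \<in> sets ?S"
    have bm: "bdd_measurable_on (XX P \<times> Om P) (indicat_real B)"
      using B by (auto simp: bdd_measurable_on_def bounded_iff indicator_def intro!: exI[of _ 1])
    have "(\<lambda>(x, a). \<integral>\<omega>. indicat_real B (x, \<omega>) \<partial>mu P a) \<in> borel_measurable \<psi>"
      using mu_measurable[OF bm] unfolding bdd_measurable_on_def measurable_cong_sets[OF sets_psi refl] by blast
    then have "(\<lambda>z. ennreal (TT P (indicator B) z)) \<in> borel_measurable \<psi>" unfolding TT_def by measurable
    then show "(\<lambda>z. emeasure (k z) B) \<in> borel_measurable \<psi>"
    proof (rule measurable_cong[THEN iffD1, rotated])
      fix z assume z: "z \<in> space \<psi>"
      interpret prob_space "k z" by (rule k_prob[OF z])
      have "(\<integral>w. indicator B w \<partial>k z) = prob B" using B by (simp add: k_def split_def)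
      then show "ennreal (TT P (indicator B) z) = emeasure (k z) B"
        using k_int[OF z, of "indicator B"] B by (simp add: emeasure_eq_measure)
    qed
  qed
  let ?\<nu> = "\<psi> \<bind> k"
  have ne: "space \<psi> \<noteq> {}" using psi.not_empty .
  have sets_nu: "sets ?\<nu> = sets ?S" using ne by (intro sets_bind) (simp add: k_def split_def)
  have nu_int: "(\<integral>z. g z \<partial>?\<nu>) = (\<integral>z. TT P g z \<partial>\<psi>)" if g: "bdd_measurable_on (XX P \<times> Om P) g" for g
  proof -
    obtain B where B: "\<And>z. z \<in> XX P \<times> Om P \<Longrightarrow> \<bar>g z\<bar> \<le> B"
      using g by (auto simp: bdd_measurable_on_def bounded_iff)
    have gm: "g \<in> borel_measurable ?S" using g by (simp add: bdd_measurable_on_def)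
    have "(\<integral>z. g z \<partial>?\<nu>) = (\<integral>z. (\<integral>w. g w \<partial>k z) \<partial>\<psi>)"
    proof (rule integral_bind[OF gm _ k psi.finite_measure_axioms, where B' = 1])
      show "\<bar>g z\<bar> \<le> B" if "z \<in> space ?S" for z using B that by (simp add: space_S)
      show "AE z in \<psi>. emeasure (k z) (space (k z)) \<le> ennreal 1"
        using k_prob by (intro AE_I2) (simp add: prob_space.emeasure_space_1)
    qed
    also have "\<dots> = (\<integral>z. TT P g z \<partial>\<psi>)"
      using k_int gm by (intro Bochner_Integration.integral_cong) auto
    finally show ?thesis .
  qed
  have nu_fin: "?\<nu> \<in> fin_meas (XX P \<times> Om P)"
  proof -
    have "subprob_space ?\<nu>"
      using psi.subprob_space_axioms k by (rule subprob_space_bind)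
    then show ?thesis using sets_nu by (simp add: fin_meas_def subprob_space.axioms(1))
  qed
  have "Tadj P \<psi> = ?\<nu>"
    unfolding Tadj_def
  proof (rule the_equality)
    show "?\<nu> \<in> fin_meas (XX P \<times> Om P) \<and>
       (\<forall>g. bdd_measurable_on (XX P \<times> Om P) g \<longrightarrow> (\<integral>z. g z \<partial>?\<nu>) = (\<integral>z. TT P g z \<partial>\<psi>))"
      using nu_fin nu_int by blast
    fix \<nu>' assume \<nu>': "\<nu>' \<in> fin_meas (XX P \<times> Om P) \<and>
       (\<forall>g. bdd_measurable_on (XX P \<times> Om P) g \<longrightarrow> (\<integral>z. g z \<partial>\<nu>') = (\<integral>z. TT P g z \<partial>\<psi>))"
    interpret f1: finite_measure \<nu>' using \<nu>' by (simp add: fin_meas_def)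
    interpret f2: finite_measure ?\<nu> using nu_fin by (simp add: fin_meas_def)
    show "\<nu>' = ?\<nu>"
    proof (rule measure_eqI)
      show "sets \<nu>' = sets ?\<nu>" using \<nu>' sets_nu by (simp add: fin_meas_def)
      fix B assume B: "B \<in> sets \<nu>'"
      then have BS: "B \<in> sets ?S" using \<nu>' by (simp add: fin_meas_def)
      have bm: "bdd_measurable_on (XX P \<times> Om P) (indicator B :: _ \<Rightarrow> real)"
        using BS by (auto simp: bdd_measurable_on_def bounded_iff indicator_def intro!: exI[of _ 1])
      have "measure \<nu>' B = (\<integral>z. indicator B z \<partial>\<nu>')" using B by simp
      also have "\<dots> = (\<integral>z. TT P (indicator B) z \<partial>\<psi>)" using \<nu>' bm by blast
      also have "\<dots> = (\<integral>z. indicator B z \<partial>?\<nu>)" by (rule nu_int[OF bm, symmetric])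
      also have "\<dots> = measure ?\<nu> B" using BS sets_nu by simp
      finally show "emeasure \<nu>' B = emeasure ?\<nu> B"
        by (simp add: f1.emeasure_eq_measure f2.emeasure_eq_measure)
    qed
  qed
  then show "Tadj P \<psi> \<in> fin_meas (XX P \<times> Om P)"
    "\<And>g. bdd_measurable_on (XX P \<times> Om P) g \<Longrightarrow> (\<integral>z. g z \<partial>Tadj P \<psi>) = (\<integral>z. TT P g z \<partial>\<psi>)"
    using nu_fin nu_int by auto
qed

text \<open>A feasible \<open>\<phi>\<close> has mass at most \<open>T\<^sup>*\<psi>(K) = \<integral> \<mu>\<^sub>a(K\<^sub>x) d\<psi> \<le> \<integral> \<kappa> d\<lambda>\<close>.\<close>

lemma rho_le_kappa: "rho P \<le> ereal (\<integral>x. kappa P x \<partial>lam P)"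
  unfolding rho_def
proof (rule SUP_least, clarify)
  fix \<phi> \<psi> assume "rho_feasible P \<phi> \<psi>"
  then have f: "\<phi> \<in> fin_meas (KK P)" "\<psi> \<in> prob_meas (XX P \<times> AA P)"
    "\<forall>B\<in>sets (borel_on (XX P \<times> Om P)). emeasure \<phi> (B \<inter> KK P) \<le> emeasure (Tadj P \<psi>) B"
    "distr \<psi> (borel_on (XX P)) fst = lam P"
    by (auto simp: rho_feasible_def)
  interpret psi: prob_space \<psi> using f(2) by (simp add: prob_meas_def)
  interpret ta: finite_measure "Tadj P \<psi>" using Tadj_eq(1)[OF f(2)] by (simp add: fin_meas_def)
  interpret ph: finite_measure \<phi> using f(1) by (simp add: fin_meas_def)
  have sets_psi: "sets \<psi> = sets (borel_on (XX P \<times> AA P))" using f(2) by (simp add: prob_meas_def)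
  have space_psi: "space \<psi> = XX P \<times> AA P"
    using sets_eq_imp_space_eq[OF sets_psi] by (simp add: borel_on_def space_restrict_space)
  have K: "KK P \<in> sets (borel_on (XX P \<times> Om P))"
  proof -
    have "KK P = (XX P \<times> Om P) \<inter> KK P" by (auto simp: KK_def)
    then show ?thesis using closed_K by (auto simp: borel_on_def sets_restrict_space)
  qed
  have bm: "bdd_measurable_on (XX P \<times> Om P) (indicator (KK P) :: _ \<Rightarrow> real)"
    using K by (auto simp: bdd_measurable_on_def bounded_iff indicator_def intro!: exI[of _ 1])
  have T: "TT P (indicator (KK P)) (x, a) = prob_K x a" if "a \<in> AA P" for x a
  proof -
    have "TT P (indicator (KK P)) (x, a) = (\<integral>\<omega>. indicator (Kx P x) \<omega> \<partial>mu P a)"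
      unfolding TT_def by (auto simp: Kx_def KK_def indicator_def intro!: Bochner_Integration.integral_cong)
    then show ?thesis using Kx_sets sets_mu[OF that] by (simp add: prob_K_def)
  qed
  have fst_meas: "fst \<in> measurable \<psi> (borel_on (XX P))"
  proof -
    have "fst \<in> measurable borel (borel :: (real ^ 'n) measure)"
      by (intro borel_measurable_continuous_onI continuous_intros)
    then show ?thesis
      unfolding measurable_cong_sets[OF sets_psi refl] borel_on_def
      by (intro measurable_restrict_space3) auto
  qed
  have kint: "integrable \<psi> (\<lambda>z. kappa P (fst z))"
    using kappa_bounds measurable_compose[OF fst_meas kappa_measurable]
    by (intro psi.integrable_const_bound[of _ 1]) (auto simp: space_psi)
  have "measure \<phi> (KK P) \<le> measure (Tadj P \<psi>) (KK P)"
    using f(3)[rule_format, OF K] by (simp add: ph.emeasure_eq_measure ta.emeasure_eq_measure)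
  also have "\<dots> = (\<integral>z. indicator (KK P) z \<partial>Tadj P \<psi>)"
    using K Tadj_eq(1)[OF f(2)] by (simp add: fin_meas_def)
  also have "\<dots> = (\<integral>z. TT P (indicator (KK P)) z \<partial>\<psi>)" by (rule Tadj_eq(2)[OF f(2) bm])
  also have "\<dots> \<le> (\<integral>z. kappa P (fst z) \<partial>\<psi>)"
  proof (rule integral_mono_AE[OF _ kint])
    have "TT P (indicator (KK P)) \<in> borel_measurable \<psi>"
      using mu_measurable[OF bm] unfolding bdd_measurable_on_def TT_def measurable_cong_sets[OF sets_psi refl]
      by blast
    then show "integrable \<psi> (TT P (indicator (KK P)))"
      using T prob_K_bounds by (intro psi.integrable_const_bound[of _ 1]) (auto simp: space_psi)
    show "AE z in \<psi>. TT P (indicator (KK P)) z \<le> kappa P (fst z)"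
      using T kappa_props(2) by (intro AE_I2) (auto simp: space_psi)
  qed
  also have "\<dots> = (\<integral>x. kappa P x \<partial>distr \<psi> (borel_on (XX P)) fst)"
    using integral_distr[OF fst_meas kappa_measurable] by simp
  finally show "ereal (measure \<phi> (KK P)) \<le> ereal (\<integral>x. kappa P x \<partial>lam P)" by (simp add: f(4))
qed

section \<open>Convergence\<close>

lemma convergence:
  assumes opt: "\<And>d. d \<ge> d0 \<Longrightarrow> dual_optimal P d (h d) (w d)" and lim: "rho_sdp P \<longlonglongrightarrow> rho P"
  shows "(\<lambda>d. \<integral>\<^sup>+ x. ennreal \<bar>ev1 (w d) x - kappa P x\<bar> \<partial>lam P) \<longlonglongrightarrow> 0"
    "\<And>\<epsilon>. (\<lambda>d. measure (lam P) (Xstar P \<epsilon> - Xd P (w d) \<epsilon>)) \<longlonglongrightarrow> 0"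
proof -
  interpret prob_space "lam P" by (rule prob_space_lam)
  define c where "c = (\<integral>x. kappa P x \<partial>lam P)"
  define J where "J d = (\<integral>x. ev1 (w d) x \<partial>lam P) - c" for d
  have feas: "dual_feasible P d (h d) (w d)" if "d \<ge> d0" for d using opt[OF that] by (simp add: dual_optimal_def)
  have val: "rho_sdp P d = ereal (\<integral>x. ev1 (w d) x \<partial>lam P)" if "d \<ge> d0" for d
    using opt[OF that] strong_duality(1)[of d] by (simp add: dual_optimal_def)
  have int: "integrable (lam P) (\<lambda>x. ev1 (w d) x - kappa P x)" for d
    using integrable_lam_ev1 kappa_integrable by (rule Bochner_Integration.integrable_diff)
  have J: "J d = (\<integral>x. ev1 (w d) x - kappa P x \<partial>lam P)" for d
    unfolding J_def c_def using integrable_lam_ev1 kappa_integrable by simp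
  have nonneg: "ev1 (w d) x - kappa P x \<ge> 0" if "d \<ge> d0" "x \<in> XX P" for d x
    using kappa_le_dual[OF feas[OF that(1)] that(2)] by simp
  have J0: "J d \<ge> 0" if "d \<ge> d0" for d
    unfolding J using nonneg[OF that] by (intro integral_nonneg_AE AE_I2) auto
  have rho: "rho P = ereal c"
  proof (rule antisym)
    show "rho P \<le> ereal c" unfolding c_def by (rule rho_le_kappa)
    show "ereal c \<le> rho P"
      using J0 by (intro LIMSEQ_le_const[OF lim] exI[of _ d0]) (auto simp: val J_def)
  qed
  have "(\<lambda>d. ereal (\<integral>x. ev1 (w d) x \<partial>lam P)) \<longlonglongrightarrow> ereal c"
    using lim[unfolded rho]
    by (rule Lim_transform_eventually) (auto simp: val intro: eventually_sequentiallyI[of d0])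
  then have "(\<lambda>d. \<integral>x. ev1 (w d) x \<partial>lam P) \<longlonglongrightarrow> c" by simp
  then have Jlim: "J \<longlonglongrightarrow> 0" unfolding J_def by (simp add: LIM_zero)
  have "(\<lambda>d. ennreal (J d)) \<longlonglongrightarrow> ennreal 0" using Jlim by (rule tendsto_ennrealI)
  then have "(\<lambda>d. ennreal (J d)) \<longlonglongrightarrow> 0" by simp
  moreover have "\<forall>\<^sub>F d in sequentially. ennreal (J d) = (\<integral>\<^sup>+ x. ennreal \<bar>ev1 (w d) x - kappa P x\<bar> \<partial>lam P)"
  proof (rule eventually_sequentiallyI[of d0])
    fix d assume d: "d \<ge> d0"
    have "(\<integral>\<^sup>+ x. ennreal \<bar>ev1 (w d) x - kappa P x\<bar> \<partial>lam P) = (\<integral>\<^sup>+ x. ennreal (ev1 (w d) x - kappa P x) \<partial>lam P)"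
      using nonneg[OF d] by (intro nn_integral_cong) simp
    also have "\<dots> = ennreal (J d)"
      unfolding J using nonneg[OF d] by (intro nn_integral_eq_integral int AE_I2) auto
    finally show "ennreal (J d) = (\<integral>\<^sup>+ x. ennreal \<bar>ev1 (w d) x - kappa P x\<bar> \<partial>lam P)" ..
  qed
  ultimately show "(\<lambda>d. \<integral>\<^sup>+ x. ennreal \<bar>ev1 (w d) x - kappa P x\<bar> \<partial>lam P) \<longlonglongrightarrow> 0"
    by (rule Lim_transform_eventually)
  show "(\<lambda>d. measure (lam P) (Xstar P \<epsilon> - Xd P (w d) \<epsilon>)) \<longlonglongrightarrow> 0" for \<epsilon>
  proof -
    have km: "kappa P \<in> borel_measurable (lam P)"
      using kappa_measurable by (simp add: measurable_cong_sets[OF sets_lam refl])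
    define S where "S n = {x \<in> space (lam P). \<epsilon> - 1 / real (Suc n) < kappa P x \<and> kappa P x < \<epsilon>}" for n
    have S: "S n \<in> sets (lam P)" for n unfolding S_def using km by measurable
    have "(\<lambda>n. prob (S n)) \<longlonglongrightarrow> prob (\<Inter>n. S n)"
    proof (rule finite_Lim_measure_decseq)
      show "range S \<subseteq> sets (lam P)" using S by auto
      show "decseq S"
      proof (rule decseq_SucI)
        fix n
        have "1 / real (Suc (Suc n)) \<le> 1 / real (Suc n)" by (simp add: frac_le)
        then show "S (Suc n) \<subseteq> S n" unfolding S_def by auto
      qed
    qed
    moreover have "(\<Inter>n. S n) = {}"
    proof (rule ccontr)
      assume "(\<Inter>n. S n) \<noteq> {}"
      then obtain x where x: "\<And>n. x \<in> S n" by auto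
      then have "kappa P x < \<epsilon>" by (simp add: S_def)
      then obtain n where "1 / real (Suc n) < \<epsilon> - kappa P x"
        using reals_Archimedean[of "\<epsilon> - kappa P x"] by (auto simp: inverse_eq_divide)
      then show False using x[of n] by (simp add: S_def)
    qed
    ultimately have Slim: "(\<lambda>n. prob (S n)) \<longlonglongrightarrow> 0" by simp
    \<comment> \<open>On \<open>Xstar - Xd\<close> one has \<open>\<kappa> < \<epsilon> \<le> w\<^sub>d\<close>: either \<open>\<kappa>\<close> is close to \<open>\<epsilon>\<close>, or \<open>w\<^sub>d - \<kappa>\<close> is large.\<close>
    have bound: "prob (Xstar P \<epsilon> - Xd P (w d) \<epsilon>) \<le> prob (S n) + J d * real (Suc n)" if d: "d \<ge> d0" for d n
    proof -
      let ?R = "{x \<in> space (lam P). ev1 (w d) x - kappa P x \<ge> 1 / real (Suc n)}"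
      have R: "?R \<in> sets (lam P)"
        using borel_measurable_integrable[OF int[of d]] by measurable
      have "Xstar P \<epsilon> - Xd P (w d) \<epsilon> \<subseteq> S n \<union> ?R"
      proof
        fix x assume "x \<in> Xstar P \<epsilon> - Xd P (w d) \<epsilon>"
        then have "x \<in> XX P" "kappa P x < \<epsilon>" "\<epsilon> \<le> ev1 (w d) x"
          using Xstar_kappa[of x \<epsilon>] by (auto simp: Xd_def)
        then show "x \<in> S n \<union> ?R" unfolding S_def by auto
      qed
      then have "prob (Xstar P \<epsilon> - Xd P (w d) \<epsilon>) \<le> prob (S n \<union> ?R)"
        using S R by (intro finite_measure_mono) auto
      also have "\<dots> \<le> prob (S n) + prob ?R" using S R by (intro measure_subadditive) auto
      also have "prob ?R \<le> (\<integral>x. ev1 (w d) x - kappa P x \<partial>lam P) / (1 / real (Suc n))"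
        using nonneg[OF d] by (intro integral_Markov_inequality_measure[OF int, where A = "{}"] AE_I2) auto
      finally show ?thesis by (simp add: J)
    qed
    show ?thesis
    proof (rule LIMSEQ_I)
      fix r :: real assume r: "r > 0"
      obtain n where n: "prob (S n) < r / 2"
        using LIMSEQ_D[OF Slim, of "r / 2"] r by (force simp: abs_less_iff)
      have "(\<lambda>d. J d * real (Suc n)) \<longlonglongrightarrow> 0 * real (Suc n)"
        using Jlim by (intro tendsto_mult tendsto_const)
      then obtain N where N: "\<And>d. d \<ge> N \<Longrightarrow> \<bar>J d * real (Suc n)\<bar> < r / 2"
        using LIMSEQ_D[of "\<lambda>d. J d * real (Suc n)" 0 "r / 2"] r by auto
      show "\<exists>no. \<forall>d\<ge>no. norm (prob (Xstar P \<epsilon> - Xd P (w d) \<epsilon>) - 0) < r"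
      proof (intro exI[of _ "max N d0"] allI impI)
        fix d assume "d \<ge> max N d0"
        then have "prob (Xstar P \<epsilon> - Xd P (w d) \<epsilon>) \<le> prob (S n) + J d * real (Suc n)" "\<bar>J d * real (Suc n)\<bar> < r / 2"
          using bound N by auto
        then show "norm (prob (Xstar P \<epsilon> - Xd P (w d) \<epsilon>) - 0) < r"
          using n by (simp add: abs_less_iff)
      qed
    qed
  qed
qed

end

section \<open>Strong duality and convergence of the inner approximations\<close>

theorem theorem4p3:
  fixes P :: "('n::finite, 'p::finite, 't::finite) data" and M :: real
  assumes "compact (XX P)" and "compact (AA P)"
    and "M > 0"
    and "1 \<le> ng P \<and> gg P 1 = ball_pol M"
    and "1 \<le> nq P \<and> qq P 1 = ball_pol M"
    and "compact (Om P) \<longrightarrow> 1 \<le> ns P \<and> ss P 1 = ball_pol M"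
    and "\<forall>j\<in>{1..ng P}. gg P j \<noteq> 0"
    and "\<forall>l\<in>{1..nq P}. qq P l \<noteq> 0"
    and "\<forall>l\<in>{1..ns P}. ss P l \<noteq> 0"
    and "\<forall>a\<in>AA P. mu P a \<in> prob_meas (Om P)"
    and "\<forall>B\<in>sets (borel_on (Om P)). (\<lambda>a. measure (mu P a) B) \<in> borel_measurable (borel_on (AA P))"
    and "\<forall>\<beta>. \<forall>a\<in>AA P. has_bochner_integral (mu P a) (\<lambda>\<omega>. mon_eval (($) \<omega>) \<beta>) (ev1 (pp P \<beta>) a)"
    and "\<forall>a\<in>AA P. \<forall>g. g \<noteq> 0 \<longrightarrow> measure (mu P a) {\<omega> \<in> Om P. ev1 g \<omega> = 0} = 0"
    and "\<forall>q. bdd_measurable_on (XX P \<times> Om P) q \<longrightarrow>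
           bdd_measurable_on (XX P \<times> AA P) (\<lambda>(x, a). \<integral>\<omega>. q (x, \<omega>) \<partial>(mu P a))"
    and "\<forall>q. bdd_continuous_on (XX P \<times> Om P) q \<longrightarrow>
           bdd_continuous_on (XX P \<times> AA P) (\<lambda>(x, a). \<integral>\<omega>. q (x, \<omega>) \<partial>(mu P a))"
    and "\<not> bounded (Om P) \<longrightarrow>
           (\<exists>c>0. \<exists>\<gamma>>0. \<forall>i. (SUP a\<in>AA P. \<integral>\<^sup>+ \<omega>. ennreal (exp (c * \<bar>\<omega> $ i\<bar>)) \<partial>(mu P a)) < ennreal \<gamma>)"
    and "interior (KK P) \<noteq> {}"
    and "interior (AA P) \<noteq> {}"
    and "interior (XX P \<times> Om P) \<noteq> {}"
    and "interior ((XX P \<times> Om P) - KK P) \<noteq> {}"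
  shows "(\<forall>d\<ge>dmin P. slater P d) \<and>
    (\<forall>d\<ge>dmin P. rho_dual P d = rho_sdp P d \<and> (\<exists>h w. dual_optimal P d h w)) \<and>
    (\<forall>h w. (\<forall>d\<ge>dmin P. dual_optimal P d (h d) (w d)) \<longrightarrow>
       (\<forall>\<epsilon>>0. \<forall>d\<ge>dmin P. Xd P (w d) \<epsilon> \<subseteq> Xstar P \<epsilon>) \<and>
       (rho_sdp P \<longlonglongrightarrow> rho P \<longrightarrow>
          (\<lambda>d. \<integral>\<^sup>+ x. ennreal \<bar>ev1 (w d) x - kappa P x\<bar> \<partial>(lam P)) \<longlonglongrightarrow> 0 \<and>
          (\<forall>\<epsilon>>0. (\<lambda>d. measure (lam P) (Xstar P \<epsilon> - Xd P (w d) \<epsilon>)) \<longlonglongrightarrow> 0)))"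
proof (intro conjI allI impI)
  interpret mixture_setting P
    by (rule mixture_setting.intro) (insert assms, simp_all)
  show "slater P d" for d by (rule slater)
  show "rho_dual P d = rho_sdp P d" "\<exists>h w. dual_optimal P d h w" for d
    by (rule strong_duality)+
  fix h w assume opt: "\<forall>d\<ge>dmin P. dual_optimal P d (h d) (w d)"
  show "Xd P (w d) \<epsilon> \<subseteq> Xstar P \<epsilon>" if "d \<ge> dmin P" for \<epsilon> d
    using opt that by (intro Xd_subset_Xstar) (auto simp: dual_optimal_def)
  assume lim: "rho_sdp P \<longlonglongrightarrow> rho P"
  show "(\<lambda>d. \<integral>\<^sup>+ x. ennreal \<bar>ev1 (w d) x - kappa P x\<bar> \<partial>(lam P)) \<longlonglongrightarrow> 0"
    using opt by (intro convergence(1)[OF _ lim]) auto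
  show "(\<lambda>d. measure (lam P) (Xstar P \<epsilon> - Xd P (w d) \<epsilon>)) \<longlonglongrightarrow> 0" for \<epsilon>
    using opt by (intro convergence(2)[OF _ lim]) auto
qed

end
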